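(* In the setting of non-commutative loops described in the context, let $a\in\mathfrak B^{0,1}$ be invertible and, for $\theta\in\mathbb R$, let $$\mathsf N(a,\theta)=\mathsf U_{\mathbb Z_0,\mathbb Z_1}(a,\theta)\;\mathsf L_{\mathbb Z_1}\;\widehat{\mathsf U}(a)^{-1}=\mathsf U_{\mathbb Z_0,\mathbb Z_1}(a,\theta)\,\mathsf U_{\mathbb Z_0,\mathbb Z_1}(a,\tfrac\pi2)^{-1}\,\mathsf L_{\mathbb Z}[a],$$ a $\mathbb Z\times\mathbb Z$ matrix. Then: (i) $\mathsf N(a,\theta)$ is a rapidly decreasing perturbation of $\mathsf L_{\mathbb Z}[0]$ with entries from $\mathfrak B^{0,1}$. (ii) $\mathsf N(a,0)=\mathsf U_{\mathbb Z_0,\mathbb Z_1}(a)\,\mathsf L_{\mathbb Z_1}\,\widehat{\mathsf U}(a)^{-1}$ has entries from $\mathfrak A\mathsf z^{1/2}\oplus\mathfrak A\mathsf z^{-1/2}$. (iii) $\mathsf N(a,\frac\pi2)=\mathsf L_{\mathbb Z}[a]$. (iv) In the special cases $a=\mathsf z^{\pm1/2}$, $$\mathsf N(\mathsf z^{1/2},\theta)=\mathsf L_{\mathbb Z}[\mathsf z^{1/2}]\,\mathsf A'_{\frac12}(\theta)\,\mathsf A'_{\frac12}(\tfrac\pi2)^{-1},\qquad \mathsf N(\mathsf z^{-1/2},\theta)=\mathsf L_{\mathbb Z}[\mathsf z^{-1/2}]\,\mathsf A'_{-\frac12}(-\theta)\,\mathsf A'_{-\frac12}(-\tfrac\pi2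)^{-1}.$$
   Context: Algebra. $\mathfrak A=\mathfrak A^+\oplus\mathfrak A^-$ is a unital superalgebra and $\mathfrak A[\mathsf z,\mathsf z^{-1}]$ is an extension by an invertible variable $\mathsf z$ (every element is uniquely a finite sum $\sum_{n\in\mathbb Z}\mathsf z^na_n$, $a_n\in\mathfrak A$) such that $\mathsf z^{\pm1}\mathfrak A^+\mathsf z^{\mp1}\subset\mathfrak A^+$ and $\mathsf z^{\pm1}\mathfrak A^-\mathsf z^{\pm1}\subset\mathfrak A^-$; it is thus $\mathbb Z/2\times\mathbb Z$-graded. It carries a locally convex algebra topology, and $\mathfrak B^{0,0}$ is the algebra of series $\sum_n\mathsf z^nb_n$, $b_n=b_n^++b_n^-$, whose homogeneous components $\mathsf z^nb_n^\pm$ are rapidly decreasing in $n$ for every continuous seminorm. Adjoin a formal symbol $\mathsf z^{1/2}$ with $\mathsf z^{1/2}\mathsf z^{1/2}=\mathsf z$, and set $\mathfrak B^{0,1}=\mathfrak B^{0,0}\mathsf z^{1/2}$, $\mathfrak B^{1,0}=\mathsf z^{1/2}\mathfrak B^{0,0}$, $\mathfrak B^{1,1}=\mathsf z^{1/2}\mathfrak B^{0,0}\mathsf z^{1/2}$; products $\mathfrak B^{i,j}\mathfrak B^{j,k}\subset\mathfrak B^{i,k}$ are defined in the obvious way. $a\in\mathfrak B^{0,1}$ is invertible if $a\mathsf z^{-1/2}$ is invertible in $\mathfrak B^{0,0}$ (then $a^{-1}\in\mathfrak B^{1,0}$). Notation. $\mathbb Z_0=\mathbb Z$, $\mathbb Z_1=\mathbb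 Z+\frac12$; $\mathbf e_{n,m}$ are matrix units, $\mathbf e_n$ column units, $\mathbf 1_S=\sum_{s\in S}\mathbf e_{s,s}$, $S^\pm=\{s\in S:\pm s>0\}$. For $a=\bigl(\sum_n\mathsf z^nb_n\bigr)\mathsf z^{1/2}\in\mathfrak B^{0,1}$ and $m\in\mathbb Z_1$ put $$a_{(m)}^+=\mathsf z^{m-\frac12}b^+_{m-\frac12}\mathsf z^{\frac12},\qquad a_{(m)}^-=\mathsf z^{m+\frac12}b^-_{m+\frac12}\mathsf z^{\frac12}.$$ (Thus $a^\pm_{(m)}=\mathsf z^ma_m^\pm$ in the expansion $a=\sum_{m\in\mathbb Z_1}\mathsf z^ma_m$.) The matrices of left multiplication by $a$ with respect to the basis $\mathbf e_n\leftrightarrow\mathsf z^n$ are $$\mathsf U_{\mathbb Z_i,\mathbb Z_j}(a)=\mathsf U^+_{\mathbb Z_i,\mathbb Z_j}(a)+\mathsf U^-_{\mathbb Z_i,\mathbb Z_j}(a),\qquad \mathsf U^{\pm}_{\mathbb Z_i,\mathbb Z_j}(a)=\sum_{n\in\mathbb Z_i,\,k\in\mathbb Z_j}\mathsf z^{-n}a^\pm_{(n\mp k)}\mathsf z^{k}\,\mathbf e_{n,k}\qquad(\{i,j\}=\{0,1\}).$$ Deformation. Let $t=\sin\theta$, $$\mathsf F_{\mathbb Z_0}(\theta)=\mathbf 1_{\mathbb Z\setminus\{0\}}+\cos\theta\,\mathbf e_{0,0}-t\sum_{n\ge1}(\mathbf e_{n,n-1}+\mathbf e_{-n,-n+1}),$$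 $$\mathsf F_{\mathbb Z_1}(\theta)=\mathbf 1_{\mathbb Z_1\setminus\{\pm\frac12\}}+\cos\tfrac\theta2(\mathbf e_{-\frac12,-\frac12}+\mathbf e_{\frac12,\frac12})-\sin\tfrac\theta2(\mathbf e_{-\frac12,\frac12}+\mathbf e_{\frac12,-\frac12})-t\sum_{n\in\mathbb Z_1,\,n\ge\frac32}(\mathbf e_{n,n-1}+\mathbf e_{-n,-n+1}).$$ For $\cos\theta\neq0$ put $\mathsf D_{\mathbb Z_i}(\theta)=\mathsf F_{\mathbb Z_i}(\theta)\sum_{k\in\mathbb Z,\,n\in\mathbb Z_i}w_k\mathbf e_{n+k,n}$, where $(1-2\cos x\sin\theta+\sin^2\theta)^{-1/2}=\sum_{k\in\mathbb Z} w_ke^{\mathrm ikx}$; these are real matrices. Let $\mathsf R_{\mathbb Z_i}=\sum_{n\in\mathbb Z_i}\mathsf z^{-n}\mathbf e_{n,n}$ and $$\mathsf U_{\mathbb Z_0,\mathbb Z_1}(a,\theta)=\mathsf R_{\mathbb Z_0}\mathsf D_{\mathbb Z_0}(\theta)\mathsf R_{\mathbb Z_0}^{-1}\;\mathsf U_{\mathbb Z_0,\mathbb Z_1}(a)\;\mathsf R_{\mathbb Z_1}\mathsf D_{\mathbb Z_1}(\theta)^{-1}\mathsf R_{\mathbb Z_1}^{-1},$$ extended by entrywise continuity to all $\theta\in\mathbb R$; $\mathsf U_{\mathbb Z_0,\mathbb Z_1}(a,0)=\mathsf U_{\mathbb Z_0,\mathbb Z_1}(a)$. Other matrices. $\mathsf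 L_{\mathbb Z_1}=\mathsf z^{1/2}\mathbf 1_{\mathbb Z_1^-}+\mathsf z^{-1/2}\mathbf 1_{\mathbb Z_1^+}$ and $\mathsf L_{\mathbb Z}[u]=\mathsf z^{1/2}\mathbf 1_{\mathbb Z^-}+u\,\mathbf e_{0,0}+\mathsf z^{-1/2}\mathbf 1_{\mathbb Z^+}$. With $$h=\sum_{n\in\mathbb Z_1^-}\mathbf e_{n-\frac12,n}-\sum_{n\in\mathbb Z_1^+}\mathbf e_{n+\frac12,n},\qquad h'=\Bigl(\sum_{n\in\mathbb Z^-}\mathbf e_{n-\frac12,n}+\tfrac{\sqrt2}2\mathbf e_{-\frac12,0}-\tfrac{\sqrt2}2\mathbf e_{\frac12,0}-\sum_{n\in\mathbb Z^+}\mathbf e_{n+\frac12,n}\Bigr)^{\!\top},$$ put $$\widehat{\mathsf U}(a)=h\,\bigl(\mathsf U^+_{\mathbb Z_1,\mathbb Z_0}(a)-\mathsf U^-_{\mathbb Z_1,\mathbb Z_0}(a)\bigr)\,h'+\tfrac{\sqrt2}2\,(\mathbf e_{0,-\frac12}+\mathbf e_{0,\frac12}),$$ a $\mathbb Z_0\times\mathbb Z_1$ matrix with entries in $\mathsf z^{1/2}\mathfrak A^+\mathsf z^{-1/2}\oplus\mathsf z^{1/2}\mathfrak A^-\mathsf z^{1/2}\subset\mathfrak B^{1,1}$. For $n\in\{\pm\frac12\}$, $\mathsf A'_n(\theta)$ is the $\mathbb Z\times\mathbb Z$ identity matrix with its $\{n-\frac12,n+\frac12\}\times\{n-\frac12,n+\frac12\}$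 block replaced by $\begin{bmatrix}\cos\frac\theta2&\sin\frac\theta2\\-\sin\frac\theta2&\cos\frac\theta2\end{bmatrix}$. Topology. A $\mathbb Z\times\mathbb Z$ matrix $(m_{p,q})$ over $\mathfrak B^{0,1}$ is called rapidly decreasing if the entries $\mathsf z^pm_{p,q}\mathsf z^{-q}$ of $\mathsf R_{\mathbb Z}^{-1}(m_{p,q})\mathsf R_{\mathbb Z}$ decrease faster than any power of $(1+|p|+|q|)^{-1}$ in every continuous seminorm ($\mathfrak B^{0,1}$ being identified with $\mathfrak B^{0,0}$ by $b\mathsf z^{1/2}\leftrightarrow b$); "perturbation of $\mathsf L_{\mathbb Z}[0]$" means that the difference from $\mathsf L_{\mathbb Z}[0]$ is rapidly decreasing. *)

theory Defs
  imports "HOL-Analysis.Analysis" "HOL-Library.Function_Algebras"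
begin

section \<open>Topological algebras and seminorms\<close>

text \<open>Joint continuity of the multiplication is part of \<^class>\<open>topological_semigroup_mult\<close>.
  Continuity of the scalar multiplication follows from the assumption \<open>locally_convex\<close>
  of the locale \<open>loop_algebra\<close> below.\<close>

class topological_real_algebra_1 =
  real_algebra_1 + topological_ab_group_add + topological_semigroup_mult + t2_space

definition continuous_seminorm :: "('a::topological_real_algebra_1 \<Rightarrow> real) \<Rightarrow> bool" where
  "continuous_seminorm p \<longleftrightarrow>
     (\<forall>x y. p (x + y) \<le> p x + p y) \<and> (\<forall>r x. p (r *\<^sub>R x) = \<bar>r\<bar> * p x) \<and> continuous_on UNIV p"

section \<open>The extension by an invertible variable\<close>

datatype parity = Even | Odd

definition padd :: "parity \<Rightarrow> parity \<Rightarrow> parity" where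
  "padd s t = (if s = t then Even else Odd)"

definition inv_elem :: "'a::monoid_mult \<Rightarrow> 'a" where
  "inv_elem x = (THE y. x * y = 1 \<and> y * x = 1)"

definition zpow :: "'a::monoid_mult \<Rightarrow> int \<Rightarrow> 'a" where
  "zpow z k = (if 0 \<le> k then z ^ nat k else inv_elem z ^ nat (- k))"

text \<open>The type \<^typ>\<open>'a\<close> is the extended algebra; the even and odd parts of the superalgebra are
  the subspaces \<open>A Even\<close> and \<open>A Odd\<close>. The assumption \<open>complete\<close> (convergence of rapidly decreasing
  series inside each of the two parts) is what makes the products of the series algebra below
  well-defined.\<close>

locale loop_algebra =
  fixes A :: "parity \<Rightarrow> 'a::topological_real_algebra_1 set" and z :: 'a
  assumes locally_convex: "open U \<Longrightarrow> w \<in> U \<Longrightarrow>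
          \<exists>p. continuous_seminorm p \<and> {y. p (y - w) < 1} \<subseteq> U"
    and subspace_A: "subspace (A s)"
    and one_in_A: "1 \<in> A Even"
    and mult_in_A: "x \<in> A s \<Longrightarrow> y \<in> A t \<Longrightarrow> x * y \<in> A (padd s t)"
    and A_direct: "A Even \<inter> A Odd = {0}"
    and z_invertible: "\<exists>y. z * y = 1 \<and> y * z = 1"
    and expansion: "\<exists>!c :: int \<Rightarrow> 'a. finite {n. c n \<noteq> 0} \<and>
          (\<forall>n. c n \<in> {x + y |x y. x \<in> A Even \<and> y \<in> A Odd}) \<and>
          w = (\<Sum>n | c n \<noteq> 0. zpow z n * c n)"
    and conj_Even: "x \<in> A Even \<Longrightarrow> z * x * inv_elem z \<in> A Even \<and> inv_elem z * x * z \<in> A Even"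
    and conj_Odd: "x \<in> A Odd \<Longrightarrow> z * x * z \<in> A Odd \<and> inv_elem z * x * inv_elem z \<in> A Odd"
    and complete: "(\<And>n::nat. f n \<in> A s) \<Longrightarrow>
          (\<And>p N. continuous_seminorm p \<Longrightarrow> \<exists>C. \<forall>n. (1 + real n) ^ N * p (f n) \<le> C) \<Longrightarrow>
          \<exists>y\<in>A s. f sums y"


section \<open>The series algebra and half-integral powers\<close>

text \<open>A series is stored by its homogeneous components: for \<open>b = (\<Sum>n. z\<^sup>n b\<^sub>n)\<close>, the value \<open>b s n\<close> is
  the product of \<open>z\<^sup>n\<close> with the parity \<open>s\<close> part of \<open>b\<^sub>n\<close>.\<close>

type_synonym 'a series = "parity \<Rightarrow> int \<Rightarrow> 'a"

definition B00 :: "(parity \<Rightarrow> 'a set) \<Rightarrow> 'a \<Rightarrow> 'a::topological_real_algebra_1 series set" where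
  "B00 A z = {b. (\<forall>s n. b s n \<in> (\<lambda>x. zpow z n * x) ` A s) \<and>
     (\<forall>p N. continuous_seminorm p \<longrightarrow>
        (\<exists>C. \<forall>s n. (1 + \<bar>real_of_int n\<bar>) ^ N * p (b s n) \<le> C))}"

text \<open>The seminorms defining the topology of the series algebra.\<close>

definition bnorm :: "('a \<Rightarrow> real) \<Rightarrow> nat \<Rightarrow> 'a series \<Rightarrow> real" where
  "bnorm p N b = (SUP (s, n). (1 + \<bar>real_of_int n\<bar>) ^ N * p (b s n))"

text \<open>An odd coefficient inverts the variable when moved past it, so \<open>z\<^sup>n b z\<^sup>m c\<close> has degree
  \<open>n + m\<close> for even \<open>b\<close> and \<open>n - m\<close> for odd \<open>b\<close>.\<close>

definition bmul :: "'a::topological_real_algebra_1 series \<Rightarrow> 'a series \<Rightarrow> 'a series" where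
  "bmul b c = (\<lambda>s k. \<Sum>\<^sub>\<infinity>n::int. b Even n * c s (k - n) + b Odd n * c (padd Odd s) (n - k))"

definition bscale :: "real \<Rightarrow> 'a::topological_real_algebra_1 series \<Rightarrow> 'a series" where
  "bscale r b = (\<lambda>s n. r *\<^sub>R b s n)"

definition bmono :: "'a::topological_real_algebra_1 \<Rightarrow> int \<Rightarrow> 'a series" where
  "bmono z k = (\<lambda>s n. if s = Even \<and> n = k then zpow z k else 0)"

definition embA :: "'a::topological_real_algebra_1 \<Rightarrow> 'a \<Rightarrow> 'a series" where
  "embA x y = (\<lambda>s n. if n = 0 then (case s of Even \<Rightarrow> x | Odd \<Rightarrow> y) else 0)"

text \<open>For \<open>i, j \<in> {0, 1}\<close> an element \<open>z\<^bsup>i/2\<^esup> b z\<^bsup>j/2\<^esup>\<close> of the space with superscripts \<open>i, j\<close> is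
  represented by \<open>b\<close>; the superscripts are passed separately where they matter.
  \<open>hmul z j\<close> is the product with middle superscript \<open>j\<close>, and \<open>hpow z i j x\<close> is
  \<open>z\<^sup>x = z\<^bsup>i/2\<^esup> z\<^bsup>x - (i + j)/2\<^esup> z\<^bsup>j/2\<^esup>\<close>, meaningful if \<open>x - (i + j)/2\<close> is an integer.
  In particular the unit of the spaces with \<open>i = j\<close> is \<open>hpow z i i 0\<close>.\<close>

definition hmul :: "'a::topological_real_algebra_1 \<Rightarrow> nat \<Rightarrow> 'a series \<Rightarrow> 'a series \<Rightarrow> 'a series" where
  "hmul z j b c = bmul (bmul b (bmono z (int j))) c"

definition hpow :: "'a::topological_real_algebra_1 \<Rightarrow> nat \<Rightarrow> nat \<Rightarrow> real \<Rightarrow> 'a series" where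
  "hpow z i j x = bmono z \<lfloor>x - (real i + real j) / 2\<rfloor>"

text \<open>Invertibility of the element \<open>a z\<^bsup>1/2\<^esup>\<close> with superscripts \<open>0, 1\<close>.\<close>

definition invertible01 :: "(parity \<Rightarrow> 'a set) \<Rightarrow> 'a::topological_real_algebra_1 \<Rightarrow> 'a series \<Rightarrow> bool" where
  "invertible01 A z a \<longleftrightarrow>
     (let b = hmul z 1 a (hpow z 1 0 (-1/2))
      in \<exists>c\<in>B00 A z. bmul b c = bmono z 0 \<and> bmul c b = bmono z 0)"


section \<open>Infinite matrices\<close>

definition ZZ :: "nat \<Rightarrow> real set" where
  "ZZ i = {real_of_int n + real i / 2 | n. True}"

text \<open>A \<open>ZZ p \<times> ZZ q\<close> matrix is a function of two real arguments of which only the values on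
  \<open>ZZ p \<times> ZZ q\<close> are meaningful.\<close>

type_synonym rmat = "real \<Rightarrow> real \<Rightarrow> real"
type_synonym 'a bmat = "real \<Rightarrow> real \<Rightarrow> 'a series"

definition rmul :: "nat \<Rightarrow> rmat \<Rightarrow> rmat \<Rightarrow> rmat" where
  "rmul q M N = (\<lambda>n k. \<Sum>\<^sub>\<infinity>l\<in>ZZ q. M n l * N l k)"

text \<open>The product over the middle index set \<open>ZZ q\<close>, with entries having middle superscript \<open>j\<close>.\<close>

definition mmul :: "'a::topological_real_algebra_1 \<Rightarrow> nat \<Rightarrow> nat \<Rightarrow> 'a bmat \<Rightarrow> 'a bmat \<Rightarrow> 'a bmat" where
  "mmul z q j M N = (\<lambda>n k s m. \<Sum>\<^sub>\<infinity>l\<in>ZZ q. hmul z j (M n l) (N l k) s m)"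

definition mat_eq :: "nat \<Rightarrow> nat \<Rightarrow> (real \<Rightarrow> real \<Rightarrow> 'b) \<Rightarrow> (real \<Rightarrow> real \<Rightarrow> 'b) \<Rightarrow> bool" where
  "mat_eq p q M N \<longleftrightarrow> (\<forall>n\<in>ZZ p. \<forall>k\<in>ZZ q. M n k = N n k)"

text \<open>A real matrix as a matrix over the series with superscripts \<open>i, i\<close>.\<close>

definition remb :: "'a::topological_real_algebra_1 \<Rightarrow> nat \<Rightarrow> rmat \<Rightarrow> 'a bmat" where
  "remb z i M = (\<lambda>n k. bscale (M n k) (hpow z i i 0))"

text \<open>Inverses of infinite matrices are taken among the matrices whose rows and columns are
  rapidly decreasing with tempered dependence on the column and row index, respectively.
  These matrices are closed under the (absolutely convergent) product, which is associative
  on them, so that inverses are unique. Over the series the growth is measured after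
  conjugation by the diagonal matrix of the powers of the variable.\<close>

definition tempered :: "nat \<Rightarrow> nat \<Rightarrow> (real \<Rightarrow> real \<Rightarrow> real) \<Rightarrow> bool" where
  "tempered p q f \<longleftrightarrow>
     (\<forall>N. \<exists>K C. \<forall>n\<in>ZZ p. \<forall>k\<in>ZZ q. (1 + \<bar>n\<bar>) ^ N * f n k \<le> C * (1 + \<bar>k\<bar>) ^ K) \<and>
     (\<forall>N. \<exists>K C. \<forall>n\<in>ZZ p. \<forall>k\<in>ZZ q. (1 + \<bar>k\<bar>) ^ N * f n k \<le> C * (1 + \<bar>n\<bar>) ^ K)"

definition rinv :: "nat \<Rightarrow> rmat \<Rightarrow> rmat" where
  "rinv i M = (THE M'. (\<forall>n k. n \<notin> ZZ i \<or> k \<notin> ZZ i \<longrightarrow> M' n k = 0) \<and>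
     tempered i i (\<lambda>n k. \<bar>M' n k\<bar>) \<and>
     mat_eq i i (rmul i M M') (\<lambda>n k. of_bool (n = k)) \<and>
     mat_eq i i (rmul i M' M) (\<lambda>n k. of_bool (n = k)))"

text \<open>The entries \<open>z\<^sup>n m\<^bsub>n,k\<^esub> z\<^bsup>-k\<^esup>\<close> for a \<open>ZZ p \<times> ZZ q\<close> matrix with entries of superscripts \<open>i, j\<close>.\<close>

definition zconj :: "'a::topological_real_algebra_1 \<Rightarrow> nat \<Rightarrow> nat \<Rightarrow> nat \<Rightarrow> nat \<Rightarrow> 'a bmat \<Rightarrow> 'a bmat" where
  "zconj z p q i j M = (\<lambda>n k.
     hmul z j (hmul z i (hpow z ((p + i) mod 2) i n) (M n k)) (hpow z j ((q + j) mod 2) (- k)))"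

definition tempered_mat ::
  "(parity \<Rightarrow> 'a::topological_real_algebra_1 set) \<Rightarrow> 'a \<Rightarrow> nat \<Rightarrow> nat \<Rightarrow> nat \<Rightarrow> nat \<Rightarrow> 'a bmat \<Rightarrow> bool" where
  "tempered_mat A z p q i j M \<longleftrightarrow>
     (\<forall>n\<in>ZZ p. \<forall>k\<in>ZZ q. M n k \<in> B00 A z) \<and>
     (\<forall>pp N. continuous_seminorm pp \<longrightarrow> tempered p q (\<lambda>n k. bnorm pp N (zconj z p q i j M n k)))"

text \<open>\<open>M'\<close> is the inverse of the \<open>ZZ p \<times> ZZ q\<close> matrix \<open>M\<close>, both with entries of superscripts \<open>i, i\<close>.\<close>

definition is_minv ::
  "(parity \<Rightarrow> 'a::topological_real_algebra_1 set) \<Rightarrow> 'a \<Rightarrow> nat \<Rightarrow> nat \<Rightarrow> nat \<Rightarrow> 'a bmat \<Rightarrow> 'a bmat \<Rightarrow> bool" where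
  "is_minv A z p q i M M' \<longleftrightarrow>
     tempered_mat A z p q i i M \<and> tempered_mat A z q p i i M' \<and>
     (\<forall>n k. n \<notin> ZZ q \<or> k \<notin> ZZ p \<longrightarrow> M' n k = 0) \<and>
     mat_eq p p (mmul z q i M M') (remb z i (\<lambda>n k. of_bool (n = k))) \<and>
     mat_eq q q (mmul z p i M' M) (remb z i (\<lambda>n k. of_bool (n = k)))"

definition minv ::
  "(parity \<Rightarrow> 'a::topological_real_algebra_1 set) \<Rightarrow> 'a \<Rightarrow> nat \<Rightarrow> nat \<Rightarrow> nat \<Rightarrow> 'a bmat \<Rightarrow> 'a bmat" where
  "minv A z p q i M = (THE M'. is_minv A z p q i M M')"

text \<open>For \<open>ZZ 0 \<times> ZZ 0\<close> matrices with entries of superscripts \<open>0, 1\<close>.\<close>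

definition rapidly_decreasing_mat ::
  "(parity \<Rightarrow> 'a::topological_real_algebra_1 set) \<Rightarrow> 'a \<Rightarrow> 'a bmat \<Rightarrow> bool" where
  "rapidly_decreasing_mat A z M \<longleftrightarrow>
     (\<forall>n\<in>ZZ 0. \<forall>k\<in>ZZ 0. M n k \<in> B00 A z) \<and>
     (\<forall>pp N K. continuous_seminorm pp \<longrightarrow>
        (\<exists>C. \<forall>n\<in>ZZ 0. \<forall>k\<in>ZZ 0. (1 + \<bar>n\<bar> + \<bar>k\<bar>) ^ K * bnorm pp N (zconj z 0 0 0 1 M n k) \<le> C))"


section \<open>The matrices of left multiplication\<close>

text \<open>The component of \<open>a z\<^bsup>1/2\<^esup>\<close> of parity \<open>s\<close> and half-integral degree \<open>m\<close>, again represented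
  without the factor \<open>z\<^bsup>1/2\<^esup>\<close>.\<close>

definition acomp :: "parity \<Rightarrow> 'a::topological_real_algebra_1 series \<Rightarrow> real \<Rightarrow> 'a series" where
  "acomp s a m =
     (let d = (case s of Even \<Rightarrow> \<lfloor>m - 1/2\<rfloor> | Odd \<Rightarrow> \<lfloor>m + 1/2\<rfloor>)
      in (\<lambda>t n. if t = s \<and> n = d then a t n else 0))"

text \<open>The \<open>ZZ i \<times> ZZ (1 - i)\<close> matrix; its entries have superscripts \<open>i, i\<close>.\<close>

definition Upart :: "'a::topological_real_algebra_1 \<Rightarrow> parity \<Rightarrow> nat \<Rightarrow> 'a series \<Rightarrow> 'a bmat" where
  "Upart z s i a = (\<lambda>n k.
     hmul z 1
       (hmul z 0 (hpow z i 0 (- n)) (acomp s a (case s of Even \<Rightarrow> n - k | Odd \<Rightarrow> n + k)))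
       (hpow z 1 i k))"

definition Umat :: "'a::topological_real_algebra_1 \<Rightarrow> nat \<Rightarrow> 'a series \<Rightarrow> 'a bmat" where
  "Umat z i a = Upart z Even i a + Upart z Odd i a"


section \<open>The deformation\<close>

definition Fmat :: "nat \<Rightarrow> real \<Rightarrow> rmat" where
  "Fmat i \<theta> = (\<lambda>n m.
     if i = 0 then
       of_bool (n = m \<and> n \<noteq> 0) + cos \<theta> * of_bool (n = 0 \<and> m = 0)
       - sin \<theta> * (of_bool (n \<ge> 1 \<and> m = n - 1) + of_bool (n \<le> -1 \<and> m = n + 1))
     else
       of_bool (n = m \<and> \<bar>n\<bar> \<noteq> 1/2) + cos (\<theta>/2) * of_bool (n = m \<and> \<bar>n\<bar> = 1/2)
       - sin (\<theta>/2) * of_bool (n = - m \<and> \<bar>n\<bar> = 1/2)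
       - sin \<theta> * (of_bool (n \<ge> 3/2 \<and> m = n - 1) + of_bool (n \<le> -3/2 \<and> m = n + 1)))"

definition wcoef :: "real \<Rightarrow> int \<Rightarrow> real" where
  "wcoef \<theta> = (THE w. \<forall>x::real.
     ((\<lambda>k. complex_of_real (w k) * exp (\<i> * of_int k * of_real x)) has_sum
       complex_of_real ((1 - 2 * cos x * sin \<theta> + (sin \<theta>)\<^sup>2) powr (-1/2))) UNIV)"

definition Dmat :: "nat \<Rightarrow> real \<Rightarrow> rmat" where
  "Dmat i \<theta> = rmul i (Fmat i \<theta>) (\<lambda>n m. wcoef \<theta> \<lfloor>n - m\<rfloor>)"

text \<open>The entries of \<open>Rmat z i\<close> have superscripts \<open>0, i\<close>, those of its inverse \<open>Rmat_inv z i\<close>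
  have superscripts \<open>i, 0\<close>.\<close>

definition Rmat :: "'a::topological_real_algebra_1 \<Rightarrow> nat \<Rightarrow> 'a bmat" where
  "Rmat z i = (\<lambda>n k. if n = k then hpow z 0 i (- n) else 0)"

definition Rmat_inv :: "'a::topological_real_algebra_1 \<Rightarrow> nat \<Rightarrow> 'a bmat" where
  "Rmat_inv z i = (\<lambda>n k. if n = k then hpow z i 0 n else 0)"

text \<open>The formula for the deformed matrix, meaningful for \<open>cos \<theta> \<noteq> 0\<close>.\<close>

definition Udef_regular :: "'a::topological_real_algebra_1 \<Rightarrow> 'a series \<Rightarrow> real \<Rightarrow> 'a bmat" where
  "Udef_regular z a \<theta> =
     (let X = mmul z 0 0 (mmul z 0 0 (Rmat z 0) (remb z 0 (Dmat 0 \<theta>))) (Rmat_inv z 0);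
          Y = mmul z 1 1 (mmul z 1 1 (Rmat z 1) (remb z 1 (rinv 1 (Dmat 1 \<theta>)))) (Rmat_inv z 1)
      in mmul z 1 0 (mmul z 0 0 X (Umat z 0 a)) Y)"

text \<open>At the exceptional angles the components of the entries are defined as limits; convergence
  in the topology of the series algebra is the predicate \<open>Udef_extends\<close>.\<close>

definition Udef :: "'a::topological_real_algebra_1 \<Rightarrow> 'a series \<Rightarrow> real \<Rightarrow> 'a bmat" where
  "Udef z a \<theta> =
     (if cos \<theta> \<noteq> 0 then Udef_regular z a \<theta>
      else (\<lambda>n k s m. Lim (at \<theta>) (\<lambda>\<theta>'. Udef_regular z a \<theta>' n k s m)))"

definition Udef_extends ::
  "(parity \<Rightarrow> 'a::topological_real_algebra_1 set) \<Rightarrow> 'a \<Rightarrow> 'a series \<Rightarrow> bool" where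
  "Udef_extends A z a \<longleftrightarrow>
     (\<forall>\<theta>. \<forall>n\<in>ZZ 0. \<forall>k\<in>ZZ 1. Udef z a \<theta> n k \<in> B00 A z) \<and>
     (\<forall>\<theta>. cos \<theta> = 0 \<longrightarrow> (\<forall>n\<in>ZZ 0. \<forall>k\<in>ZZ 1. \<forall>p N. continuous_seminorm p \<longrightarrow>
        ((\<lambda>\<theta>'. bnorm p N (Udef z a \<theta>' n k - Udef z a \<theta> n k)) \<longlongrightarrow> 0) (at \<theta>)))"


section \<open>The other matrices\<close>

text \<open>The entries of \<open>Lmat1\<close> and \<open>Lmat\<close> have superscripts \<open>0, 1\<close>.\<close>

definition Lmat1 :: "'a::topological_real_algebra_1 \<Rightarrow> 'a bmat" where
  "Lmat1 z = (\<lambda>n k. if n \<noteq> k then 0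
     else if n < 0 then hpow z 0 1 (1/2) else hpow z 0 1 (-1/2))"

definition Lmat :: "'a::topological_real_algebra_1 \<Rightarrow> 'a series \<Rightarrow> 'a bmat" where
  "Lmat z u = (\<lambda>n k. if n \<noteq> k then 0
     else if n < 0 then hpow z 0 1 (1/2) else if n = 0 then u else hpow z 0 1 (-1/2))"

definition hmat :: rmat where
  "hmat n k = of_bool (k < 0 \<and> n = k - 1/2) - of_bool (k > 0 \<and> n = k + 1/2)"

definition hmat_pre :: rmat where
  "hmat_pre n k = of_bool (k < 0 \<and> n = k - 1/2) + sqrt 2 / 2 * of_bool (n = -1/2 \<and> k = 0)
     - sqrt 2 / 2 * of_bool (n = 1/2 \<and> k = 0) - of_bool (k > 0 \<and> n = k + 1/2)"

definition hmat' :: rmat where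
  "hmat' n k = hmat_pre k n"

text \<open>A \<open>ZZ 0 \<times> ZZ 1\<close> matrix with entries of superscripts \<open>1, 1\<close>.\<close>

definition Uhat :: "'a::topological_real_algebra_1 \<Rightarrow> 'a series \<Rightarrow> 'a bmat" where
  "Uhat z a =
     mmul z 0 1 (mmul z 1 1 (remb z 1 hmat) (Upart z Even 1 a - Upart z Odd 1 a)) (remb z 1 hmat')
     + remb z 1 (\<lambda>n k. sqrt 2 / 2 * of_bool (n = 0 \<and> (k = -1/2 \<or> k = 1/2)))"

definition Aprime :: "real \<Rightarrow> real \<Rightarrow> rmat" where
  "Aprime \<nu> \<theta> = (\<lambda>n k.
     if n = \<nu> - 1/2 \<and> k = \<nu> - 1/2 then cos (\<theta>/2)
     else if n = \<nu> - 1/2 \<and> k = \<nu> + 1/2 then sin (\<theta>/2)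
     else if n = \<nu> + 1/2 \<and> k = \<nu> - 1/2 then - sin (\<theta>/2)
     else if n = \<nu> + 1/2 \<and> k = \<nu> + 1/2 then cos (\<theta>/2)
     else of_bool (n = k))"

definition Nmat ::
  "(parity \<Rightarrow> 'a::topological_real_algebra_1 set) \<Rightarrow> 'a \<Rightarrow> 'a series \<Rightarrow> real \<Rightarrow> 'a bmat" where
  "Nmat A z a \<theta> = mmul z 1 1 (mmul z 1 0 (Udef z a \<theta>) (Lmat1 z)) (minv A z 0 1 1 (Uhat z a))"

end

theory Submission
  imports Defs
begin

text \<open>The components \<open>z\<^sup>d A\<^sup>\<plusminus>\<close> grade the algebra by the infinite dihedral group. Conjugating a matrix
  by the powers of \<open>z\<close> and absorbing the half powers turns all products in question into products of
  integer-indexed matrices of tempered growth, which are associative. In this picture every entry of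
  \<open>U(a, \<theta>)\<close> is a sum of real multiples of the graded components of \<open>a\<close>. As the matrices
  \<open>D(\<theta>)\<close> are orthogonal, the multiples depend only on the square of the series of the \<open>w\<^sub>k\<close>, whose
  coefficients are geometric, so they are explicit and extend continuously to \<open>cos \<theta> = 0\<close>.

  At \<open>\<theta> = pi/2\<close> the matrix decomposes, up to signs and a rotation of two columns, as left
  multiplication by \<open>a\<close> in a shifted basis plus the single entry \<open>a\<close>; replacing \<open>a\<close> by its inverse
  inverts it. A change of basis turns it into the matrix \<open>Uhat\<close>, so
  \<open>N(a, \<theta>) = U(a, \<theta>) U(a, pi/2)\<^sup>-\<^sup>1 L[a]\<close> is explicit. The multiples that depend on
  \<open>\<theta>\<close> belong to rows, columns and degrees in which the indices are dominated by the degree, so that the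
  decay of \<open>a\<close> makes \<open>N(a, \<theta>) - L[0]\<close> rapidly decreasing. At \<open>\<theta> = 0\<close> the factors have few
  degrees in each entry, and for \<open>a = z\<^sup>1\<^sup>/\<^sup>2\<close> and \<open>a = z\<^sup>-\<^sup>1\<^sup>/\<^sup>2\<close> the matrix \<open>U(a, \<theta>)\<close> differs
  from \<open>U(a, pi/2)\<close> by a rotation.\<close>

instance topological_real_algebra_1 \<subseteq> t3_space
proof
  fix S :: "'a set" and y
  assume S: "closed S" "y \<notin> S"
  have "open ((\<lambda>(u, v). y + (u - v)) -` (- S))"
    by (rule open_vimage) (use S in \<open>auto simp: case_prod_unfold intro!: continuous_intros\<close>)
  then obtain O1 O2 where O: "open O1" "open O2" "0 \<in> O1" "0 \<in> O2"
      "O1 \<times> O2 \<subseteq> (\<lambda>(u, v). y + (u - v)) -` (- S)"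
    using S(2) by (auto elim!: open_prod_elim[of _ "(0, 0)"])
  have "open ((\<lambda>x. x - y) -` O1)" for y
    by (rule open_vimage[OF O(1)]) (auto intro!: continuous_intros)
  moreover have "open ((\<lambda>x. x - y) -` O2)" for y
    by (rule open_vimage[OF O(2)]) (auto intro!: continuous_intros)
  ultimately have "open ((\<lambda>x. x - y) -` O1)" "open (\<Union>s\<in>S. (\<lambda>x. x - s) -` O2)"
    by auto
  moreover have "y \<in> (\<lambda>x. x - y) -` O1" "S \<subseteq> (\<Union>s\<in>S. (\<lambda>x. x - s) -` O2)"
    using O by auto
  moreover have "(\<lambda>x. x - y) -` O1 \<inter> (\<Union>s\<in>S. (\<lambda>x. x - s) -` O2) = {}"
  proof (rule ccontr)
    assume "\<not> ?thesis"
    then obtain x s where x: "x - y \<in> O1" "s \<in> S" "x - s \<in> O2" by auto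
    then have "(x - y, x - s) \<in> (\<lambda>(u, v). y + (u - v)) -` (- S)"
      using O by blast
    then show False using x by simp
  qed
  ultimately show "\<exists>U V. open U \<and> open V \<and> y \<in> U \<and> S \<subseteq> V \<and> U \<inter> V = {}" by blast
qed

section \<open>Continuous seminorms\<close>

lemma cs_triangle: "continuous_seminorm p \<Longrightarrow> p (x + y) \<le> p x + p y"
  and cs_scale: "continuous_seminorm p \<Longrightarrow> p (r *\<^sub>R x) = \<bar>r\<bar> * p x"
  and cs_cont: "continuous_seminorm p \<Longrightarrow> continuous_on UNIV p"
  by (auto simp: continuous_seminorm_def)

lemma cs_zero: "continuous_seminorm p \<Longrightarrow> p 0 = 0"
  using cs_scale[of p 0 0] by simp

lemma cs_minus: "continuous_seminorm p \<Longrightarrow> p (- x) = p x"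
  using cs_scale[of p "-1" x] by simp

lemma cs_nonneg: "continuous_seminorm p \<Longrightarrow> 0 \<le> p x"
  using cs_triangle[of p x "-x"] by (simp add: cs_minus cs_zero)

lemma cs_sum: "continuous_seminorm p \<Longrightarrow> p (sum f F) \<le> (\<Sum>i\<in>F. p (f i))"
proof (induction F rule: infinite_finite_induct)
  case (insert x F)
  then show ?case using cs_triangle[of p "f x" "sum f F"] by simp
qed (auto simp: cs_zero)

lemma cs_isCont: "continuous_seminorm p \<Longrightarrow> isCont p x"
  by (metis UNIV_I continuous_on_eq_continuous_within cs_cont)

lemma cs_add:
  assumes "continuous_seminorm p" "continuous_seminorm q"
  shows "continuous_seminorm (\<lambda>x. p x + q x)"
  unfolding continuous_seminorm_def
proof (intro conjI allI)
  show "p (x + y) + q (x + y) \<le> p x + q x + (p y + q y)" for x y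
    using cs_triangle[OF assms(1), of x y] cs_triangle[OF assms(2), of x y] by linarith
  show "p (r *\<^sub>R x) + q (r *\<^sub>R x) = \<bar>r\<bar> * (p x + q x)" for r x
    by (simp add: assms cs_scale algebra_simps)
  show "continuous_on UNIV (\<lambda>x. p x + q x)"
    by (intro continuous_intros cs_cont assms)
qed

lemma cs_mult_both:
  assumes "continuous_seminorm p"
  shows "continuous_seminorm (\<lambda>x. p (b * x * c))"
  unfolding continuous_seminorm_def
proof (intro conjI allI)
  show "p (b * (x + y) * c) \<le> p (b * x * c) + p (b * y * c)" for x y
    using cs_triangle[OF assms, of "b * x * c" "b * y * c"] by (simp add: algebra_simps)
  show "p (b * (r *\<^sub>R x) * c) = \<bar>r\<bar> * p (b * x * c)" for r x
    by (simp add: cs_scale[OF assms, symmetric])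
  have "continuous_on UNIV (\<lambda>x. b * x * c)" by (intro continuous_intros)
  then show "continuous_on UNIV (\<lambda>x. p (b * x * c))"
    by (rule continuous_on_compose2[OF cs_cont[OF assms]]) auto
qed

lemma cs_has_sum_le:
  assumes p: "continuous_seminorm p" and f: "(f has_sum y) I"
    and s: "(\<lambda>i. p (f i)) summable_on I"
  shows "p y \<le> infsum (\<lambda>i. p (f i)) I"
proof (rule tendsto_upperbound)
  show "((\<lambda>F. p (sum f F)) \<longlongrightarrow> p y) (finite_subsets_at_top I)"
    using f unfolding has_sum_def by (rule isCont_tendsto_compose[OF cs_isCont[OF p]])
  show "\<forall>\<^sub>F F in finite_subsets_at_top I. p (sum f F) \<le> infsum (\<lambda>i. p (f i)) I"
    unfolding eventually_finite_subsets_at_top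
  proof (intro exI[of _ "{}"] conjI allI impI)
    fix F assume F: "finite F \<and> {} \<subseteq> F \<and> F \<subseteq> I"
    have "p (sum f F) \<le> (\<Sum>i\<in>F. p (f i))" by (rule cs_sum[OF p])
    also have "\<dots> \<le> infsum (\<lambda>i. p (f i)) I"
      by (rule finite_sum_le_infsum) (use s F p cs_nonneg in auto)
    finally show "p (sum f F) \<le> infsum (\<lambda>i. p (f i)) I" .
  qed auto
qed simp

section \<open>Index sets of polynomial growth\<close>

definition poly_size :: "('i \<Rightarrow> real) \<Rightarrow> 'i set \<Rightarrow> bool" where
  "poly_size \<sigma> I \<longleftrightarrow> (\<forall>i\<in>I. 0 \<le> \<sigma> i) \<and>
     (\<exists>(\<phi>::'i \<Rightarrow> nat) C K. inj_on \<phi> I \<and> (\<forall>i\<in>I. 1 + real (\<phi> i) \<le> C * (1 + \<sigma> i) ^ K))"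

lemma poly_sizeE:
  assumes "poly_size \<sigma> I"
  obtains \<phi> :: "'i \<Rightarrow> nat" and C K where "inj_on \<phi> I"
    "\<And>i. i \<in> I \<Longrightarrow> 1 + real (\<phi> i) \<le> C * (1 + \<sigma> i) ^ K" "0 < C" "\<And>i. i \<in> I \<Longrightarrow> 0 \<le> \<sigma> i"
proof -
  from assms obtain \<phi> :: "'i \<Rightarrow> nat" and C K where *: "inj_on \<phi> I"
    "\<And>i. i \<in> I \<Longrightarrow> 1 + real (\<phi> i) \<le> C * (1 + \<sigma> i) ^ K" "\<And>i. i \<in> I \<Longrightarrow> 0 \<le> \<sigma> i"
    unfolding poly_size_def by blast
  have "1 + real (\<phi> i) \<le> max 1 C * (1 + \<sigma> i) ^ K" if "i \<in> I" for i
  proof -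
    have "C * (1 + \<sigma> i) ^ K \<le> max 1 C * (1 + \<sigma> i) ^ K"
      using *(3)[OF that] by (intro mult_right_mono) auto
    then show ?thesis using *(2)[OF that] by linarith
  qed
  then show ?thesis using * by (intro that[of \<phi> "max 1 C" K]) auto
qed

lemma poly_sizeI:
  fixes \<phi> :: "'i \<Rightarrow> nat"
  assumes "inj_on \<phi> I" "\<And>i. i \<in> I \<Longrightarrow> 1 + real (\<phi> i) \<le> C * (1 + \<sigma> i) ^ K"
    "\<And>i. i \<in> I \<Longrightarrow> 0 \<le> \<sigma> i"
  shows "poly_size \<sigma> I"
  using assms unfolding poly_size_def by blast

lemma poly_size_int: "poly_size (\<lambda>n::int. \<bar>real_of_int n\<bar>) UNIV"
proof (rule poly_sizeI[where \<phi> = int_encode and C = 2 and K = 1])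
  show "inj_on int_encode UNIV" by (rule inj_int_encode)
qed (auto simp: int_encode_def sum_encode_def)

lemma poly_size_parity: "poly_size (\<lambda>s::parity. 0) UNIV"
  by (rule poly_sizeI[where \<phi> = "case_parity 0 1" and C = 2 and K = 1]) (auto simp: inj_on_def split: parity.splits)

lemma prod_encode_le: "1 + real (prod_encode (a, b)) \<le> ((1 + real a) * (1 + real b)) ^ 2"
proof -
  have tri: "triangle n \<le> n * n" for n
    by (induction n) auto
  have "1 + prod_encode (a, b) \<le> 1 + (a + b) * (a + b) + a"
    using tri[of "a + b"] by (simp add: prod_encode_def)
  also have "\<dots> \<le> ((1 + a) * (1 + b)) ^ 2"
    by (simp add: power2_eq_square algebra_simps)
  finally have "real (1 + prod_encode (a, b)) \<le> real (((1 + a) * (1 + b)) ^ 2)"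
    by (simp only: of_nat_le_iff)
  then show ?thesis by (simp only: of_nat_add of_nat_mult of_nat_power of_nat_1)
qed

lemma poly_size_times:
  assumes "poly_size \<sigma> I" "poly_size \<tau> J"
  shows "poly_size (\<lambda>(i, j). \<sigma> i + \<tau> j) (I \<times> J)"
proof -
  from poly_sizeE[OF assms(1)] obtain \<phi> :: "_ \<Rightarrow> nat" and C K where 1: "inj_on \<phi> I"
    "\<And>i. i \<in> I \<Longrightarrow> 1 + real (\<phi> i) \<le> C * (1 + \<sigma> i) ^ K" "0 < C" "\<And>i. i \<in> I \<Longrightarrow> 0 \<le> \<sigma> i" by metis
  from poly_sizeE[OF assms(2)] obtain \<psi> :: "_ \<Rightarrow> nat" and D L where 2: "inj_on \<psi> J"
    "\<And>i. i \<in> J \<Longrightarrow> 1 + real (\<psi> i) \<le> D * (1 + \<tau> i) ^ L" "0 < D" "\<And>i. i \<in> J \<Longrightarrow> 0 \<le> \<tau> i" by metis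
  show ?thesis
    unfolding poly_size_def
  proof (intro conjI exI[of _ "\<lambda>(i,j). prod_encode (\<phi> i, \<psi> j)"] exI[of _ "(C * D)^2"]
      exI[of _ "2 * (K + L)"] ballI)
    show "inj_on (\<lambda>(i,j). prod_encode (\<phi> i, \<psi> j)) (I \<times> J)"
      using 1(1) 2(1) by (auto simp: inj_on_def)
    fix x assume "x \<in> I \<times> J"
    then obtain i j where x: "x = (i, j)" "i \<in> I" "j \<in> J" by auto
    show "0 \<le> (case x of (i, j) \<Rightarrow> \<sigma> i + \<tau> j)" using 1(4) 2(4) x by auto
    have "1 + real (prod_encode (\<phi> i, \<psi> j)) \<le> ((1 + real (\<phi> i)) * (1 + real (\<psi> j))) ^ 2"
      by (rule prod_encode_le)
    also have "\<dots> \<le> ((C * (1 + \<sigma> i) ^ K) * (D * (1 + \<tau> j) ^ L)) ^ 2"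
      using 1 2 x by (intro power_mono mult_mono) auto
    also have "\<dots> \<le> ((C * (1 + (\<sigma> i + \<tau> j)) ^ K) * (D * (1 + (\<sigma> i + \<tau> j)) ^ L)) ^ 2"
      using 1 2 x by (intro power_mono mult_mono) (auto intro!: mult_left_mono power_mono)
    also have "\<dots> = (C * D)^2 * (1 + (\<sigma> i + \<tau> j)) ^ (2 * (K + L))"
      by (simp add: power_mult_distrib power_add power_mult mult.commute[of 2])
    finally show "1 + real (case x of (i, j) \<Rightarrow> prod_encode (\<phi> i, \<psi> j))
      \<le> (C * D)^2 * (1 + (case x of (i, j) \<Rightarrow> \<sigma> i + \<tau> j)) ^ (2 * (K + L))"
      using x by simp
  qed
qed

lemma poly_size_summable:
  assumes "poly_size \<sigma> I"
  shows "\<exists>K. (\<lambda>i. 1 / (1 + \<sigma> i) ^ K) summable_on I"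
proof -
  from poly_sizeE[OF assms] obtain \<phi> :: "_ \<Rightarrow> nat" and C K where 1: "inj_on \<phi> I"
    "\<And>i. i \<in> I \<Longrightarrow> 1 + real (\<phi> i) \<le> C * (1 + \<sigma> i) ^ K" "0 < C" "\<And>i. i \<in> I \<Longrightarrow> 0 \<le> \<sigma> i" by metis
  have "summable (\<lambda>n. 1 / (1 + real n) ^ 2)"
    using inverse_power_summable[of 2, where 'a=real]
    using summable_Suc_iff[of "\<lambda>n. inverse (real n ^ 2)"] by (simp add: inverse_eq_divide add.commute)
  then have "(\<lambda>n. 1 / (1 + real n) ^ 2) summable_on UNIV"
    by (subst summable_on_UNIV_nonneg_real_iff) auto
  then have "(\<lambda>n. 1 / (1 + real n) ^ 2) summable_on (\<phi> ` I)"
    by (rule summable_on_subset_banach) auto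
  then have "(\<lambda>i. 1 / (1 + real (\<phi> i)) ^ 2) summable_on I"
    using 1(1) by (subst (asm) summable_on_reindex) (auto simp: o_def)
  then have s: "(\<lambda>i. C^2 * (1 / (1 + real (\<phi> i)) ^ 2)) summable_on I"
    by (rule summable_on_cmult_right)
  have "(\<lambda>i. 1 / (1 + \<sigma> i) ^ (2 * K)) summable_on I"
  proof (rule summable_on_comparison_test[OF s])
    fix i assume i: "i \<in> I"
    have "(1 + real (\<phi> i))^2 \<le> (C * (1 + \<sigma> i) ^ K)^2"
      using 1 i by (intro power_mono) auto
    also have "\<dots> = C^2 * (1 + \<sigma> i) ^ (2 * K)"
      by (simp add: power_mult_distrib power_mult[symmetric] mult.commute)
    finally have *: "(1 + real (\<phi> i))^2 \<le> C^2 * (1 + \<sigma> i) ^ (2 * K)" .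
    have "0 < (1 + \<sigma> i) ^ (2 * K)" using 1(4)[OF i] by simp
    then show "1 / (1 + \<sigma> i) ^ (2 * K) \<le> C^2 * (1 / (1 + real (\<phi> i)) ^ 2)"
      using * by (simp add: field_simps)
    show "0 \<le> 1 / (1 + \<sigma> i) ^ (2 * K)" using 1(4)[OF i] by simp
  qed
  then show ?thesis by blast
qed

definition rapid_fam :: "('i \<Rightarrow> real) \<Rightarrow> 'i set \<Rightarrow> ('i \<Rightarrow> 'a::topological_real_algebra_1) \<Rightarrow> bool" where
  "rapid_fam \<sigma> I f \<longleftrightarrow>
     (\<forall>p N. continuous_seminorm p \<longrightarrow> (\<exists>C. \<forall>i\<in>I. (1 + \<sigma> i) ^ N * p (f i) \<le> C))"

lemma rapid_fam_summable:
  assumes "poly_size \<sigma> I" "rapid_fam \<sigma> I f" "continuous_seminorm p"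
  shows "(\<lambda>i. p (f i)) summable_on I"
proof -
  from poly_size_summable[OF assms(1)] obtain K where
    K: "(\<lambda>i. 1 / (1 + \<sigma> i) ^ K) summable_on I" by blast
  from assms obtain C where C: "\<And>i. i \<in> I \<Longrightarrow> (1 + \<sigma> i) ^ K * p (f i) \<le> C"
    unfolding rapid_fam_def by blast
  have s: "(\<lambda>i. C * (1 / (1 + \<sigma> i) ^ K)) summable_on I"
    by (rule summable_on_cmult_right[OF K])
  show ?thesis
  proof (rule summable_on_comparison_test[OF s])
    fix i assume i: "i \<in> I"
    have "0 \<le> \<sigma> i" using assms(1) i by (auto simp: poly_size_def)
    then have "0 < (1 + \<sigma> i) ^ K" by simp
    then show "p (f i) \<le> C * (1 / (1 + \<sigma> i) ^ K)"
      using C[OF i] by (simp add: field_simps)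
  qed (simp add: assms cs_nonneg)
qed

context loop_algebra
begin

lemma sums_imp_has_sum:
  fixes f :: "nat \<Rightarrow> 'a"
  assumes f: "f sums y" and s: "\<And>p. continuous_seminorm p \<Longrightarrow> summable (\<lambda>n. p (f n))"
  shows "(f has_sum y) UNIV"
  unfolding has_sum_def
proof (rule topological_tendstoI)
  fix U assume U: "open U" "y \<in> U"
  from locally_convex[OF U] obtain p where p: "continuous_seminorm p" "{x. p (x - y) < 1} \<subseteq> U"
    by blast
  have "((\<lambda>n. p (sum f {..<n} - y)) \<longlongrightarrow> p (y - y)) sequentially"
    using f unfolding sums_def
    by (intro isCont_tendsto_compose[OF cs_isCont[OF p(1)]] tendsto_intros)
  then have "\<forall>\<^sub>F n in sequentially. p (sum f {..<n} - y) < 1 / 2"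
    by (rule order_tendstoD) (simp add: cs_zero[OF p(1)])
  then obtain N1 where N1: "\<And>n. n \<ge> N1 \<Longrightarrow> p (sum f {..<n} - y) < 1 / 2"
    by (auto simp: eventually_sequentially)
  from s[OF p(1)] have "summable (\<lambda>n. p (f n))" .
  then obtain N2 where N2: "\<And>m n. m \<ge> N2 \<Longrightarrow> norm (\<Sum>i=m..<n. p (f i)) < 1 / 2"
    unfolding summable_Cauchy by (metis half_gt_zero zero_less_one)
  define N where "N = max N1 N2"
  show "\<forall>\<^sub>F F in finite_subsets_at_top UNIV. sum f F \<in> U"
    unfolding eventually_finite_subsets_at_top
  proof (intro exI[of _ "{..<N}"] conjI allI impI)
    fix F :: "nat set" assume F: "finite F \<and> {..<N} \<subseteq> F \<and> F \<subseteq> UNIV"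
    then obtain M where M: "F \<subseteq> {..<M}"
      using finite_nat_bounded by blast
    have "sum f F = sum f {..<N} + sum f (F - {..<N})"
      using F by (metis add.commute sum.subset_diff)
    then have "p (sum f F - y) \<le> p (sum f {..<N} - y) + p (sum f (F - {..<N}))"
      using cs_triangle[OF p(1), of "sum f {..<N} - y" "sum f (F - {..<N})"]
      by (simp add: algebra_simps)
    also have "p (sum f (F - {..<N})) \<le> (\<Sum>i\<in>F - {..<N}. p (f i))"
      by (rule cs_sum[OF p(1)])
    also have "\<dots> \<le> (\<Sum>i=N..<M. p (f i))"
      using M by (intro sum_mono2) (auto simp: cs_nonneg[OF p(1)])
    also have "\<dots> < 1 / 2" using N2[of N M] by (simp add: N_def)
    also have "p (sum f {..<N} - y) < 1 / 2" using N1[of N] by (simp add: N_def)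
    finally show "sum f F \<in> U" using p(2) by auto
  qed auto
qed

lemma rapid_has_sum_A:
  assumes I: "poly_size \<sigma> I" and r: "rapid_fam \<sigma> I f" and f: "\<And>i. i \<in> I \<Longrightarrow> f i \<in> A s"
  shows "\<exists>y\<in>A s. (f has_sum y) I"
proof -
  from poly_sizeE[OF I] obtain \<phi> :: "_ \<Rightarrow> nat" and C K where 1: "inj_on \<phi> I"
    "\<And>i. i \<in> I \<Longrightarrow> 1 + real (\<phi> i) \<le> C * (1 + \<sigma> i) ^ K" "0 < C" "\<And>i. i \<in> I \<Longrightarrow> 0 \<le> \<sigma> i" by metis
  define F where "F n = (if n \<in> \<phi> ` I then f (inv_into I \<phi> n) else 0)" for n
  have F\<phi>: "F (\<phi> i) = f i" if "i \<in> I" for i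
    using that 1(1) by (simp add: F_def)
  have F0: "F n = 0" if "n \<notin> \<phi> ` I" for n using that by (simp add: F_def)
  have FA: "F n \<in> A s" for n
    using f subspace_A[of s] by (auto simp: F_def inv_into_into subspace_0)
  have bd: "\<exists>B. \<forall>n. (1 + real n) ^ N * p (F n) \<le> B" if p: "continuous_seminorm p" for p N
  proof -
    from r p obtain B where B: "\<And>i. i \<in> I \<Longrightarrow> (1 + \<sigma> i) ^ (K * N) * p (f i) \<le> B"
      unfolding rapid_fam_def by blast
    have "(1 + real n) ^ N * p (F n) \<le> max 0 (C ^ N * B)" for n
    proof (cases "n \<in> \<phi> ` I")
      case True
      then obtain i where i: "i \<in> I" "n = \<phi> i" by blast
      have "(1 + real n) ^ N * p (F n) \<le> (C * (1 + \<sigma> i) ^ K) ^ N * p (f i)"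
        using 1(2)[OF i(1)] i F\<phi>[OF i(1)] by (auto intro!: mult_right_mono power_mono cs_nonneg[OF p])
      also have "\<dots> = C ^ N * ((1 + \<sigma> i) ^ (K * N) * p (f i))"
        by (simp add: power_mult_distrib power_mult)
      also have "\<dots> \<le> C ^ N * B" using B[OF i(1)] 1(3) by (intro mult_left_mono) auto
      finally show ?thesis by simp
    qed (simp add: F0 cs_zero[OF p])
    then show ?thesis by blast
  qed
  obtain y where y: "y \<in> A s" "F sums y"
    using complete[of F s, OF FA bd] by blast
  have "rapid_fam real UNIV F"
    using bd by (auto simp: rapid_fam_def)
  moreover have "poly_size real UNIV"
    by (rule poly_sizeI[where \<phi> = id and C = 1 and K = 1]) auto
  ultimately have "(\<lambda>n. p (F n)) summable_on UNIV" if "continuous_seminorm p" for p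
    using rapid_fam_summable that by blast
  then have "summable (\<lambda>n. p (F n))" if "continuous_seminorm p" for p
    using that summable_on_imp_summable by blast
  from sums_imp_has_sum[OF y(2) this] have "(F has_sum y) UNIV" .
  then have "(F has_sum y) (\<phi> ` I)"
    by (rule has_sum_cong_neutral[THEN iffD1, rotated -1]) (auto simp: F0)
  then have "((F \<circ> \<phi>) has_sum y) I"
    using 1(1) by (simp add: has_sum_reindex)
  then have "(f has_sum y) I"
    by (rule has_sum_cong[THEN iffD1, rotated]) (simp add: F\<phi>)
  then show ?thesis using y by blast
qed

lemma cs_mult_bound:
  assumes p: "continuous_seminorm p"
  obtains q where "continuous_seminorm q" "\<And>x y :: 'a. p (x * y) \<le> q x * q y" "\<And>x. p x \<le> q x"
proof -
  have "open ((\<lambda>(u, v). p (u * v)) -` {..<1})"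
    by (rule open_vimage)
       (auto simp: case_prod_unfold intro!: continuous_intros continuous_on_compose2[OF cs_cont[OF p]])
  then obtain O1 O2 where O: "open O1" "open O2" "(0::'a) \<in> O1" "(0::'a) \<in> O2"
      "O1 \<times> O2 \<subseteq> (\<lambda>(u, v). p (u * v)) -` {..<1}"
    by (auto elim!: open_prod_elim[of _ "(0, 0)"] simp: cs_zero[OF p])
  from locally_convex[OF O(1,3)] obtain q1 where q1: "continuous_seminorm q1" "{y. q1 (y - 0) < 1} \<subseteq> O1"
    by blast
  from locally_convex[OF O(2,4)] obtain q2 where q2: "continuous_seminorm q2" "{y. q2 (y - 0) < 1} \<subseteq> O2"
    by blast
  define q where "q x = p x + (q1 x + q2 x)" for x
  have q: "continuous_seminorm q"
    unfolding q_def by (intro cs_add p q1 q2)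
  have le1: "p (x * y) < 1" if "q x < 1" "q y < 1" for x y
  proof -
    have "x \<in> O1" "y \<in> O2"
      using that q1(2) q2(2) cs_nonneg[OF p, of x] cs_nonneg[OF p, of y]
        cs_nonneg[OF q1(1), of y] cs_nonneg[OF q2(1), of x]
      unfolding q_def by auto
    then show ?thesis using O(5) by auto
  qed
  have le: "p (x * y) \<le> (q x + e) * (q y + e)" if "e > 0" for x y e
  proof -
    have pos: "q x + e > 0" "q y + e > 0" using that cs_nonneg[OF q, of x] cs_nonneg[OF q, of y] by auto
    have "p (((1 / (q x + e)) *\<^sub>R x) * ((1 / (q y + e)) *\<^sub>R y)) < 1"
      using pos that by (intro le1) (auto simp: cs_scale[OF q] field_simps)
    then have "p ((1 / (q x + e) * (1 / (q y + e))) *\<^sub>R (x * y)) < 1"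
      by (simp add: mult.commute)
    then have "1 / ((q x + e) * (q y + e)) * p (x * y) < 1"
      using pos by (subst (asm) cs_scale[OF p]) (simp add: abs_mult)
    then show ?thesis using pos by (simp add: divide_less_eq)
  qed
  have "p (x * y) \<le> q x * q y" for x y
  proof (rule tendsto_lowerbound)
    show "((\<lambda>e. (q x + e) * (q y + e)) \<longlongrightarrow> q x * q y) (at_right 0)"
      by (auto intro!: tendsto_eq_intros)
    show "\<forall>\<^sub>F e in at_right 0. p (x * y) \<le> (q x + e) * (q y + e)"
      using le by (auto simp: eventually_at_right_field intro!: exI[of _ 1])
  qed simp
  moreover have "p x \<le> q x" for x
    using cs_nonneg[OF q1(1), of x] cs_nonneg[OF q2(1), of x] by (simp add: q_def)
  ultimately show ?thesis using q that by blast
qed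

lemma tendsto_scaleR_elem: "((\<lambda>r. r *\<^sub>R (x::'a)) \<longlongrightarrow> r0 *\<^sub>R x) (nhds r0)"
proof (rule topological_tendstoI)
  fix U assume U: "open U" "r0 *\<^sub>R x \<in> U"
  from locally_convex[OF U] obtain p where p: "continuous_seminorm p" "{y. p (y - r0 *\<^sub>R x) < 1} \<subseteq> U"
    by blast
  have "((\<lambda>r. \<bar>r - r0\<bar> * p x) \<longlongrightarrow> \<bar>r0 - r0\<bar> * p x) (nhds r0)"
    by (intro tendsto_intros filterlim_ident)
  then have "\<forall>\<^sub>F r in nhds r0. \<bar>r - r0\<bar> * p x < 1"
    by (rule order_tendstoD) simp
  then show "\<forall>\<^sub>F r in nhds r0. r *\<^sub>R x \<in> U"
  proof eventually_elim
    case (elim r)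
    have "p (r *\<^sub>R x - r0 *\<^sub>R x) = \<bar>r - r0\<bar> * p x"
      by (simp add: scaleR_diff_left[symmetric] cs_scale[OF p(1)])
    then show ?case using elim p(2) by auto
  qed
qed

lemma has_sum_scaleR_elem:
  assumes "(f has_sum r) I"
  shows "((\<lambda>i. f i *\<^sub>R (x::'a)) has_sum (r *\<^sub>R x)) I"
  using filterlim_compose[OF tendsto_scaleR_elem assms[unfolded has_sum_def]]
  by (simp add: has_sum_def scaleR_sum_left)

end

section \<open>The grading by the infinite dihedral group\<close>

type_synonym dih = "parity \<times> int"

text \<open>The pair \<open>(s, d)\<close> stands for the degree of \<open>z\<^sup>d A\<^sup>s\<close>; odd elements of the algebra
  invert the powers of \<open>z\<close> they pass.\<close>

definition gm :: "dih \<Rightarrow> dih \<Rightarrow> dih" where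
  "gm g h = (padd (fst g) (fst h), if fst g = Even then snd g + snd h else snd g - snd h)"

definition gi :: "dih \<Rightarrow> dih" where
  "gi g = (fst g, if fst g = Even then - snd g else snd g)"

definition gsz :: "dih \<Rightarrow> real" where
  "gsz g = \<bar>real_of_int (snd g)\<bar>"

definition ev :: "'a series \<Rightarrow> dih \<Rightarrow> 'a" where
  "ev b g = b (fst g) (snd g)"

lemma ev_pair [simp]: "ev b (s, m) = b s m"
  by (simp add: ev_def)

lemma ev_eqI: "(\<And>g. ev b g = ev c g) \<Longrightarrow> b = c"
  by (intro ext) (metis ev_pair)

lemma parity_UNIV: "(UNIV :: parity set) = {Even, Odd}"
  using parity.exhaust by auto

lemma neq_Even [simp]: "s \<noteq> Even \<longleftrightarrow> s = Odd" "Even \<noteq> s \<longleftrightarrow> s = Odd"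
    "s \<noteq> Odd \<longleftrightarrow> s = Even" "Odd \<noteq> s \<longleftrightarrow> s = Even"
  by (cases s; simp)+

lemma padd_simps [simp]: "padd Even s = s" "padd s Even = s" "padd s s = Even"
    "padd Odd (padd Odd s) = s" "padd Odd s = Even \<longleftrightarrow> s = Odd" "padd Odd s = Odd \<longleftrightarrow> s = Even"
  by (cases s; simp add: padd_def)+

lemma gm_assoc: "gm (gm g h) k = gm g (gm h k)"
  by (cases "fst g"; cases "fst h"; cases "fst k") (simp_all add: gm_def padd_def)

lemma gm_one [simp]: "gm (Even, 0) g = g" "gm g (Even, 0) = g"
  by (cases g; auto simp: gm_def)+

lemma gm_gi [simp]: "gm (gi g) g = (Even, 0)" "gm g (gi g) = (Even, 0)"
  by (cases g; auto simp: gm_def gi_def)+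

lemma gm_gi_cancel [simp]: "gm (gi g) (gm g h) = h" "gm g (gm (gi g) h) = h"
  by (simp_all add: gm_assoc[symmetric])

lemma gi_gi [simp]: "gi (gi g) = g"
  by (cases g) (auto simp: gi_def)

lemma gi_gm: "gi (gm g h) = gm (gi h) (gi g)"
  by (metis gm_assoc gm_gi(2) gm_gi_cancel(1) gm_one(2))

lemma gsz_nonneg [simp]: "0 \<le> gsz g"
  by (simp add: gsz_def)

lemma gsz_gm: "gsz (gm g h) \<le> gsz g + gsz h"
  by (auto simp: gsz_def gm_def)

lemma gsz_gm_mult: "1 + gsz (gm g h) \<le> (1 + gsz g) * (1 + gsz h)"
proof -
  have "0 \<le> gsz g * gsz h" by simp
  moreover have "(1 + gsz g) * (1 + gsz h) = 1 + (gsz g + gsz h) + gsz g * gsz h"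
    by (simp add: algebra_simps)
  ultimately show ?thesis using gsz_gm[of g h] by linarith
qed

lemma poly_size_dih: "poly_size gsz UNIV"
proof -
  have "poly_size (\<lambda>(s::parity, n::int). 0 + \<bar>real_of_int n\<bar>) (UNIV \<times> UNIV)"
    by (rule poly_size_times[OF poly_size_parity poly_size_int])
  moreover have "(\<lambda>(s::parity, n::int). 0 + \<bar>real_of_int n\<bar>) = gsz"
    by (auto simp: gsz_def)
  ultimately show ?thesis by simp
qed

abbreviation lsz :: "int \<times> dih \<Rightarrow> real" where
  "lsz \<equiv> (\<lambda>(l, g). \<bar>real_of_int l\<bar> + gsz g)"

lemma poly_size_lsz: "poly_size lsz UNIV"
  using poly_size_times[OF poly_size_int poly_size_dih] by simp

lemma tempered_product_bound:
  fixes a b c s t x y :: real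
  assumes ge: "1 \<le> a" "1 \<le> b" "1 \<le> s" "1 \<le> t" "0 \<le> x" "0 \<le> y"
    and N1: "N + M \<le> N1" and N2: "K1 + N + M \<le> N2"
    and 1: "a ^ N1 * s ^ N1 * x \<le> C1 * b ^ K1" and 2: "b ^ N2 * t ^ N2 * y \<le> C2 * c"
    and C1: "0 \<le> C1"
  shows "a ^ N * (s * t) ^ N * (b * s * t) ^ M * (x * y) \<le> C1 * C2 * c"
proof -
  have "a ^ N * (s * t) ^ N * (b * s * t) ^ M * (x * y)
      = (a ^ N * s ^ (N + M) * x) * (b ^ M * t ^ (N + M) * y)"
    by (simp add: power_mult_distrib power_add mult_ac)
  also have "\<dots> \<le> (a ^ N1 * s ^ N1 * x) * (b ^ M * t ^ (N + M) * y)"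
    using ge N1 by (intro mult_right_mono mult_mono power_increasing) auto
  also have "\<dots> \<le> (C1 * b ^ K1) * (b ^ M * t ^ (N + M) * y)"
    using ge by (intro mult_right_mono 1) auto
  also have "\<dots> = C1 * (b ^ (K1 + M) * t ^ (N + M) * y)"
    by (simp add: power_add mult_ac)
  also have "\<dots> \<le> C1 * (b ^ N2 * t ^ N2 * y)"
    using ge N2 C1 by (intro mult_left_mono mult_right_mono mult_mono power_increasing) auto
  also have "\<dots> \<le> C1 * (C2 * c)" by (intro mult_left_mono 2 C1)
  finally show ?thesis by (simp add: mult_ac)
qed

lemma (in loop_algebra) has_sum_mult_both:
  assumes "(f has_sum (y::'a)) I"
  shows "((\<lambda>i. b * f i * c) has_sum (b * y * c)) I"
proof -
  have "continuous_on UNIV (\<lambda>x. b * x * c)" by (intro continuous_intros)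
  then have "isCont (\<lambda>x. b * x * c) y"
    by (simp add: continuous_on_eq_continuous_within)
  from isCont_tendsto_compose[OF this assms[unfolded has_sum_def]]
  show ?thesis by (simp add: has_sum_def sum_distrib_left sum_distrib_right)
qed

section \<open>Powers of the variable\<close>

context loop_algebra
begin

lemma z_inv: "z * inv_elem z = 1" "inv_elem z * z = 1"
proof -
  obtain y where y: "z * y = 1" "y * z = 1" using z_invertible by blast
  have "inv_elem z = y"
    unfolding inv_elem_def
  proof (rule the_equality)
    fix y' assume y': "z * y' = 1 \<and> y' * z = 1"
    have "y' = y' * (z * y)" using y by simp
    also have "\<dots> = y" using y' by (simp add: mult.assoc[symmetric])
    finally show "y' = y" .
  qed (use y in simp)
  then show "z * inv_elem z = 1" "inv_elem z * z = 1" using y by auto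
qed

lemma zpow_0 [simp]: "zpow z 0 = 1" and zpow_1: "zpow z 1 = z" and zpow_m1: "zpow z (-1) = inv_elem z"
  by (simp_all add: zpow_def)

lemma zpow_Suc: "zpow z (m + 1) = zpow z m * z"
proof (cases "0 \<le> m")
  case True
  then have "nat (m + 1) = Suc (nat m)" by simp
  then show ?thesis using True by (simp add: zpow_def power_Suc2 del: power_Suc)
next
  case False
  then have *: "nat (- m) = Suc (nat (- (m + 1)))" by simp
  have "inv_elem z ^ nat (- m) * z = inv_elem z ^ nat (- (m + 1))"
    unfolding * by (simp add: power_Suc2 z_inv mult.assoc del: power_Suc)
  then show ?thesis using False by (cases "m = -1") (auto simp: zpow_def z_inv)
qed

lemma zpow_add_nat: "zpow z (m + int n) = zpow z m * zpow z (int n)"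
proof (induction n)
  case (Suc n)
  have "zpow z (m + int (Suc n)) = zpow z (m + int n) * z"
    using zpow_Suc[of "m + int n"] by (simp add: algebra_simps)
  also have "\<dots> = zpow z m * (zpow z (int n) * z)" using Suc by (simp add: mult.assoc)
  also have "zpow z (int n) * z = zpow z (int (Suc n))"
    using zpow_Suc[of "int n"] by (simp add: algebra_simps)
  finally show ?case .
qed simp

lemma zpow_cancel: "zpow z (- int n) * zpow z (int n) = 1" "zpow z (int n) * zpow z (- int n) = 1"
proof -
  show 1: "zpow z (- int n) * zpow z (int n) = 1"
    using zpow_add_nat[of "- int n" n] by simp
  have "zpow z (int n) * zpow z (- int n) = z ^ n * inv_elem z ^ n"
    by (auto simp: zpow_def)
  also have "\<dots> = 1"
  proof (induction n)
    case (Suc n)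
    have "z ^ Suc n * inv_elem z ^ Suc n = z ^ n * (z * inv_elem z) * inv_elem z ^ n"
      by (simp only: power_Suc2[of z] power_Suc[of "inv_elem z"] mult.assoc)
    then show ?case using Suc by (simp add: z_inv)
  qed simp
  finally show "zpow z (int n) * zpow z (- int n) = 1" .
qed

lemma zpow_add: "zpow z (m + n) = zpow z m * zpow z n"
proof (cases "0 \<le> n")
  case True then show ?thesis using zpow_add_nat[of m "nat n"] by simp
next
  case False
  have "zpow z m = zpow z (m + n) * zpow z (- n)"
    using zpow_add_nat[of "m + n" "nat (- n)"] False by simp
  then have "zpow z m * zpow z n = zpow z (m + n) * (zpow z (- n) * zpow z n)"
    by (simp add: mult.assoc)
  also have "zpow z (- n) * zpow z n = 1" using zpow_cancel(2)[of "nat (- n)"] False by simp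
  finally show ?thesis by simp
qed

lemma zpow_inv [simp]: "zpow z m * zpow z (- m) = 1" "zpow z (- m) * zpow z m = 1"
    "zpow z m * (zpow z (- m) * x) = x" "zpow z (- m) * (zpow z m * x) = x"
  by (simp_all flip: zpow_add mult.assoc)

lemma zpow_conj_Even: "x \<in> A Even \<Longrightarrow> zpow z m * x * zpow z (- m) \<in> A Even"
proof (induction m arbitrary: x rule: int_induct[of _ 0])
  case (step1 i)
  have "zpow z (i + 1) * x * zpow z (- (i + 1)) = zpow z i * (z * x * inv_elem z) * zpow z (- i)"
  proof -
    have "zpow z (i + 1) * x * zpow z (- (i + 1)) = zpow z (i + 1) * x * zpow z (- 1 + - i)"
      by (simp only: minus_add_distrib add.commute)
    then show ?thesis unfolding zpow_add by (simp add: zpow_1 zpow_m1 mult.assoc)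
  qed
  then show ?case using step1 conj_Even by simp
next
  case (step2 i)
  have "zpow z (i - 1) * x * zpow z (- (i - 1)) = zpow z i * (inv_elem z * x * z) * zpow z (- i)"
  proof -
    have "zpow z (i - 1) * x * zpow z (- (i - 1)) = zpow z (i + - 1) * x * zpow z (1 + - i)"
      by (simp add: algebra_simps)
    then show ?thesis unfolding zpow_add by (simp add: zpow_1 zpow_m1 mult.assoc)
  qed
  then show ?case using step2 conj_Even by simp
qed simp

lemma zpow_conj_Odd: "x \<in> A Odd \<Longrightarrow> zpow z m * x * zpow z m \<in> A Odd"
proof (induction m arbitrary: x rule: int_induct[of _ 0])
  case (step1 i)
  have "zpow z (i + 1) * x * zpow z (i + 1) = zpow z i * (z * x * z) * zpow z i"
    using zpow_add[of i 1] zpow_add[of 1 i] by (simp add: zpow_1 mult.assoc add.commute)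
  then show ?case using step1 conj_Odd by simp
next
  case (step2 i)
  have "zpow z (i - 1) * x * zpow z (i - 1) = zpow z i * (inv_elem z * x * inv_elem z) * zpow z i"
  proof -
    have "zpow z (i - 1) * x * zpow z (i - 1) = zpow z (i + - 1) * x * zpow z (- 1 + i)" by simp
    then show ?thesis unfolding zpow_add by (simp add: zpow_m1 mult.assoc)
  qed
  then show ?case using step2 conj_Odd by simp
qed simp

definition Hg :: "dih \<Rightarrow> 'a set" where
  "Hg g = (\<lambda>x. zpow z (snd g) * x) ` A (fst g)"

lemma Hg_iff: "x \<in> Hg g \<longleftrightarrow> zpow z (- snd g) * x \<in> A (fst g)"
proof
  assume "x \<in> Hg g"
  then show "zpow z (- snd g) * x \<in> A (fst g)" by (auto simp: Hg_def)
next
  assume "zpow z (- snd g) * x \<in> A (fst g)"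
  then show "x \<in> Hg g" unfolding Hg_def by (intro image_eqI[of _ _ "zpow z (- snd g) * x"]) simp_all
qed

lemma Hg_0 [simp]: "0 \<in> Hg g"
  using subspace_0[OF subspace_A] by (simp add: Hg_iff)

lemma Hg_add: "x \<in> Hg g \<Longrightarrow> y \<in> Hg g \<Longrightarrow> x + y \<in> Hg g"
  by (simp add: Hg_iff distrib_left subspace_add[OF subspace_A])

lemma Hg_scale: "x \<in> Hg g \<Longrightarrow> r *\<^sub>R x \<in> Hg g"
  by (simp add: Hg_iff subspace_scale[OF subspace_A])

lemma zpow_Hg: "zpow z d \<in> Hg (Even, d)"
  using one_in_A by (simp add: Hg_iff)

lemma Hg_mult:
  assumes "x \<in> Hg g" "y \<in> Hg h"
  shows "x * y \<in> Hg (gm g h)"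
proof -
  obtain s m t n where [simp]: "g = (s, m)" "h = (t, n)" by (cases g, cases h)
  from assms obtain x' y' where x: "x = zpow z m * x'" "x' \<in> A s" and y: "y = zpow z n * y'" "y' \<in> A t"
    by (auto simp: Hg_def)
  show ?thesis
  proof (cases s)
    case Even
    have "zpow z (- m - n) * (x * y) = zpow z (- n) * x' * zpow z n * y'"
    proof -
      have "zpow z (- m - n) = zpow z (- n) * zpow z (- m)"
        by (metis zpow_add add.commute diff_conv_add_uminus)
      then show ?thesis by (simp add: x y mult.assoc)
    qed
    moreover have "zpow z (- n) * x' * zpow z n * y' \<in> A (padd s t)"
      using mult_in_A[OF zpow_conj_Even[of x' "- n"] y(2)] x(2) Even by simp
    ultimately show ?thesis using Even by (simp add: Hg_iff gm_def)
  next
    case Odd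
    have "zpow z (n - m) * (x * y) = zpow z n * x' * zpow z n * y'"
      using zpow_add[of n "- m"] by (simp add: x y mult.assoc)
    moreover have "zpow z n * x' * zpow z n * y' \<in> A (padd s t)"
      using mult_in_A[OF zpow_conj_Odd[of x' n] y(2)] x(2) Odd by simp
    ultimately show ?thesis using Odd by (simp add: Hg_iff gm_def)
  qed
qed

lemma rapid_has_sum:
  assumes I: "poly_size \<sigma> I" and r: "rapid_fam \<sigma> I f" and f: "\<And>i. i \<in> I \<Longrightarrow> f i \<in> Hg g"
  shows "\<exists>y\<in>Hg g. (f has_sum y) I"
proof -
  have "rapid_fam \<sigma> I (\<lambda>i. zpow z (- snd g) * f i)"
    unfolding rapid_fam_def
  proof (intro allI impI)
    fix p :: "'a \<Rightarrow> real" and N assume "continuous_seminorm p"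
    from cs_mult_both[OF this, of "zpow z (- snd g)" 1] r
    show "\<exists>C. \<forall>i\<in>I. (1 + \<sigma> i) ^ N * p (zpow z (- snd g) * f i) \<le> C"
      unfolding rapid_fam_def by fastforce
  qed
  from rapid_has_sum_A[OF I this, of "fst g"] f obtain y where
    y: "y \<in> A (fst g)" "((\<lambda>i. zpow z (- snd g) * f i) has_sum y) I"
    by (auto simp: Hg_iff)
  from has_sum_mult_both[OF y(2), of "zpow z (snd g)" 1]
  have "(f has_sum (zpow z (snd g) * y)) I" by simp
  moreover have "zpow z (snd g) * y \<in> Hg g" using y(1) by (simp add: Hg_iff)
  ultimately show ?thesis by blast
qed

section \<open>The series algebra\<close>

lemma B00_iff: "b \<in> B00 A z \<longleftrightarrow> (\<forall>g. ev b g \<in> Hg g) \<and> rapid_fam gsz UNIV (ev b)"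
  unfolding B00_def rapid_fam_def Hg_def ev_def gsz_def by auto

lemma B00_ev: "b \<in> B00 A z \<Longrightarrow> ev b g \<in> Hg g"
  unfolding B00_iff by blast

lemma bmul_has_sum:
  assumes b: "b \<in> B00 A z" and c: "c \<in> B00 A z"
  shows "((\<lambda>g. ev b g * ev c (gm (gi g) u)) has_sum ev (bmul b c) u) UNIV"
proof -
  let ?f = "\<lambda>g. ev b g * ev c (gm (gi g) u)"
  have mem: "?f g \<in> Hg u" for g
    using Hg_mult[OF B00_ev[OF b] B00_ev[OF c], of g "gm (gi g) u"] by simp
  have "rapid_fam gsz UNIV ?f"
    unfolding rapid_fam_def
  proof (intro allI impI)
    fix p :: "'a \<Rightarrow> real" and N assume "continuous_seminorm p"
    then obtain q where q: "continuous_seminorm q" "\<And>x y. p (x * y) \<le> q x * q y"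
      using cs_mult_bound by metis
    from b q(1) obtain C where C: "\<And>g. (1 + gsz g) ^ N * q (ev b g) \<le> C"
      unfolding B00_iff rapid_fam_def by blast
    from c q(1) obtain D where D: "\<And>g. (1 + gsz g) ^ 0 * q (ev c g) \<le> D"
      unfolding B00_iff rapid_fam_def by (metis UNIV_I)
    have "(1 + gsz g) ^ N * p (?f g) \<le> C * D" for g
    proof -
      have "(1 + gsz g) ^ N * p (?f g) \<le> (1 + gsz g) ^ N * (q (ev b g) * q (ev c (gm (gi g) u)))"
        by (intro mult_left_mono q(2)) auto
      also have "\<dots> = ((1 + gsz g) ^ N * q (ev b g)) * q (ev c (gm (gi g) u))" by simp
      also have "\<dots> \<le> C * D"
        using C[of g] D[of "gm (gi g) u"] by (intro mult_mono) (auto simp: cs_nonneg[OF q(1)] intro: order_trans[OF _ C[of g]])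
      finally show ?thesis .
    qed
    then show "\<exists>C. \<forall>i\<in>UNIV. (1 + gsz i) ^ N * p (?f i) \<le> C" by blast
  qed
  from rapid_has_sum[OF poly_size_dih this mem] obtain y where y: "(?f has_sum y) UNIV" by blast
  have "(?f has_sum y) (prod.swap ` (UNIV \<times> UNIV))"
    using y by (simp add: product_swap[of UNIV UNIV, simplified])
  then have "((?f \<circ> prod.swap) has_sum y) (UNIV \<times> UNIV)"
    by (subst (asm) has_sum_reindex) auto
  then have "((\<lambda>n. \<Sum>s\<in>UNIV. ?f (s, n)) has_sum y) UNIV"
    by (rule has_sum_SigmaD) (auto intro!: has_sum_finiteI simp: parity_UNIV)
  moreover have "(\<Sum>s\<in>UNIV. ?f (s, n)) = b Even n * c (fst u) (snd u - n) + b Odd n * c (padd Odd (fst u)) (n - snd u)" for n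
    by (simp add: parity_UNIV gm_def gi_def ev_def)
  ultimately have "ev (bmul b c) u = y"
    unfolding ev_def[of "bmul b c"] unfolding bmul_def by (simp add: infsumI)
  then show ?thesis using y by simp
qed

end

context loop_algebra
begin

section \<open>Tempered matrices\<close>

text \<open>Rows and columns are indexed by the integers, and the entries are multiplied by the plain
  product of series.\<close>

definition tm :: "(int \<Rightarrow> int \<Rightarrow> 'a series) \<Rightarrow> bool" where
  "tm X \<longleftrightarrow> (\<forall>n k g. ev (X n k) g \<in> Hg g) \<and>
     (\<forall>p N. continuous_seminorm p \<longrightarrow> (\<exists>K C. 0 \<le> C \<and> (\<forall>n k g.
        (1 + \<bar>real_of_int n\<bar>) ^ N * (1 + gsz g) ^ N * p (ev (X n k) g) \<le> C * (1 + \<bar>real_of_int k\<bar>) ^ K))) \<and>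
     (\<forall>p N. continuous_seminorm p \<longrightarrow> (\<exists>K C. 0 \<le> C \<and> (\<forall>n k g.
        (1 + \<bar>real_of_int k\<bar>) ^ N * (1 + gsz g) ^ N * p (ev (X n k) g) \<le> C * (1 + \<bar>real_of_int n\<bar>) ^ K)))"

definition mm :: "(int \<Rightarrow> int \<Rightarrow> 'a series) \<Rightarrow> (int \<Rightarrow> int \<Rightarrow> 'a series) \<Rightarrow> int \<Rightarrow> int \<Rightarrow> 'a series" where
  "mm X Y n k = (\<lambda>s m. \<Sum>\<^sub>\<infinity>l. bmul (X n l) (Y l k) s m)"

lemma tm_mem: "tm X \<Longrightarrow> ev (X n k) g \<in> Hg g"
  unfolding tm_def by blast

lemma tm_col:
  assumes "tm X" "continuous_seminorm p"
  obtains K C where "0 \<le> C" "\<And>n k g. (1 + \<bar>real_of_int n\<bar>) ^ N * (1 + gsz g) ^ N * p (ev (X n k) g) \<le> C * (1 + \<bar>real_of_int k\<bar>) ^ K"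
  using assms unfolding tm_def by metis

lemma tm_row:
  assumes "tm X" "continuous_seminorm p"
  obtains K C where "0 \<le> C" "\<And>n k g. (1 + \<bar>real_of_int k\<bar>) ^ N * (1 + gsz g) ^ N * p (ev (X n k) g) \<le> C * (1 + \<bar>real_of_int n\<bar>) ^ K"
  using assms unfolding tm_def by metis

lemma tm_B00:
  assumes "tm X" shows "X n k \<in> B00 A z"
  unfolding B00_iff rapid_fam_def
proof (intro conjI allI impI)
  show "ev (X n k) g \<in> Hg g" for g by (rule tm_mem[OF assms])
  fix p :: "'a \<Rightarrow> real" and N assume p: "continuous_seminorm p"
  from tm_col[OF assms p, where N = N] obtain K C where
    C: "\<And>n k g. (1 + \<bar>real_of_int n\<bar>) ^ N * (1 + gsz g) ^ N * p (ev (X n k) g) \<le> C * (1 + \<bar>real_of_int k\<bar>) ^ K" by metis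
  have "(1 + gsz g) ^ N * p (ev (X n k) g) \<le> C * (1 + \<bar>real_of_int k\<bar>) ^ K" for g
  proof -
    have "1 * ((1 + gsz g) ^ N * p (ev (X n k) g)) \<le> (1 + \<bar>real_of_int n\<bar>) ^ N * ((1 + gsz g) ^ N * p (ev (X n k) g))"
      by (intro mult_right_mono) (auto simp: cs_nonneg[OF p])
    then show ?thesis using C[of n g k] by (simp add: mult.assoc)
  qed
  then show "\<exists>C. \<forall>g\<in>UNIV. (1 + gsz g) ^ N * p (ev (X n k) g) \<le> C" by blast
qed

definition mterm :: "(int \<Rightarrow> int \<Rightarrow> 'a series) \<Rightarrow> (int \<Rightarrow> int \<Rightarrow> 'a series) \<Rightarrow> int \<Rightarrow> int \<Rightarrow> dih \<Rightarrow> int \<times> dih \<Rightarrow> 'a" where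
  "mterm X Y n k u = (\<lambda>(l, g). ev (X n l) g * ev (Y l k) (gm (gi g) u))"

lemma mterm_mem:
  assumes "tm X" "tm Y" shows "mterm X Y n k u i \<in> Hg u"
  using Hg_mult[OF tm_mem[OF assms(1), of n "fst i" "snd i"] tm_mem[OF assms(2), of "fst i" k "gm (gi (snd i)) u"]]
  by (simp add: mterm_def case_prod_unfold)

lemma mterm_sizes:
  fixes l :: int and g u :: dih
  defines "t \<equiv> 1 + gsz (gm (gi g) u)" and "s \<equiv> 1 + gsz g" and "b \<equiv> 1 + \<bar>real_of_int l\<bar>"
  shows "1 + gsz u \<le> s * t" "1 + lsz (l, g) \<le> b * s * t"
proof -
  show "1 + gsz u \<le> s * t"
    using gsz_gm_mult[of g "gm (gi g) u"] by (simp add: s_def t_def)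
  have "1 + lsz (l, g) \<le> b * s"
    by (simp add: b_def s_def algebra_simps)
  also have "\<dots> \<le> b * s * t"
    using mult_left_mono[of 1 t "b * s"] by (simp add: b_def s_def t_def)
  finally show "1 + lsz (l, g) \<le> b * s * t" .
qed

lemma mterm_bound_col:
  assumes X: "tm X" and Y: "tm Y" and p: "continuous_seminorm p"
  shows "\<exists>K C. 0 \<le> C \<and> (\<forall>n k u i. (1 + \<bar>real_of_int n\<bar>) ^ N * (1 + gsz u) ^ N * (1 + lsz i) ^ M * p (mterm X Y n k u i)
            \<le> C * (1 + \<bar>real_of_int k\<bar>) ^ K)"
proof -
  from cs_mult_bound[OF p] obtain q where q: "continuous_seminorm q" "\<And>x y. p (x * y) \<le> q x * q y" by metis
  from tm_col[OF X q(1), where N = "N + M"] obtain K1 C1 where 1: "0 \<le> C1"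
    "\<And>n k g. (1 + \<bar>real_of_int n\<bar>) ^ (N + M) * (1 + gsz g) ^ (N + M) * q (ev (X n k) g) \<le> C1 * (1 + \<bar>real_of_int k\<bar>) ^ K1" by metis
  from tm_col[OF Y q(1), where N = "K1 + N + M"] obtain K2 C2 where 2: "0 \<le> C2"
    "\<And>n k g. (1 + \<bar>real_of_int n\<bar>) ^ (K1 + N + M) * (1 + gsz g) ^ (K1 + N + M) * q (ev (Y n k) g) \<le> C2 * (1 + \<bar>real_of_int k\<bar>) ^ K2" by metis
  have "(1 + \<bar>real_of_int n\<bar>) ^ N * (1 + gsz u) ^ N * (1 + lsz i) ^ M * p (mterm X Y n k u i)
            \<le> C1 * C2 * (1 + \<bar>real_of_int k\<bar>) ^ K2" for n k u i
  proof -
    obtain l g where i: "i = (l, g)" by (cases i)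
    define a b s t where "a = 1 + \<bar>real_of_int n\<bar>" "b = 1 + \<bar>real_of_int l\<bar>" "s = 1 + gsz g" "t = 1 + gsz (gm (gi g) u)"
    note d = a_b_s_t_def
    have sz: "1 + gsz u \<le> s * t" "1 + lsz i \<le> b * s * t"
      using mterm_sizes(1)[where g = g and u = u] mterm_sizes(2)[where g = g and u = u and l = l] by (simp_all add: d i)
    have "a ^ N * (1 + gsz u) ^ N * (1 + lsz i) ^ M * p (mterm X Y n k u i)
       \<le> a ^ N * (s * t) ^ N * (b * s * t) ^ M * (q (ev (X n l) g) * q (ev (Y l k) (gm (gi g) u)))"
      using sz q(2)[of "ev (X n l) g" "ev (Y l k) (gm (gi g) u)"]
      by (intro mult_mono power_mono) (auto simp: i mterm_def d cs_nonneg[OF p])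
    also have "\<dots> \<le> C1 * C2 * (1 + \<bar>real_of_int k\<bar>) ^ K2"
      by (rule tempered_product_bound[where ?N1.0 = "N + M" and ?N2.0 = "K1 + N + M" and ?K1.0 = K1])
         (use 1(1) 1(2)[of n g l] 2(2)[of l "gm (gi g) u" k] in \<open>auto simp: d cs_nonneg[OF q(1)]\<close>)
    finally show ?thesis by (simp add: d)
  qed
  then show ?thesis using 1(1) 2(1) by (metis mult_nonneg_nonneg)
qed

lemma mterm_bound_row:
  assumes X: "tm X" and Y: "tm Y" and p: "continuous_seminorm p"
  shows "\<exists>K C. 0 \<le> C \<and> (\<forall>n k u i. (1 + \<bar>real_of_int k\<bar>) ^ N * (1 + gsz u) ^ N * (1 + lsz i) ^ M * p (mterm X Y n k u i)
            \<le> C * (1 + \<bar>real_of_int n\<bar>) ^ K)"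
proof -
  from cs_mult_bound[OF p] obtain q where q: "continuous_seminorm q" "\<And>x y. p (x * y) \<le> q x * q y" by metis
  from tm_row[OF Y q(1), where N = "N + M"] obtain K1 C1 where 1: "0 \<le> C1"
    "\<And>n k g. (1 + \<bar>real_of_int k\<bar>) ^ (N + M) * (1 + gsz g) ^ (N + M) * q (ev (Y n k) g) \<le> C1 * (1 + \<bar>real_of_int n\<bar>) ^ K1" by metis
  from tm_row[OF X q(1), where N = "K1 + N + M"] obtain K2 C2 where 2: "0 \<le> C2"
    "\<And>n k g. (1 + \<bar>real_of_int k\<bar>) ^ (K1 + N + M) * (1 + gsz g) ^ (K1 + N + M) * q (ev (X n k) g) \<le> C2 * (1 + \<bar>real_of_int n\<bar>) ^ K2" by metis
  have "(1 + \<bar>real_of_int k\<bar>) ^ N * (1 + gsz u) ^ N * (1 + lsz i) ^ M * p (mterm X Y n k u i)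
            \<le> C1 * C2 * (1 + \<bar>real_of_int n\<bar>) ^ K2" for n k u i
  proof -
    obtain l g where i: "i = (l, g)" by (cases i)
    define a b s t where "a = 1 + \<bar>real_of_int k\<bar>" "b = 1 + \<bar>real_of_int l\<bar>" "s = 1 + gsz g" "t = 1 + gsz (gm (gi g) u)"
    note d = a_b_s_t_def
    have sz: "1 + gsz u \<le> t * s" "1 + lsz i \<le> b * t * s"
      using mterm_sizes(1)[where g = g and u = u] mterm_sizes(2)[where g = g and u = u and l = l] by (simp_all add: d i mult_ac)
    have "a ^ N * (1 + gsz u) ^ N * (1 + lsz i) ^ M * p (mterm X Y n k u i)
       \<le> a ^ N * (t * s) ^ N * (b * t * s) ^ M * (q (ev (Y l k) (gm (gi g) u)) * q (ev (X n l) g))"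
      using sz q(2)[of "ev (X n l) g" "ev (Y l k) (gm (gi g) u)"]
      by (intro mult_mono power_mono) (auto simp: i mterm_def d cs_nonneg[OF p] mult.commute)
    also have "\<dots> \<le> C1 * C2 * (1 + \<bar>real_of_int n\<bar>) ^ K2"
      by (rule tempered_product_bound[where ?N1.0 = "N + M" and ?N2.0 = "K1 + N + M" and ?K1.0 = K1])
         (use 1(1) 1(2)[of k "gm (gi g) u" l] 2(2)[of l g n] in \<open>auto simp: d cs_nonneg[OF q(1)]\<close>)
    finally show ?thesis by (simp add: d)
  qed
  then show ?thesis using 1(1) 2(1) by (metis mult_nonneg_nonneg)
qed

lemma mterm_rapid:
  assumes X: "tm X" and Y: "tm Y"
  shows "rapid_fam lsz UNIV (mterm X Y n k u)"
  unfolding rapid_fam_def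
proof (intro allI impI)
  fix p :: "'a \<Rightarrow> real" and M assume "continuous_seminorm p"
  from mterm_bound_col[OF X Y this, of 0 M]
  obtain K C where "\<And>i. (1 + lsz i) ^ M * p (mterm X Y n k u i) \<le> C * (1 + \<bar>real_of_int k\<bar>) ^ K"
    unfolding power_0 mult_1_left by blast
  then show "\<exists>C. \<forall>i\<in>UNIV. (1 + lsz i) ^ M * p (mterm X Y n k u i) \<le> C" by blast
qed

lemma mm_has_sum:
  assumes X: "tm X" and Y: "tm Y"
  shows "(mterm X Y n k u has_sum ev (mm X Y n k) u) UNIV" "ev (mm X Y n k) u \<in> Hg u"
proof -
  from rapid_has_sum[OF poly_size_lsz mterm_rapid[OF X Y] mterm_mem[OF X Y]]
  obtain y where y: "y \<in> Hg u" "(mterm X Y n k u has_sum y) UNIV" by blast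
  have "((\<lambda>l. ev (bmul (X n l) (Y l k)) u) has_sum y) UNIV"
  proof (rule has_sum_SigmaD)
    show "(mterm X Y n k u has_sum y) (UNIV \<times> UNIV)" using y(2) by simp
    show "((\<lambda>g. mterm X Y n k u (l, g)) has_sum ev (bmul (X n l) (Y l k)) u) UNIV" for l
      using bmul_has_sum[OF tm_B00[OF X] tm_B00[OF Y]] by (simp add: mterm_def)
  qed
  then have "ev (mm X Y n k) u = y"
    by (simp add: mm_def ev_def infsumI)
  then show "(mterm X Y n k u has_sum ev (mm X Y n k) u) UNIV" "ev (mm X Y n k) u \<in> Hg u"
    using y by auto
qed

lemma mm_cs_le:
  assumes X: "tm X" and Y: "tm Y" and p: "continuous_seminorm p"
    and M: "(\<lambda>i. 1 / (1 + lsz i) ^ M) summable_on UNIV"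
    and W: "0 < W" and B: "\<And>i. W * (1 + lsz i) ^ M * p (mterm X Y n k u i) \<le> B"
  shows "W * p (ev (mm X Y n k) u) \<le> B * (\<Sum>\<^sub>\<infinity>i. 1 / (1 + lsz i) ^ M)"
proof -
  have "p (ev (mm X Y n k) u) \<le> (\<Sum>\<^sub>\<infinity>i. p (mterm X Y n k u i))"
    by (rule cs_has_sum_le[OF p mm_has_sum(1)[OF X Y]])
       (rule rapid_fam_summable[OF poly_size_lsz mterm_rapid[OF X Y] p])
  also have "\<dots> \<le> (\<Sum>\<^sub>\<infinity>i. B / W * (1 / (1 + lsz i) ^ M))"
  proof (rule infsum_mono)
    show "(\<lambda>i. p (mterm X Y n k u i)) summable_on UNIV"
      by (rule rapid_fam_summable[OF poly_size_lsz mterm_rapid[OF X Y] p])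
    show "(\<lambda>i. B / W * (1 / (1 + lsz i) ^ M)) summable_on UNIV"
      by (rule summable_on_cmult_right[OF M])
    fix i
    have "0 < (1 + lsz i) ^ M" by (auto simp: case_prod_unfold intro!: zero_less_power add_pos_nonneg)
    then show "p (mterm X Y n k u i) \<le> B / W * (1 / (1 + lsz i) ^ M)"
      using B[of i] W by (simp add: field_simps)
  qed
  also have "\<dots> = B / W * (\<Sum>\<^sub>\<infinity>i. 1 / (1 + lsz i) ^ M)"
    by (rule infsum_cmult_right) (use M in auto)
  finally show ?thesis using W by (simp add: field_simps)
qed

lemma tm_mm:
  assumes X: "tm X" and Y: "tm Y"
  shows "tm (mm X Y)"
  unfolding tm_def
proof (intro conjI allI impI)
  show "ev (mm X Y n k) g \<in> Hg g" for n k g by (rule mm_has_sum(2)[OF X Y])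
  obtain M where M: "(\<lambda>i. 1 / (1 + lsz i) ^ M) summable_on UNIV"
    using poly_size_summable[OF poly_size_lsz] by blast
  have S: "0 \<le> (\<Sum>\<^sub>\<infinity>i. 1 / (1 + lsz i) ^ M)"
    by (rule infsum_nonneg) (auto simp: case_prod_unfold)
  fix p :: "'a \<Rightarrow> real" and N assume p: "continuous_seminorm p"
  show "\<exists>K C. 0 \<le> C \<and> (\<forall>n k g. (1 + \<bar>real_of_int n\<bar>) ^ N * (1 + gsz g) ^ N * p (ev (mm X Y n k) g)
      \<le> C * (1 + \<bar>real_of_int k\<bar>) ^ K)"
  proof -
    from mterm_bound_col[OF X Y p, of N M] obtain K C where C: "0 \<le> C"
      "\<And>n k u i. (1 + \<bar>real_of_int n\<bar>) ^ N * (1 + gsz u) ^ N * (1 + lsz i) ^ M * p (mterm X Y n k u i)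
            \<le> C * (1 + \<bar>real_of_int k\<bar>) ^ K" by metis
    have "(1 + \<bar>real_of_int n\<bar>) ^ N * (1 + gsz g) ^ N * p (ev (mm X Y n k) g)
      \<le> C * (1 + \<bar>real_of_int k\<bar>) ^ K * (\<Sum>\<^sub>\<infinity>i. 1 / (1 + lsz i) ^ M)" for n k g
      by (rule mm_cs_le[OF X Y p M _ C(2)]) (auto intro!: mult_pos_pos zero_less_power add_pos_nonneg)
    then show ?thesis using C(1) S
      by (intro exI[of _ K] exI[of _ "C * (\<Sum>\<^sub>\<infinity>i. 1 / (1 + lsz i) ^ M)"]) (auto simp: mult_ac)
  qed
  show "\<exists>K C. 0 \<le> C \<and> (\<forall>n k g. (1 + \<bar>real_of_int k\<bar>) ^ N * (1 + gsz g) ^ N * p (ev (mm X Y n k) g)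
      \<le> C * (1 + \<bar>real_of_int n\<bar>) ^ K)"
  proof -
    from mterm_bound_row[OF X Y p, of N M] obtain K C where C: "0 \<le> C"
      "\<And>n k u i. (1 + \<bar>real_of_int k\<bar>) ^ N * (1 + gsz u) ^ N * (1 + lsz i) ^ M * p (mterm X Y n k u i)
            \<le> C * (1 + \<bar>real_of_int n\<bar>) ^ K" by metis
    have "(1 + \<bar>real_of_int k\<bar>) ^ N * (1 + gsz g) ^ N * p (ev (mm X Y n k) g)
      \<le> C * (1 + \<bar>real_of_int n\<bar>) ^ K * (\<Sum>\<^sub>\<infinity>i. 1 / (1 + lsz i) ^ M)" for n k g
      by (rule mm_cs_le[OF X Y p M _ C(2)]) (auto intro!: mult_pos_pos zero_less_power add_pos_nonneg)
    then show ?thesis using C(1) S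
      by (intro exI[of _ K] exI[of _ "C * (\<Sum>\<^sub>\<infinity>i. 1 / (1 + lsz i) ^ M)"]) (auto simp: mult_ac)
  qed
qed

lemma mm_assoc:
  assumes X: "tm X" and Y: "tm Y" and Z: "tm Z"
  shows "mm (mm X Y) Z = mm X (mm Y Z)"
proof (intro ext)
  fix n k and s0 :: parity and m0 :: int
  define u where "u = (s0, m0)"
  define F :: "(int \<times> dih) \<times> (int \<times> dih) \<Rightarrow> 'a" where
    "F = (\<lambda>((l, g), (l', v)). ev (X n l) g * ev (Y l l') (gm (gi g) v) * ev (Z l' k) (gm (gi v) u))"
  have F: "F ((l, g), (l', v)) = ev (X n l) g * mterm Y Z l k (gm (gi g) u) (l', gm (gi g) v)" for l g l' v
    by (simp add: F_def mterm_def mult.assoc gi_gm gm_assoc)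
  have F': "F ((l, g), (l', v)) = mterm X Y n l' v (l, g) * ev (Z l' k) (gm (gi v) u)" for l g l' v
    by (simp add: F_def mterm_def)
  let ?sz = "\<lambda>(i :: int \<times> dih, j :: int \<times> dih). lsz i + lsz j"
  have Fmem: "F i \<in> Hg u" for i
  proof -
    obtain l g l' v where i: "i = ((l, g), (l', v))" by (metis prod.exhaust)
    show ?thesis
      using Hg_mult[OF tm_mem[OF X, of n l g] mterm_mem[OF Y Z, of l k "gm (gi g) u" "(l', gm (gi g) v)"]]
      by (simp add: i F)
  qed
  have "rapid_fam ?sz UNIV F"
    unfolding rapid_fam_def
  proof (intro allI impI)
    fix p :: "'a \<Rightarrow> real" and N assume p: "continuous_seminorm p"
    from cs_mult_bound[OF p] obtain q where q: "continuous_seminorm q" "\<And>x y. p (x * y) \<le> q x * q y" by metis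
    from mterm_bound_col[OF Y Z q(1), of 0 N] obtain K C where C: "0 \<le> C"
      "\<And>n k u i. (1 + lsz i) ^ N * q (mterm Y Z n k u i) \<le> C * (1 + \<bar>real_of_int k\<bar>) ^ K" by auto
    from tm_row[OF X q(1), where N = "N + N"] obtain K' C' where C': "0 \<le> C'"
      "\<And>n k g. (1 + \<bar>real_of_int k\<bar>) ^ (N + N) * (1 + gsz g) ^ (N + N) * q (ev (X n k) g) \<le> C' * (1 + \<bar>real_of_int n\<bar>) ^ K'" by metis
    have "(1 + ?sz i) ^ N * p (F i) \<le> (C' * (1 + \<bar>real_of_int n\<bar>) ^ K') * (C * (1 + \<bar>real_of_int k\<bar>) ^ K)" for i
    proof -
      obtain l g l' v where i: "i = ((l, g), (l', v))" by (metis prod.exhaust)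
      define b s w where "b = 1 + \<bar>real_of_int l\<bar>" "s = 1 + gsz g" "w = 1 + lsz (l', gm (gi g) v)"
      note d = b_s_w_def
      have ge: "1 \<le> b" "1 \<le> s" "1 \<le> w" by (simp_all add: d)
      have "1 + gsz v \<le> s + gsz (gm (gi g) v)"
        using gsz_gm[of g "gm (gi g) v"] by (simp add: d)
      then have "1 + ?sz i \<le> (b - 1) + (s - 1) + (w + (s - 1))"
        by (simp add: i d)
      also have "\<dots> \<le> b * s * s * w"
      proof -
        define B S W where "B = b - 1" "S = s - 1" "W = w - 1"
        have [simp]: "b = 1 + B" "s = 1 + S" "w = 1 + W" and nn: "0 \<le> B" "0 \<le> S" "0 \<le> W"
          using ge by (auto simp: B_S_W_def)
        show ?thesis
          using nn by (simp add: algebra_simps)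
      qed
      finally have sz: "1 + ?sz i \<le> b * s * s * w" .
      have sz0: "0 \<le> 1 + ?sz i" by (simp add: i)
      have "(1 + ?sz i) ^ N * p (F i) \<le> (b * s * s * w) ^ N * (q (ev (X n l) g) * q (mterm Y Z l k (gm (gi g) u) (l', gm (gi g) v)))"
        using q(2) sz sz0 ge by (intro mult_mono power_mono) (auto simp: i F cs_nonneg[OF p])
      also have "\<dots> = (b ^ N * s ^ (N + N) * q (ev (X n l) g)) * (w ^ N * q (mterm Y Z l k (gm (gi g) u) (l', gm (gi g) v)))"
        by (simp add: power_mult_distrib power_add mult_ac)
      also have "\<dots> \<le> (b ^ (N + N) * s ^ (N + N) * q (ev (X n l) g)) * (w ^ N * q (mterm Y Z l k (gm (gi g) u) (l', gm (gi g) v)))"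
        using ge by (intro mult_right_mono power_increasing) (auto simp: cs_nonneg[OF q(1)])
      also have "\<dots> \<le> (C' * (1 + \<bar>real_of_int n\<bar>) ^ K') * (C * (1 + \<bar>real_of_int k\<bar>) ^ K)"
        unfolding d by (rule mult_mono[OF C'(2) C(2)]) (use C'(1) in \<open>auto simp: cs_nonneg[OF q(1)]\<close>)
      finally show ?thesis .
    qed
    then show "\<exists>C. \<forall>i\<in>UNIV. (1 + ?sz i) ^ N * p (F i) \<le> C" by blast
  qed
  moreover have "poly_size ?sz UNIV"
    using poly_size_times[OF poly_size_lsz poly_size_lsz] by simp
  ultimately obtain S where S: "(F has_sum S) UNIV"
    using rapid_has_sum[of ?sz UNIV F u] Fmem by blast
  have "(mterm X (mm Y Z) n k u has_sum S) UNIV"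
  proof (rule has_sum_SigmaD)
    show "(F has_sum S) (UNIV \<times> UNIV)" using S by simp
    fix i :: "int \<times> dih"
    obtain l g where i: "i = (l, g)" by (cases i)
    have bij: "bij_betw (\<lambda>(l', v). (l', gm (gi g) v)) (UNIV :: (int \<times> dih) set) UNIV"
      by (rule bij_betw_byWitness[of _ "\<lambda>(l', v). (l', gm g v)"]) auto
    have "((\<lambda>j. mterm Y Z l k (gm (gi g) u) ((\<lambda>(l', v). (l', gm (gi g) v)) j)) has_sum ev (mm Y Z l k) (gm (gi g) u)) UNIV"
      by (rule has_sum_reindex_bij_betw[OF bij, THEN iffD2]) (rule mm_has_sum(1)[OF Y Z])
    note * = has_sum_mult_both[OF this, of "ev (X n l) g" 1]
    have eq: "F (i, j) = ev (X n l) g * mterm Y Z l k (gm (gi g) u) ((\<lambda>(l', v). (l', gm (gi g) v)) j) * 1" for j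
      by (cases j) (simp add: i F)
    show "((\<lambda>j. F (i, j)) has_sum mterm X (mm Y Z) n k u i) UNIV"
      using * unfolding eq by (simp add: i mterm_def[of X])
  qed
  moreover have "(mterm (mm X Y) Z n k u has_sum S) UNIV"
  proof (rule has_sum_SigmaD)
    have "((F \<circ> prod.swap) has_sum S) UNIV"
      using S by (subst has_sum_reindex[symmetric]) (auto simp: surj_swap)
    then show "((F \<circ> prod.swap) has_sum S) (UNIV \<times> UNIV)" by simp
    fix j :: "int \<times> dih"
    obtain l' v where j: "j = (l', v)" by (cases j)
    have eq: "(F \<circ> prod.swap) (j, i) = mterm X Y n l' v i * ev (Z l' k) (gm (gi v) u)" for i
      by (cases i) (simp add: j F')
    from has_sum_mult_both[OF mm_has_sum(1)[OF X Y, of n l' v], of 1 "ev (Z l' k) (gm (gi v) u)"]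
    show "((\<lambda>i. (F \<circ> prod.swap) (j, i)) has_sum mterm (mm X Y) Z n k u j) UNIV"
      unfolding eq by (simp add: j mterm_def[of "mm X Y"])
  qed
  ultimately have "ev (mm (mm X Y) Z n k) u = ev (mm X (mm Y Z) n k) u"
    using mm_has_sum(1)[OF tm_mm[OF X Y] Z, of n k u] mm_has_sum(1)[OF X tm_mm[OF Y Z], of n k u]
    by (metis has_sum_unique)
  then show "mm (mm X Y) Z n k s0 m0 = mm X (mm Y Z) n k s0 m0" by (simp add: u_def)
qed

end

declare split_paired_All [simp del] split_paired_Ex [simp del]

lemma infsum_single:
  assumes "j \<in> I" "\<And>i. i \<in> I \<Longrightarrow> i \<noteq> j \<Longrightarrow> f i = 0"
  shows "infsum f I = (f j :: 'b::{topological_comm_monoid_add, t2_space})"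
proof -
  have "infsum f I = infsum f {j}"
    by (rule infsum_cong_neutral) (use assms in auto)
  then show ?thesis by simp
qed

lemma bmul_0 [simp]: "bmul 0 c = 0" "bmul b 0 = 0"
  by (intro ext; simp add: bmul_def)+

context loop_algebra
begin

definition lsh :: "int \<Rightarrow> 'a series \<Rightarrow> 'a series" where
  "lsh d b = (\<lambda>s m. zpow z d * b s (m - d))"

definition rsh :: "int \<Rightarrow> 'a series \<Rightarrow> 'a series" where
  "rsh d b = (\<lambda>s m. b s (if s = Even then m - d else m + d) * zpow z d)"

lemma ev_lsh: "ev (lsh d b) u = zpow z d * ev b (gm (Even, - d) u)"
  by (simp add: lsh_def ev_def gm_def)

lemma ev_rsh: "ev (rsh d b) u = ev b (gm u (Even, - d)) * zpow z d"
  by (simp add: rsh_def ev_def gm_def)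

lemma bmul_bmono_left: "bmul (bmono z d) b = lsh d b"
proof (intro ext)
  fix s k
  have "(\<Sum>\<^sub>\<infinity>n. bmono z d Even n * b s (k - n) + bmono z d Odd n * b (padd Odd s) (n - k))
      = bmono z d Even d * b s (k - d) + bmono z d Odd d * b (padd Odd s) (d - k)"
    by (rule infsum_single) (auto simp: bmono_def)
  then show "bmul (bmono z d) b s k = lsh d b s k"
    by (simp add: bmul_def lsh_def bmono_def)
qed

lemma bmul_bmono_right: "bmul b (bmono z d) = rsh d b"
proof (intro ext)
  fix s k
  define n0 where "n0 = (if s = Even then k - d else k + d)"
  have "(\<Sum>\<^sub>\<infinity>n. b Even n * bmono z d s (k - n) + b Odd n * bmono z d (padd Odd s) (n - k))
      = b Even n0 * bmono z d s (k - n0) + b Odd n0 * bmono z d (padd Odd s) (n0 - k)"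
    by (rule infsum_single) (auto simp: bmono_def n0_def)
  then show "bmul b (bmono z d) s k = rsh d b s k"
    by (cases s) (simp_all add: bmul_def rsh_def bmono_def n0_def)
qed

lemma lsh_0 [simp]: "lsh 0 b = b" and rsh_0 [simp]: "rsh 0 b = b"
  by (simp_all add: lsh_def rsh_def fun_eq_iff)

lemma lsh_zero [simp]: "lsh d 0 = 0" and rsh_zero [simp]: "rsh d 0 = 0"
  by (simp_all add: lsh_def rsh_def fun_eq_iff)

lemma lsh_lsh: "lsh d (lsh e b) = lsh (d + e) b"
  by (simp add: lsh_def fun_eq_iff zpow_add mult.assoc algebra_simps)

lemma zpow_commute: "zpow z d * zpow z e = zpow z e * zpow z d"
  by (metis zpow_add add.commute)

lemma rsh_rsh: "rsh d (rsh e b) = rsh (e + d) b"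
  by (auto simp: rsh_def fun_eq_iff zpow_add mult.assoc zpow_commute algebra_simps)

lemma lsh_rsh: "lsh d (rsh e b) = rsh e (lsh d b)"
  by (auto simp: lsh_def rsh_def fun_eq_iff mult.assoc algebra_simps)

lemma lsh_inv [simp]: "lsh (- d) (lsh d b) = b" "lsh d (lsh (- d) b) = b"
  and rsh_inv [simp]: "rsh (- d) (rsh d b) = b" "rsh d (rsh (- d) b) = b"
  by (simp_all add: lsh_lsh rsh_rsh)

lemma ev_bmono: "ev (bmono z d) g = (if g = (Even, d) then zpow z d else 0)"
  by (cases g) (simp add: bmono_def)

lemma ev_0 [simp]: "ev 0 g = 0" by (simp add: ev_def)

lemma rapid_finite_support:
  fixes b :: "'a series"
  assumes "finite {g. ev b g \<noteq> 0}"
  shows "rapid_fam gsz UNIV (ev b)"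
  unfolding rapid_fam_def
proof (intro allI impI)
  fix p :: "'a \<Rightarrow> real" and N assume p: "continuous_seminorm p"
  have "(1 + gsz i) ^ N * p (ev b i) \<le> (\<Sum>g | ev b g \<noteq> 0. (1 + gsz g) ^ N * p (ev b g))" for i
  proof (cases "ev b i = 0")
    case True
    then show ?thesis
      by (simp add: cs_zero[OF p]) (auto intro!: sum_nonneg mult_nonneg_nonneg simp: cs_nonneg[OF p])
  next
    case False
    then show ?thesis
      by (intro member_le_sum) (use assms cs_nonneg[OF p] in auto)
  qed
  then show "\<exists>C. \<forall>i\<in>UNIV. (1 + gsz i) ^ N * p (ev b i) \<le> C" by blast
qed

lemma bmono_B00 [simp]: "bmono z d \<in> B00 A z"
  unfolding B00_iff
  by (auto simp: ev_bmono zpow_Hg intro!: rapid_finite_support)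

lemma zero_B00 [simp]: "0 \<in> B00 A z"
  unfolding B00_iff
  by (auto intro!: rapid_finite_support)

lemma B00_bound:
  assumes "b \<in> B00 A z" "continuous_seminorm p"
  shows "\<exists>C\<ge>0. \<forall>g. (1 + gsz g) ^ N * p (ev b g) \<le> C"
proof -
  from assms obtain C where C: "\<And>g. (1 + gsz g) ^ N * p (ev b g) \<le> C"
    unfolding B00_iff rapid_fam_def by blast
  have "0 \<le> (1 + gsz g) ^ N * p (ev b g)" for g
    by (intro mult_nonneg_nonneg) (auto simp: cs_nonneg[OF assms(2)])
  then have "0 \<le> C" using C[of undefined] by (rule order_trans)
  then show ?thesis using C by blast
qed

lemma ev_add: "ev (b + c) g = ev b g + ev c g" and ev_diff: "ev (b - c) g = ev b g - ev c g"
  for b c :: "'a series"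
  by (simp_all add: ev_def)

definition gscale :: "(dih \<Rightarrow> real) \<Rightarrow> 'a series \<Rightarrow> 'a series" where
  "gscale r b = (\<lambda>s m. r (s, m) *\<^sub>R b s m)"

lemma ev_gscale: "ev (gscale r b) g = r g *\<^sub>R ev b g"
  by (simp add: gscale_def ev_def)

lemma gscale_B00:
  assumes b: "b \<in> B00 A z" and r: "\<And>g. \<bar>r g\<bar> \<le> R"
  shows "gscale r b \<in> B00 A z"
  unfolding B00_iff rapid_fam_def
proof (intro conjI allI impI)
  show "ev (gscale r b) g \<in> Hg g" for g
    by (simp add: ev_gscale Hg_scale B00_ev[OF b])
  fix p :: "'a \<Rightarrow> real" and N assume p: "continuous_seminorm p"
  from B00_bound[OF b p] obtain C where C: "0 \<le> C" "\<And>g. (1 + gsz g) ^ N * p (ev b g) \<le> C" by blast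
  have "(1 + gsz g) ^ N * p (ev (gscale r b) g) \<le> R * C" for g
  proof -
    have "(1 + gsz g) ^ N * p (ev (gscale r b) g) = \<bar>r g\<bar> * ((1 + gsz g) ^ N * p (ev b g))"
      by (simp add: ev_gscale cs_scale[OF p])
    also have "\<dots> \<le> R * C"
      by (intro mult_mono r C) (use r[of g] in \<open>auto simp: cs_nonneg[OF p]\<close>)
    finally show ?thesis .
  qed
  then show "\<exists>C. \<forall>i\<in>UNIV. (1 + gsz i) ^ N * p (ev (gscale r b) i) \<le> C" by blast
qed

lemma bscale_gscale: "bscale r b = gscale (\<lambda>_. r) b"
  by (simp add: bscale_def gscale_def)

lemma bscale_B00: "b \<in> B00 A z \<Longrightarrow> bscale r b \<in> B00 A z"
  unfolding bscale_gscale by (rule gscale_B00[where R = "\<bar>r\<bar>"]) auto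

section \<open>Examples of tempered matrices\<close>

lemma pow_shift_bound:
  fixes x y w :: real
  assumes "x \<le> y * w" "0 \<le> x" shows "x ^ N \<le> y ^ N * w ^ N"
  using power_mono[OF assms(1) assms(2), of N] by (simp add: power_mult_distrib)

lemma tm_gscale:
  assumes b: "b \<in> B00 A z" and r: "\<And>n k g. \<bar>\<rho> n k g\<bar> \<le> R"
    and s1: "\<And>n k g. \<rho> n k g \<noteq> 0 \<Longrightarrow> \<bar>real_of_int n\<bar> \<le> gsz g + \<bar>real_of_int k\<bar> + 3"
    and s2: "\<And>n k g. \<rho> n k g \<noteq> 0 \<Longrightarrow> \<bar>real_of_int k\<bar> \<le> gsz g + \<bar>real_of_int n\<bar> + 3"
  shows "tm (\<lambda>n k. gscale (\<rho> n k) b)"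
proof -
  have main: "\<exists>K C. 0 \<le> C \<and> (\<forall>n k g. (1 + \<bar>real_of_int (f n k)\<bar>) ^ N * (1 + gsz g) ^ N * p (ev (gscale (\<rho> n k) b) g)
      \<le> C * (1 + \<bar>real_of_int (h n k)\<bar>) ^ K)"
    if p: "continuous_seminorm p"
    and f: "\<And>n k g. \<rho> n k g \<noteq> 0 \<Longrightarrow> \<bar>real_of_int (f n k)\<bar> \<le> gsz g + \<bar>real_of_int (h n k)\<bar> + 3" for p N f h
  proof -
    from B00_bound[OF b p] obtain C where C: "0 \<le> C" "\<And>g. (1 + gsz g) ^ (N + N) * p (ev b g) \<le> C" by blast
    have R: "0 \<le> R" using r[of 0 0 undefined] by linarith
    have "(1 + \<bar>real_of_int (f n k)\<bar>) ^ N * (1 + gsz g) ^ N * p (ev (gscale (\<rho> n k) b) g)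
      \<le> 4 ^ N * R * C * (1 + \<bar>real_of_int (h n k)\<bar>) ^ N" for n k g
    proof (cases "\<rho> n k g = 0")
      case True
      then show ?thesis using R C(1) by (simp add: ev_gscale cs_zero[OF p])
    next
      case False
      define x y w where "x = 1 + \<bar>real_of_int (f n k)\<bar>" "y = 1 + gsz g" "w = 1 + \<bar>real_of_int (h n k)\<bar>"
      note d = x_y_w_def
      have "0 \<le> gsz g * \<bar>real_of_int (h n k)\<bar>" by simp
      moreover have "4 * y * w = 4 + 4 * gsz g + 4 * \<bar>real_of_int (h n k)\<bar> + 4 * (gsz g * \<bar>real_of_int (h n k)\<bar>)"
        by (simp add: d algebra_simps)
      ultimately have "x \<le> (4 * y) * w"
        using f[OF False] gsz_nonneg[of g] abs_ge_zero[of "real_of_int (h n k)"]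
        unfolding d(1) by linarith
      then have "x ^ N \<le> (4 * y) ^ N * w ^ N"
        by (rule pow_shift_bound) (simp add: d)
      then have "x ^ N * y ^ N * p (ev (gscale (\<rho> n k) b) g) \<le> (4 * y) ^ N * w ^ N * y ^ N * (R * p (ev b g))"
        using r[of n k g] by (intro mult_mono) (auto simp: d ev_gscale cs_scale[OF p] cs_nonneg[OF p] mult_right_mono)
      also have "\<dots> = 4 ^ N * R * (y ^ (N + N) * p (ev b g)) * w ^ N"
        by (simp add: power_mult_distrib power_add mult_ac)
      also have "\<dots> \<le> 4 ^ N * R * C * w ^ N"
        using C R by (intro mult_right_mono mult_left_mono) (auto simp: d)
      finally show ?thesis by (simp add: d)
    qed
    then show ?thesis using R C(1) by (intro exI[of _ N] exI[of _ "4 ^ N * R * C"]) auto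
  qed
  show ?thesis
    unfolding tm_def
  proof (intro conjI allI impI)
    show "ev (gscale (\<rho> n k) b) g \<in> Hg g" for n k g
      by (simp add: ev_gscale Hg_scale B00_ev[OF b])
    fix p :: "'a \<Rightarrow> real" and N assume p: "continuous_seminorm p"
    show "\<exists>K C. 0 \<le> C \<and> (\<forall>n k g. (1 + \<bar>real_of_int n\<bar>) ^ N * (1 + gsz g) ^ N * p (ev (gscale (\<rho> n k) b) g)
      \<le> C * (1 + \<bar>real_of_int k\<bar>) ^ K)"
      by (rule main[OF p, of "\<lambda>n k. n" "\<lambda>n k. k"]) (rule s1)
    show "\<exists>K C. 0 \<le> C \<and> (\<forall>n k g. (1 + \<bar>real_of_int k\<bar>) ^ N * (1 + gsz g) ^ N * p (ev (gscale (\<rho> n k) b) g)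
      \<le> C * (1 + \<bar>real_of_int n\<bar>) ^ K)"
      by (rule main[OF p, of "\<lambda>n k. k" "\<lambda>n k. n"]) (rule s2)
  qed
qed

end

context loop_algebra
begin

definition Diag :: "(int \<Rightarrow> 'a series) \<Rightarrow> int \<Rightarrow> int \<Rightarrow> 'a series" where
  "Diag d n k = (if n = k then d n else 0)"

lemma tm_Diag:
  assumes S: "finite S" "S \<subseteq> B00 A z" and d: "\<And>n. d n \<in> S"
  shows "tm (Diag d)"
proof -
  have bd: "\<exists>C\<ge>0. \<forall>n g. (1 + gsz g) ^ N * p (ev (d n) g) \<le> C" if p: "continuous_seminorm p" for p N
  proof -
    have "\<forall>b\<in>S. \<exists>C\<ge>0. \<forall>g. (1 + gsz g) ^ N * p (ev b g) \<le> C"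
      using B00_bound[OF _ p] S(2) by blast
    then obtain C where C: "\<And>b. b \<in> S \<Longrightarrow> 0 \<le> C b" "\<And>b g. b \<in> S \<Longrightarrow> (1 + gsz g) ^ N * p (ev b g) \<le> C b"
      by metis
    have "(1 + gsz g) ^ N * p (ev (d n) g) \<le> sum C S" for n g
      using C(2)[OF d, of g n] member_le_sum[of "d n" S C] S(1) C(1) d by force
    then show ?thesis using sum_nonneg[of S C] C(1) by blast
  qed
  show ?thesis
    unfolding tm_def
  proof (intro conjI allI impI)
    show "ev (Diag d n k) g \<in> Hg g" for n k g
      using d[of n] S(2) by (auto simp: Diag_def B00_ev)
    fix p :: "'a \<Rightarrow> real" and N assume p: "continuous_seminorm p"
    from bd[OF p, of N] obtain C where C: "0 \<le> C" "\<And>n g. (1 + gsz g) ^ N * p (ev (d n) g) \<le> C" by blast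
    have *: "(1 + \<bar>real_of_int n\<bar>) ^ N * (1 + gsz g) ^ N * p (ev (Diag d n k) g) \<le> C * (1 + \<bar>real_of_int k\<bar>) ^ N" for n k g
    proof (cases "n = k")
      case True
      have "(1 + \<bar>real_of_int n\<bar>) ^ N * ((1 + gsz g) ^ N * p (ev (d n) g)) \<le> (1 + \<bar>real_of_int n\<bar>) ^ N * C"
        by (intro mult_left_mono C) auto
      then show ?thesis using True by (simp add: Diag_def mult_ac)
    qed (use C in \<open>auto simp: Diag_def cs_zero[OF p]\<close>)
    have **: "(1 + \<bar>real_of_int k\<bar>) ^ N * (1 + gsz g) ^ N * p (ev (Diag d n k) g) \<le> C * (1 + \<bar>real_of_int n\<bar>) ^ N" for n k g
      using *[of n g k] C(1) by (cases "n = k") (auto simp: Diag_def cs_zero[OF p])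
    show "\<exists>K C. 0 \<le> C \<and> (\<forall>n k g. (1 + \<bar>real_of_int n\<bar>) ^ N * (1 + gsz g) ^ N * p (ev (Diag d n k) g) \<le> C * (1 + \<bar>real_of_int k\<bar>) ^ K)"
      using * C(1) by blast
    show "\<exists>K C. 0 \<le> C \<and> (\<forall>n k g. (1 + \<bar>real_of_int k\<bar>) ^ N * (1 + gsz g) ^ N * p (ev (Diag d n k) g) \<le> C * (1 + \<bar>real_of_int n\<bar>) ^ K)"
      using ** C(1) by blast
  qed
qed

lemma mm_Diag_left: "mm (Diag d) X n k = bmul (d n) (X n k)"
proof (intro ext)
  fix s m
  have "(\<Sum>\<^sub>\<infinity>l. bmul (Diag d n l) (X l k) s m) = bmul (Diag d n n) (X n k) s m"
    by (rule infsum_single) (auto simp: Diag_def)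
  then show "mm (Diag d) X n k s m = bmul (d n) (X n k) s m"
    by (simp add: mm_def Diag_def)
qed

lemma mm_Diag_right: "mm X (Diag d) n k = bmul (X n k) (d k)"
proof (intro ext)
  fix s m
  have "(\<Sum>\<^sub>\<infinity>l. bmul (X n l) (Diag d l k) s m) = bmul (X n k) (Diag d k k) s m"
    by (rule infsum_single) (auto simp: Diag_def)
  then show "mm X (Diag d) n k s m = bmul (X n k) (d k) s m"
    by (simp add: mm_def Diag_def)
qed

text \<open>The series algebra sits in the matrices as the corner of index 0.\<close>

lemma tm_corner: "b \<in> B00 A z \<Longrightarrow> tm (Diag (\<lambda>n. if n = 0 then b else 0))"
  by (rule tm_Diag[where S = "{b, 0}"]) auto

lemma bmul_B00:
  assumes "b \<in> B00 A z" "c \<in> B00 A z" shows "bmul b c \<in> B00 A z"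
  using tm_B00[OF tm_mm[OF tm_corner[OF assms(1)] tm_corner[OF assms(2)]], of 0 0]
  by (simp add: mm_Diag_left Diag_def)

lemma bmul_assoc:
  assumes "b \<in> B00 A z" "c \<in> B00 A z" "d \<in> B00 A z"
  shows "bmul (bmul b c) d = bmul b (bmul c d)"
  using fun_cong[OF fun_cong[OF mm_assoc[OF tm_corner[OF assms(1)] tm_corner[OF assms(2)] tm_corner[OF assms(3)]], of 0], of 0]
  by (simp add: mm_Diag_left mm_Diag_right[of _ "\<lambda>n. if n = 0 then d else 0"] Diag_def)

lemma lsh_B00 [simp]: "b \<in> B00 A z \<Longrightarrow> lsh d b \<in> B00 A z"
  by (metis bmul_B00 bmono_B00 bmul_bmono_left)

lemma rsh_B00 [simp]: "b \<in> B00 A z \<Longrightarrow> rsh d b \<in> B00 A z"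
  by (metis bmul_B00 bmono_B00 bmul_bmono_right)

lemma bmul_lsh: "b \<in> B00 A z \<Longrightarrow> c \<in> B00 A z \<Longrightarrow> bmul (lsh d b) c = lsh d (bmul b c)"
  by (metis bmul_assoc bmono_B00 bmul_bmono_left)

lemma bmul_rsh: "b \<in> B00 A z \<Longrightarrow> c \<in> B00 A z \<Longrightarrow> bmul b (rsh d c) = rsh d (bmul b c)"
  by (metis bmul_assoc bmono_B00 bmul_bmono_right)

lemma bmul_rsh_lsh: "b \<in> B00 A z \<Longrightarrow> c \<in> B00 A z \<Longrightarrow> bmul (rsh d b) c = bmul b (lsh d c)"
  by (metis bmul_assoc bmono_B00 bmul_bmono_right bmul_bmono_left)

lemma lsh_bmono: "lsh d (bmono z e) = bmono z (d + e)"
  by (auto simp: lsh_def bmono_def fun_eq_iff zpow_add)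

lemma rsh_bmono: "rsh d (bmono z e) = bmono z (e + d)"
  by (metis bmul_bmono_right bmul_bmono_left lsh_bmono)

definition one_mat :: "int \<Rightarrow> int \<Rightarrow> 'a series" where
  "one_mat = Diag (\<lambda>_. bmono z 0)"

lemma mm_one [simp]: "mm one_mat X = X" "mm X one_mat = X"
  by (intro ext; simp add: one_mat_def mm_Diag_left mm_Diag_right bmul_bmono_left bmul_bmono_right)+

lemma mm_inverse_unique:
  assumes "tm X" "tm Y" "tm Y'" "mm Y X = one_mat" "mm X Y' = one_mat"
  shows "Y = Y'"
  by (metis mm_assoc mm_one assms)

lemma tm_shift:
  assumes "tm X" shows "tm (\<lambda>n k. lsh d (rsh e (X n k)))"
proof -
  have D: "tm (Diag (\<lambda>_. bmono z d))" for d
    by (rule tm_Diag[where S = "{bmono z d}"]) auto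
  have "(\<lambda>n k. lsh d (rsh e (X n k))) = mm (Diag (\<lambda>_. bmono z d)) (mm X (Diag (\<lambda>_. bmono z e)))"
    by (simp add: fun_eq_iff mm_Diag_left mm_Diag_right bmul_bmono_left bmul_bmono_right)
  then show ?thesis using tm_mm[OF D tm_mm[OF assms D]] by simp
qed

lemma mm_gscale:
  assumes b: "b \<in> B00 A z" and c: "c \<in> B00 A z"
    and X: "tm (\<lambda>n k. gscale (\<rho> n k) b)" and Y: "tm (\<lambda>n k. gscale (\<rho>' n k) c)"
    and s: "\<And>n k g h. ev b g \<noteq> 0 \<Longrightarrow> ev c h \<noteq> 0 \<Longrightarrow> ((\<lambda>l. \<rho> n l g * \<rho>' l k h) has_sum \<tau> n k (gm g h)) UNIV"
  shows "mm (\<lambda>n k. gscale (\<rho> n k) b) (\<lambda>n k. gscale (\<rho>' n k) c) = (\<lambda>n k. gscale (\<tau> n k) (bmul b c))"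
proof (intro ext)
  fix n k and s0 :: parity and m0 :: int
  define u where "u = (s0, m0)"
  let ?X = "\<lambda>n k. gscale (\<rho> n k) b" and ?Y = "\<lambda>n k. gscale (\<rho>' n k) c"
  let ?S = "ev (mm ?X ?Y n k) u"
  have "((mterm ?X ?Y n k u \<circ> prod.swap) has_sum ?S) UNIV"
    using mm_has_sum(1)[OF X Y] by (subst has_sum_reindex[symmetric]) (auto simp: surj_swap)
  then have "((mterm ?X ?Y n k u \<circ> prod.swap) has_sum ?S) (UNIV \<times> UNIV)" by simp
  then have "((\<lambda>g. \<tau> n k u *\<^sub>R (ev b g * ev c (gm (gi g) u))) has_sum ?S) UNIV"
  proof (rule has_sum_SigmaD)
    fix g
    have "((\<lambda>l. (\<rho> n l g * \<rho>' l k (gm (gi g) u)) *\<^sub>R (ev b g * ev c (gm (gi g) u)))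
        has_sum (\<tau> n k u *\<^sub>R (ev b g * ev c (gm (gi g) u)))) UNIV"
    proof (cases "ev b g = 0 \<or> ev c (gm (gi g) u) = 0")
      case False
      then show ?thesis using has_sum_scaleR_elem[OF s[of g "gm (gi g) u" n k]] by simp
    qed auto
    then show "((\<lambda>l. (mterm ?X ?Y n k u \<circ> prod.swap) (g, l))
        has_sum (\<tau> n k u *\<^sub>R (ev b g * ev c (gm (gi g) u)))) UNIV"
      by (simp add: mterm_def ev_gscale mult.commute)
  qed
  moreover have "((\<lambda>g. \<tau> n k u *\<^sub>R (ev b g * ev c (gm (gi g) u))) has_sum (\<tau> n k u *\<^sub>R ev (bmul b c) u)) UNIV"
    using has_sum_mult_both[OF bmul_has_sum[OF b c, of u], of "of_real (\<tau> n k u)" 1]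
    by (simp add: scaleR_conv_of_real mult.assoc)
  ultimately have "?S = ev (gscale (\<tau> n k) (bmul b c)) u"
    by (simp add: has_sum_unique ev_gscale)
  then show "mm ?X ?Y n k s0 m0 = gscale (\<tau> n k) (bmul b c) s0 m0"
    by (simp add: u_def)
qed

end

section \<open>Reduction of the matrices of the statement\<close>

definition ix :: "nat \<Rightarrow> int \<Rightarrow> real" where
  "ix q \<kappa> = real_of_int \<kappa> - real q / 2"

lemma ix_eq_iff [simp]: "ix q \<kappa> = ix q l \<longleftrightarrow> \<kappa> = l"
  by (simp add: ix_def)

lemma ZZ_ix: "ZZ q = range (ix q)"
proof (intro set_eqI iffI)
  fix x assume "x \<in> ZZ q"
  then obtain n where "x = real_of_int n + real q / 2" by (auto simp: ZZ_def)
  then have "x = ix q (n + int q)" by (simp add: ix_def)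
  then show "x \<in> range (ix q)" by blast
next
  fix x assume "x \<in> range (ix q)"
  then obtain k where "x = real_of_int k - real q / 2" by (auto simp: ix_def)
  then have "x = real_of_int (k - int q) + real q / 2" by simp
  then show "x \<in> ZZ q" unfolding ZZ_def by blast
qed

lemma ix_ZZ [simp]: "ix q \<kappa> \<in> ZZ q"
  by (simp add: ZZ_ix)

lemma inj_ix: "inj (ix q)" by (simp add: inj_def)

lemma infsum_ZZ: "infsum f (ZZ q) = (\<Sum>\<^sub>\<infinity>\<kappa>. f (ix q \<kappa>))"
  unfolding ZZ_ix by (subst infsum_reindex[OF inj_ix]) (simp add: o_def)

lemma mat_eq_ix: "mat_eq p q M N \<longleftrightarrow> (\<forall>n k. M (ix p n) (ix q k) = N (ix p n) (ix q k))"
  by (simp add: mat_eq_def ZZ_ix)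

lemma ix_size:
  assumes "q \<le> 1"
  shows "1 + \<bar>real_of_int k\<bar> \<le> 2 * (1 + \<bar>ix q k\<bar>)" "1 + \<bar>ix q k\<bar> \<le> 2 * (1 + \<bar>real_of_int k\<bar>)"
proof -
  have "q = 0 \<or> q = 1" using assms by auto
  then show "1 + \<bar>real_of_int k\<bar> \<le> 2 * (1 + \<bar>ix q k\<bar>)" "1 + \<bar>ix q k\<bar> \<le> 2 * (1 + \<bar>real_of_int k\<bar>)"
    by (auto simp: ix_def abs_if)
qed

lemma growth_transfer:
  fixes F :: "int \<Rightarrow> int \<Rightarrow> real"
  assumes u: "\<And>n. 1 \<le> (u n :: real)" "\<And>n. u n \<le> 2 * u' n" and v: "\<And>n. 1 \<le> (v' n :: real)" "\<And>n. v' n \<le> 2 * v n"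
    and F: "\<And>n k. 0 \<le> F n k" and b: "\<And>n k. u' n ^ N * F n k \<le> C * v' k ^ K"
  shows "\<exists>K C. 0 \<le> C \<and> (\<forall>n k. u n ^ N * F n k \<le> C * v k ^ K)"
proof (intro exI[of _ K] exI[of _ "2 ^ N * \<bar>C\<bar> * 2 ^ K"] conjI allI)
  fix n k
  have "u n ^ N * F n k \<le> (2 * u' n) ^ N * F n k"
    using u(1)[of n] u(2)[of n] F by (intro mult_right_mono power_mono) auto
  also have "\<dots> = 2 ^ N * (u' n ^ N * F n k)" by (simp add: power_mult_distrib)
  also have "\<dots> \<le> 2 ^ N * (\<bar>C\<bar> * v' k ^ K)"
    using b[of n k] v(1)[of k] by (intro mult_left_mono order_trans[OF b] mult_right_mono) auto
  also have "\<dots> \<le> 2 ^ N * (\<bar>C\<bar> * (2 * v k) ^ K)"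
    using v(1)[of k] v(2)[of k] by (intro mult_left_mono power_mono) auto
  finally show "u n ^ N * F n k \<le> 2 ^ N * \<bar>C\<bar> * 2 ^ K * v k ^ K"
    by (simp add: power_mult_distrib mult_ac)
qed auto

lemma tempered_iff:
  assumes "p \<le> 1" "q \<le> 1" and F: "\<And>n k. f (ix p n) (ix q k) = F n k" "\<And>n k. 0 \<le> F n k"
  shows "tempered p q f \<longleftrightarrow>
     (\<forall>N. (\<exists>K C. 0 \<le> C \<and> (\<forall>n k. (1 + \<bar>real_of_int n\<bar>) ^ N * F n k \<le> C * (1 + \<bar>real_of_int k\<bar>) ^ K)) \<and>
          (\<exists>K C. 0 \<le> C \<and> (\<forall>k n. (1 + \<bar>real_of_int k\<bar>) ^ N * F n k \<le> C * (1 + \<bar>real_of_int n\<bar>) ^ K)))"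
    (is "_ \<longleftrightarrow> ?R")
proof
  assume "tempered p q f"
  then have t: "\<exists>K C. \<forall>n k. (1 + \<bar>ix p n\<bar>) ^ N * F n k \<le> C * (1 + \<bar>ix q k\<bar>) ^ K"
     "\<exists>K C. \<forall>n k. (1 + \<bar>ix q k\<bar>) ^ N * F n k \<le> C * (1 + \<bar>ix p n\<bar>) ^ K" for N
    unfolding tempered_def ZZ_ix by (simp_all add: F)
  show ?R
  proof (intro allI conjI)
    fix N
    from t(1)[of N] obtain K C where C: "\<And>n k. (1 + \<bar>ix p n\<bar>) ^ N * F n k \<le> C * (1 + \<bar>ix q k\<bar>) ^ K" by blast
    show "\<exists>K C. 0 \<le> C \<and> (\<forall>n k. (1 + \<bar>real_of_int n\<bar>) ^ N * F n k \<le> C * (1 + \<bar>real_of_int k\<bar>) ^ K)"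
      by (rule growth_transfer[OF _ ix_size(1)[OF assms(1)] _ ix_size(2)[OF assms(2)] F(2) C]) auto
    from t(2)[of N] obtain K C where C: "\<And>k n. (1 + \<bar>ix q k\<bar>) ^ N * F n k \<le> C * (1 + \<bar>ix p n\<bar>) ^ K" by blast
    show "\<exists>K C. 0 \<le> C \<and> (\<forall>k n. (1 + \<bar>real_of_int k\<bar>) ^ N * F n k \<le> C * (1 + \<bar>real_of_int n\<bar>) ^ K)"
      by (rule growth_transfer[OF _ ix_size(1)[OF assms(2)] _ ix_size(2)[OF assms(1)] F(2) C]) auto
  qed
next
  assume R: ?R
  have "\<exists>K C. \<forall>n k. (1 + \<bar>ix p n\<bar>) ^ N * F n k \<le> C * (1 + \<bar>ix q k\<bar>) ^ K" for N
  proof -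
    from R obtain K C where C: "\<And>n k. (1 + \<bar>real_of_int n\<bar>) ^ N * F n k \<le> C * (1 + \<bar>real_of_int k\<bar>) ^ K" by blast
    have "\<exists>K C. 0 \<le> C \<and> (\<forall>n k. (1 + \<bar>ix p n\<bar>) ^ N * F n k \<le> C * (1 + \<bar>ix q k\<bar>) ^ K)"
      by (rule growth_transfer[OF _ ix_size(2)[OF assms(1)] _ ix_size(1)[OF assms(2)] F(2) C]) auto
    then show ?thesis by blast
  qed
  moreover have "\<exists>K C. \<forall>n k. (1 + \<bar>ix q k\<bar>) ^ N * F n k \<le> C * (1 + \<bar>ix p n\<bar>) ^ K" for N
  proof -
    from R obtain K C where C: "\<And>k n. (1 + \<bar>real_of_int k\<bar>) ^ N * F n k \<le> C * (1 + \<bar>real_of_int n\<bar>) ^ K" by blast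
    have "\<exists>K C. 0 \<le> C \<and> (\<forall>k n. (1 + \<bar>ix q k\<bar>) ^ N * F n k \<le> C * (1 + \<bar>ix p n\<bar>) ^ K)"
      by (rule growth_transfer[OF _ ix_size(2)[OF assms(2)] _ ix_size(1)[OF assms(1)] F(2) C]) auto
    then show ?thesis by blast
  qed
  ultimately show "tempered p q f"
    unfolding tempered_def ZZ_ix by (simp add: F)
qed

lemma bnorm_alt: "bnorm p N b = (SUP g. (1 + gsz g) ^ N * p (ev b g))"
  by (simp add: bnorm_def ev_def gsz_def case_prod_unfold)

lemma bnorm_least: "(\<And>g. (1 + gsz g) ^ N * p (ev b g) \<le> C) \<Longrightarrow> bnorm p N b \<le> C"
  unfolding bnorm_alt by (rule cSUP_least) auto

context loop_algebra
begin

lemma bnorm_upper: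
  assumes "b \<in> B00 A z" "continuous_seminorm p"
  shows "(1 + gsz g) ^ N * p (ev b g) \<le> bnorm p N b"
  unfolding bnorm_alt
  by (rule cSUP_upper) (use B00_bound[OF assms, of N] in \<open>auto simp: bdd_above_def\<close>)

lemma bnorm_nonneg:
  assumes "b \<in> B00 A z" "continuous_seminorm p"
  shows "0 \<le> bnorm p N b"
proof -
  have "0 \<le> (1 + gsz (Even, 0)) ^ N * p (ev b (Even, 0))"
    by (intro mult_nonneg_nonneg) (auto simp: cs_nonneg[OF assms(2)])
  then show ?thesis using bnorm_upper[OF assms] by (rule order_trans)
qed

text \<open>Conjugation by the diagonal matrices of powers of the variable, with half-integral powers
  absorbed: \<open>z\<^bsup>i/2\<^esup> b z\<^bsup>j/2\<^esup>\<close> is identified with \<open>z\<^sup>i b\<close>. This turns all products with middle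
  superscripts into plain products, and the conjugated matrices are the ones of tempered growth.\<close>

definition Psi :: "nat \<Rightarrow> nat \<Rightarrow> nat \<Rightarrow> 'a bmat \<Rightarrow> int \<Rightarrow> int \<Rightarrow> 'a series" where
  "Psi p q i M n k = lsh (n + int i) (rsh (- k) (M (ix p n) (ix q k)))"

definition unPsi :: "nat \<Rightarrow> nat \<Rightarrow> nat \<Rightarrow> (int \<Rightarrow> int \<Rightarrow> 'a series) \<Rightarrow> 'a bmat" where
  "unPsi p q i X x y = (if x \<in> ZZ p \<and> y \<in> ZZ q then
     lsh (- (\<lfloor>x + real p / 2\<rfloor> + int i)) (rsh \<lfloor>y + real q / 2\<rfloor> (X \<lfloor>x + real p / 2\<rfloor> \<lfloor>y + real q / 2\<rfloor>)) else 0)"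

lemma floor_ix [simp]: "\<lfloor>ix q \<kappa> + real q / 2\<rfloor> = \<kappa>"
  by (simp add: ix_def)

lemma Psi_unPsi [simp]: "Psi p q i (unPsi p q i X) = X"
proof (intro ext)
  fix n k s m
  have "Psi p q i (unPsi p q i X) n k = X n k"
    by (simp add: Psi_def unPsi_def lsh_rsh lsh_lsh rsh_rsh)
  then show "Psi p q i (unPsi p q i X) n k s m = X n k s m" by simp
qed

lemma entry_Psi: "M (ix p n) (ix q k) = lsh (- (n + int i)) (rsh k (Psi p q i M n k))"
  unfolding Psi_def by (simp only: lsh_rsh[of "n + int i"] rsh_inv lsh_inv)

lemma Psi_eq_iff: "Psi p q i M = Psi p q i N \<longleftrightarrow> mat_eq p q M N"
proof
  assume "Psi p q i M = Psi p q i N"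
  then show "mat_eq p q M N" unfolding mat_eq_ix by (metis entry_Psi)
next
  assume "mat_eq p q M N"
  then have "M (ix p n) (ix q k) = N (ix p n) (ix q k)" for n k by (simp add: mat_eq_ix)
  then show "Psi p q i M = Psi p q i N" by (intro ext) (simp add: Psi_def)
qed

lemma infsum_zpow: "(\<Sum>\<^sub>\<infinity>l\<in>I. zpow z d * f l * zpow z e) = zpow z d * infsum f I * zpow z e"
proof (cases "f summable_on I")
  case True
  then show ?thesis
    using has_sum_mult_both[OF has_sum_infsum[OF True], of "zpow z d" "zpow z e"] by (simp add: infsumI)
next
  case False
  have "\<not> (\<lambda>l. zpow z d * f l * zpow z e) summable_on I"
  proof
    assume "(\<lambda>l. zpow z d * f l * zpow z e) summable_on I"
    from has_sum_mult_both[OF has_sum_infsum[OF this], of "zpow z (- d)" "zpow z (- e)"]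
    show False using False by (simp add: mult.assoc summable_on_def)
  qed
  then show ?thesis using False by (simp add: infsum_not_exists)
qed

lemma hmul_alt: "hmul z j b c = bmul (rsh (int j) b) c"
  by (simp add: hmul_def bmul_bmono_right)

lemma mmul_Psi:
  assumes M: "\<And>n k. M (ix p n) (ix q k) \<in> B00 A z" and N: "\<And>n k. N (ix q n) (ix r k) \<in> B00 A z"
  shows "Psi p r i (mmul z q j M N) = mm (Psi p q i M) (Psi q r j N)"
proof (intro ext)
  fix n k s m
  let ?H = "\<lambda>l. hmul z j (M (ix p n) (ix q l)) (N (ix q l) (ix r k))"
  have eq: "bmul (Psi p q i M n l) (Psi q r j N l k) = lsh (n + int i) (rsh (- k) (?H l))" for l
  proof -
    let ?M = "M (ix p n) (ix q l)" and ?N = "N (ix q l) (ix r k)"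
    have "bmul (Psi p q i M n l) (Psi q r j N l k)
        = lsh (n + int i) (bmul (rsh (- l) ?M) (lsh (l + int j) (rsh (- k) ?N)))"
      unfolding Psi_def by (rule bmul_lsh) (simp_all add: M N)
    also have "bmul (rsh (- l) ?M) (lsh (l + int j) (rsh (- k) ?N))
        = bmul (rsh (l + int j) (rsh (- l) ?M)) (rsh (- k) ?N)"
      by (rule bmul_rsh_lsh[symmetric]) (simp_all add: M N)
    also have "\<dots> = rsh (- k) (?H l)"
      by (simp add: rsh_rsh hmul_alt bmul_rsh M N)
    finally show ?thesis .
  qed
  have "mm (Psi p q i M) (Psi q r j N) n k s m
      = (\<Sum>\<^sub>\<infinity>l. lsh (n + int i) (rsh (- k) (?H l)) s m)"
    by (simp add: mm_def eq)
  also have "\<dots> = lsh (n + int i) (rsh (- k) (\<lambda>s m. \<Sum>\<^sub>\<infinity>l. ?H l s m)) s m"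
    by (simp only: lsh_def rsh_def mult.assoc[symmetric] infsum_zpow)
  also have "(\<lambda>s m. \<Sum>\<^sub>\<infinity>l. ?H l s m) = mmul z q j M N (ix p n) (ix r k)"
    by (simp add: mmul_def infsum_ZZ)
  finally show "Psi p r i (mmul z q j M N) n k s m = mm (Psi p q i M) (Psi q r j N) n k s m"
    by (simp only: Psi_def[of p r])
qed

lemma tm_entry_B00: "tm (Psi p q i M) \<Longrightarrow> M (ix p n) (ix q k) \<in> B00 A z"
  by (subst entry_Psi[of _ _ _ _ _ i]) (simp add: tm_B00)

lemma mmul_Psi_tm:
  assumes "tm (Psi p q i M)" "tm (Psi q r j N)"
  shows "Psi p r i (mmul z q j M N) = mm (Psi p q i M) (Psi q r j N)"
  using assms by (intro mmul_Psi tm_entry_B00)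

lemma zconj_Psi:
  assumes "p \<le> 1" "q \<le> 1" "i \<le> 1" "j \<le> 1"
  shows "\<exists>e e'. \<forall>M n k. zconj z p q i j M (ix p n) (ix q k) = lsh e (rsh e' (Psi p q i M n k))"
proof -
  have "\<exists>e. \<forall>n. \<lfloor>ix p n - (real ((p + i) mod 2) + real i) / 2\<rfloor> + int i = e + (n + int i)"
  proof -
    have "p = 0 \<and> i = 0 \<or> p = 0 \<and> i = 1 \<or> p = 1 \<and> i = 0 \<or> p = 1 \<and> i = 1" using assms by auto
    then show ?thesis
      by (elim disjE conjE) (rule exI[of _ 0] exI[of _ "-1"], simp add: ix_def)+
  qed
  then obtain e where e: "\<And>n. \<lfloor>ix p n - (real ((p + i) mod 2) + real i) / 2\<rfloor> + int i = e + (n + int i)"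
    by blast
  have "\<exists>e. \<forall>k. int j + \<lfloor>- ix q k - (real j + real ((q + j) mod 2)) / 2\<rfloor> = - k + e"
  proof -
    have "q = 0 \<and> j = 0 \<or> q = 0 \<and> j = 1 \<or> q = 1 \<and> j = 0 \<or> q = 1 \<and> j = 1" using assms by auto
    moreover have "\<lfloor>1 / 2 - real_of_int k - 1 / 2\<rfloor> = - k" "\<lfloor>- real_of_int k - 1\<rfloor> = - k - 1" for k by linarith+
    ultimately show ?thesis
      by (elim disjE conjE) (rule exI[of _ 0] exI[of _ "1"], simp add: ix_def)+
  qed
  then obtain e' where e': "\<And>k. int j + \<lfloor>- ix q k - (real j + real ((q + j) mod 2)) / 2\<rfloor> = - k + e'"
    by blast
  have "zconj z p q i j M (ix p n) (ix q k) = lsh e (rsh e' (Psi p q i M n k))" for M n k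
    by (simp add: zconj_def hmul_alt hpow_def rsh_bmono bmul_bmono_left bmul_bmono_right rsh_rsh e e'
        Psi_def lsh_rsh lsh_lsh)
  then show ?thesis by blast
qed

lemma zconj_Psi_00: "zconj z 0 0 0 1 M (ix 0 n) (ix 0 k) = Psi 0 0 0 M n k"
proof -
  have "\<lfloor>- real_of_int k - 1\<rfloor> = - k - 1" for k by linarith
  then show ?thesis
    by (simp add: zconj_def hmul_alt hpow_def rsh_bmono bmul_bmono_left bmul_bmono_right rsh_rsh
        Psi_def lsh_rsh ix_def)
qed

lemma tm_iff_bnorm:
  assumes Z: "\<And>n k. Z n k \<in> B00 A z"
  shows "tm Z \<longleftrightarrow> (\<forall>p N N'. continuous_seminorm p \<longrightarrow>
     (\<exists>K C. 0 \<le> C \<and> (\<forall>n k. (1 + \<bar>real_of_int n\<bar>) ^ N' * bnorm p N (Z n k) \<le> C * (1 + \<bar>real_of_int k\<bar>) ^ K)) \<and>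
     (\<exists>K C. 0 \<le> C \<and> (\<forall>k n. (1 + \<bar>real_of_int k\<bar>) ^ N' * bnorm p N (Z n k) \<le> C * (1 + \<bar>real_of_int n\<bar>) ^ K)))"
    (is "_ \<longleftrightarrow> ?R")
proof
  assume tmZ: "tm Z"
  have step: "(1 + x) ^ N' * bnorm p N b \<le> B"
    if "0 \<le> x" "\<And>g. (1 + x) ^ (max N N') * (1 + gsz g) ^ (max N N') * p (ev b g) \<le> B" "continuous_seminorm p"
    for x p N N' b B
  proof -
    have "(1 + gsz g) ^ N * p (ev b g) \<le> B / (1 + x) ^ N'" for g
    proof -
      have "(1 + x) ^ N' * ((1 + gsz g) ^ N * p (ev b g)) \<le> (1 + x) ^ (max N N') * ((1 + gsz g) ^ (max N N') * p (ev b g))"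
        using that(1) by (intro mult_mono power_increasing mult_nonneg_nonneg) (auto simp: cs_nonneg[OF that(3)])
      also have "\<dots> \<le> B" using that(2)[of g] by (simp add: mult_ac)
      finally show ?thesis using that(1) by (simp add: field_simps)
    qed
    then have "bnorm p N b \<le> B / (1 + x) ^ N'" by (rule bnorm_least)
    then show ?thesis using that(1) by (simp add: field_simps)
  qed
  show ?R
  proof (intro allI impI conjI)
    fix p :: "'a \<Rightarrow> real" and N N' assume p: "continuous_seminorm p"
    from tm_col[OF tmZ p, where N = "max N N'"] obtain K C where "0 \<le> C"
      "\<And>n k g. (1 + \<bar>real_of_int n\<bar>) ^ max N N' * (1 + gsz g) ^ max N N' * p (ev (Z n k) g) \<le> C * (1 + \<bar>real_of_int k\<bar>) ^ K" by metis
    then show "\<exists>K C. 0 \<le> C \<and> (\<forall>n k. (1 + \<bar>real_of_int n\<bar>) ^ N' * bnorm p N (Z n k) \<le> C * (1 + \<bar>real_of_int k\<bar>) ^ K)"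
      using step[OF _ _ p] by (intro exI[of _ K] exI[of _ C]) simp
    from tm_row[OF tmZ p, where N = "max N N'"] obtain K C where "0 \<le> C"
      "\<And>n k g. (1 + \<bar>real_of_int k\<bar>) ^ max N N' * (1 + gsz g) ^ max N N' * p (ev (Z n k) g) \<le> C * (1 + \<bar>real_of_int n\<bar>) ^ K" by metis
    then show "\<exists>K C. 0 \<le> C \<and> (\<forall>k n. (1 + \<bar>real_of_int k\<bar>) ^ N' * bnorm p N (Z n k) \<le> C * (1 + \<bar>real_of_int n\<bar>) ^ K)"
      using step[OF _ _ p] by (intro exI[of _ K] exI[of _ C]) simp
  qed
next
  assume R: ?R
  have step: "x * (1 + gsz g) ^ N * p (ev (Z n k) g) \<le> B"
    if "x * bnorm p N (Z n k) \<le> B" "0 \<le> x" "continuous_seminorm p" for x p N n k g B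
    using mult_left_mono[OF bnorm_upper[OF Z that(3), of g N n k] that(2)] that(1) by (simp add: mult.assoc)
  show "tm Z"
    unfolding tm_def
  proof (intro conjI allI impI)
    show "ev (Z n k) g \<in> Hg g" for n k g by (rule B00_ev[OF Z])
    fix p :: "'a \<Rightarrow> real" and N assume p: "continuous_seminorm p"
    from R p obtain K C where C: "0 \<le> C"
      "\<And>n k. (1 + \<bar>real_of_int n\<bar>) ^ N * bnorm p N (Z n k) \<le> C * (1 + \<bar>real_of_int k\<bar>) ^ K" by blast
    show "\<exists>K C. 0 \<le> C \<and> (\<forall>n k g. (1 + \<bar>real_of_int n\<bar>) ^ N * (1 + gsz g) ^ N * p (ev (Z n k) g) \<le> C * (1 + \<bar>real_of_int k\<bar>) ^ K)"
      using C(1) step[OF C(2) _ p] by (intro exI[of _ K] exI[of _ C]) simp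
    from R p obtain K C where C: "0 \<le> C"
      "\<And>k n. (1 + \<bar>real_of_int k\<bar>) ^ N * bnorm p N (Z n k) \<le> C * (1 + \<bar>real_of_int n\<bar>) ^ K" by blast
    show "\<exists>K C. 0 \<le> C \<and> (\<forall>n k g. (1 + \<bar>real_of_int k\<bar>) ^ N * (1 + gsz g) ^ N * p (ev (Z n k) g) \<le> C * (1 + \<bar>real_of_int n\<bar>) ^ K)"
      using C(1) step[OF C(2) _ p] by (intro exI[of _ K] exI[of _ C]) simp
  qed
qed

lemma tempered_mat_iff:
  assumes "p \<le> 1" "q \<le> 1" "i \<le> 1" "j \<le> 1"
  shows "tempered_mat A z p q i j M \<longleftrightarrow> tm (Psi p q i M)"
proof -
  from zconj_Psi[OF assms] obtain e e' where
    e: "\<And>M n k. zconj z p q i j M (ix p n) (ix q k) = lsh e (rsh e' (Psi p q i M n k))" by blast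
  define Z where "Z n k = zconj z p q i j M (ix p n) (ix q k)" for n k
  have Zeq: "Z = (\<lambda>n k. lsh e (rsh e' (Psi p q i M n k)))"
    by (simp add: Z_def e fun_eq_iff)
  have tmZ: "tm Z \<longleftrightarrow> tm (Psi p q i M)"
  proof
    assume "tm Z"
    from tm_shift[OF this, of "- e" "- e'"]
    show "tm (Psi p q i M)" by (simp add: Z_def e lsh_rsh lsh_lsh rsh_rsh)
  next
    assume "tm (Psi p q i M)"
    from tm_shift[OF this, of e e'] show "tm Z" by (simp add: Zeq)
  qed
  have iff: "(\<forall>pp N. continuous_seminorm pp \<longrightarrow> tempered p q (\<lambda>n k. bnorm pp N (zconj z p q i j M n k))) \<longleftrightarrow> tm Z"
    if "\<And>n k. M (ix p n) (ix q k) \<in> B00 A z"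
  proof -
    have Z: "Z n k \<in> B00 A z" for n k using that by (simp add: Z_def e Psi_def)
    have "tempered p q (\<lambda>n k. bnorm pp N (zconj z p q i j M n k)) \<longleftrightarrow>
      (\<forall>N'. (\<exists>K C. 0 \<le> C \<and> (\<forall>n k. (1 + \<bar>real_of_int n\<bar>) ^ N' * bnorm pp N (Z n k) \<le> C * (1 + \<bar>real_of_int k\<bar>) ^ K)) \<and>
          (\<exists>K C. 0 \<le> C \<and> (\<forall>k n. (1 + \<bar>real_of_int k\<bar>) ^ N' * bnorm pp N (Z n k) \<le> C * (1 + \<bar>real_of_int n\<bar>) ^ K)))"
      if "continuous_seminorm pp" for pp N
      by (rule tempered_iff) (use assms bnorm_nonneg[OF Z that] in \<open>auto simp: Z_def\<close>)
    then show ?thesis unfolding tm_iff_bnorm[OF Z] by blast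
  qed
  show ?thesis
  proof
    assume "tempered_mat A z p q i j M"
    then show "tm (Psi p q i M)" unfolding tempered_mat_def ZZ_ix using iff tmZ by simp
  next
    assume t: "tm (Psi p q i M)"
    have "M (ix p n) (ix q k) \<in> B00 A z" for n k by (rule tm_entry_B00[OF t])
    then show "tempered_mat A z p q i j M" unfolding tempered_mat_def ZZ_ix using iff tmZ t by simp
  qed
qed

lemma Psi_remb: "Psi p q i (remb z i M) n k = bscale (M (ix p n) (ix q k)) (bmono z (n - k))"
proof -
  have "\<lfloor>- real i\<rfloor> = - int i" by linarith
  then have "hpow z i i 0 = bmono z (- int i)" by (simp add: hpow_def)
  moreover have "lsh d (bscale r b) = bscale r (lsh d b)" "rsh d (bscale r b) = bscale r (rsh d b)" for d r b
    by (simp_all add: lsh_def rsh_def bscale_def fun_eq_iff)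
  ultimately show ?thesis
    by (simp add: Psi_def remb_def lsh_bmono rsh_bmono)
qed

lemma Psi_remb_one: "Psi p p i (remb z i (\<lambda>n k. of_bool (n = k))) = one_mat"
proof (intro ext)
  fix n k s m
  show "Psi p p i (remb z i (\<lambda>n k. of_bool (n = k))) n k s m = one_mat n k s m"
    by (simp add: Psi_remb one_mat_def Diag_def bscale_def)
qed

lemma is_minv_iff:
  assumes "p \<le> 1" "q \<le> 1" "i \<le> 1"
  shows "is_minv A z p q i M M' \<longleftrightarrow> tm (Psi p q i M) \<and> tm (Psi q p i M') \<and>
     (\<forall>n k. n \<notin> ZZ q \<or> k \<notin> ZZ p \<longrightarrow> M' n k = 0) \<and>
     mm (Psi p q i M) (Psi q p i M') = one_mat \<and> mm (Psi q p i M') (Psi p q i M) = one_mat"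
  unfolding is_minv_def
  by (auto simp: tempered_mat_iff[OF assms(1,2,3,3)] tempered_mat_iff[OF assms(2,1,3,3)] Psi_eq_iff[symmetric, where i = i] mmul_Psi_tm Psi_remb_one)

lemma minvI:
  assumes le: "p \<le> 1" "q \<le> 1" "i \<le> 1"
    and X: "tm (Psi p q i M)" and Y: "tm Y" and inv: "mm (Psi p q i M) Y = one_mat" "mm Y (Psi p q i M) = one_mat"
  shows "is_minv A z p q i M (minv A z p q i M)" "Psi q p i (minv A z p q i M) = Y"
proof -
  have 1: "is_minv A z p q i M (unPsi q p i Y)"
    using X Y inv by (auto simp: is_minv_iff[OF le] unPsi_def)
  have uniq: "M' = unPsi q p i Y" if "is_minv A z p q i M M'" for M'
  proof -
    have "Psi q p i M' = Y"
      using that X Y inv mm_inverse_unique[of "Psi p q i M" "Psi q p i M'" Y] by (simp add: is_minv_iff[OF le])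
    then have "Psi q p i M' = Psi q p i (unPsi q p i Y)" by simp
    then have "mat_eq q p M' (unPsi q p i Y)" by (simp only: Psi_eq_iff)
    moreover have "M' n k = 0" "unPsi q p i Y n k = 0" if "n \<notin> ZZ q \<or> k \<notin> ZZ p" for n k
      using \<open>is_minv A z p q i M M'\<close> that by (auto simp: is_minv_iff[OF le] unPsi_def)
    ultimately show ?thesis
      unfolding mat_eq_def by (intro ext) metis
  qed
  have "minv A z p q i M = unPsi q p i Y"
    unfolding minv_def using 1 uniq by (rule the_equality)
  then show "is_minv A z p q i M (minv A z p q i M)" "Psi q p i (minv A z p q i M) = Y"
    using 1 by simp_all
qed

end

section \<open>Absolutely convergent Fourier series\<close>

definition cexp :: "int \<Rightarrow> real \<Rightarrow> complex" where
  "cexp k x = exp (\<i> * of_int k * of_real x)"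

lemma cexp_add: "cexp (j + k) x = cexp j x * cexp k x"
  by (simp add: cexp_def distrib_left distrib_right exp_add)

lemma norm_cexp [simp]: "norm (cexp k x) = 1"
proof -
  have "cexp k x = exp (\<i> * complex_of_real (of_int k * x))" by (simp add: cexp_def mult.assoc)
  then show ?thesis by (simp only: norm_exp_i_times)
qed

lemma cexp_0 [simp]: "cexp 0 x = 1" "cexp k 0 = 1"
  by (simp_all add: cexp_def)

lemma cexp_cnj: "cnj (cexp k x) = cexp (- k) x"
  by (simp add: cexp_def exp_cnj)

lemma has_sum_product_complex:
  fixes f :: "'i \<Rightarrow> complex" and g :: "'j \<Rightarrow> complex"
  assumes f: "(f has_sum a) I" and g: "(g has_sum b) J"
  shows "((\<lambda>(i, j). f i * g j) has_sum (a * b)) (I \<times> J)"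
proof (rule has_sum_SigmaI)
  show "((\<lambda>j. (\<lambda>(i, j). f i * g j) (i, j)) has_sum (f i * b)) J" for i
    using has_sum_cmult_right[OF g, of "f i"] by simp
  show "((\<lambda>i. f i * b) has_sum (a * b)) I"
    using has_sum_cmult_left[OF f, of b] by simp
  have "(\<lambda>i. norm (f i)) summable_on I" "(\<lambda>j. norm (g j)) summable_on J"
    using f g summable_on_iff_abs_summable_on_complex has_sum_imp_summable by blast+
  then have "(\<lambda>x. norm ((\<lambda>(i, j). f i * g j) x)) summable_on (I \<times> J)"
    by (subst Infinite_Sum.abs_summable_on_Sigma_iff)
       (auto simp: norm_mult infsum_cmult_right' abs_mult intro!: summable_on_cmult_right summable_on_cmult_left infsum_nonneg mult_nonneg_nonneg)
  then show "(\<lambda>(i, j). f i * g j) summable_on (I \<times> J)"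
    by (rule abs_summable_summable)
qed

lemma integral_cexp: "((\<lambda>x. cexp k x) has_integral (if k = 0 then 2 * pi else 0)) {0..2*pi}"
proof (cases "k = 0")
  case True
  then show ?thesis using has_integral_const_real[of "1::complex" 0 "2*pi"]
    by (simp add: scaleR_conv_of_real)
next
  case False
  have "((\<lambda>x. cexp k x) has_integral (cexp k (2*pi) / (\<i> * of_int k) - cexp k 0 / (\<i> * of_int k))) {0..2*pi}"
  proof (rule fundamental_theorem_of_calculus)
    fix x :: real
    have "((\<lambda>w. exp (\<i> * of_int k * w) / (\<i> * of_int k)) has_field_derivative
        exp (\<i> * of_int k * of_real x)) (at (of_real x))"
      using False by (auto intro!: derivative_eq_intros)
    from has_vector_derivative_real_field[OF this, of "{0..2*pi}"] show "((\<lambda>x. cexp k x / (\<i> * of_int k)) has_vector_derivative cexp k x) (at x within {0..2*pi})"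
      by (simp add: cexp_def)
  qed simp
  moreover have "cexp k (2 * pi) = 1"
  proof -
    have "cexp k (2 * pi) = exp (2 * of_int k * pi * \<i>)"
      by (simp add: cexp_def mult_ac)
    then show ?thesis using exp_integer_2pi[of "of_int k"] by simp
  qed
  ultimately show ?thesis using False by simp
qed

lemma fourier_unique:
  fixes c :: "int \<Rightarrow> complex"
  assumes "\<And>x. ((\<lambda>k. c k * cexp k x) has_sum 0) UNIV"
  shows "c m = 0"
proof -
  have abs: "(\<lambda>k. norm (c k)) summable_on UNIV"
    using assms[of 0] summable_on_iff_abs_summable_on_complex has_sum_imp_summable by fastforce
  have "norm (c m) \<le> e" if e: "e > 0" for e :: real
  proof -
    have "((\<lambda>k. norm (c k)) has_sum (\<Sum>\<^sub>\<infinity>k. norm (c k))) UNIV" using abs by simp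
    from has_sum_finite_approximation[OF this e] obtain F0 where
      F0: "finite F0" "dist (sum (\<lambda>k. norm (c k)) F0) (\<Sum>\<^sub>\<infinity>k. norm (c k)) \<le> e" by auto
    define F where "F = insert m F0"
    have F: "finite F" "m \<in> F" "F0 \<subseteq> F" using F0 by (auto simp: F_def)
    have abs': "(\<lambda>k. norm (c k)) summable_on (- F)" using abs by (rule summable_on_subset_banach) auto
    have tail: "(\<Sum>\<^sub>\<infinity>k\<in>- F. norm (c k)) \<le> e"
    proof -
      have "(\<Sum>\<^sub>\<infinity>k. norm (c k)) = (\<Sum>\<^sub>\<infinity>k\<in>F \<union> - F. norm (c k))" by simp
      also have "\<dots> = (\<Sum>\<^sub>\<infinity>k\<in>F. norm (c k)) + (\<Sum>\<^sub>\<infinity>k\<in>- F. norm (c k))"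
        by (rule infsum_Un_disjoint) (use abs' F in auto)
      also have "(\<Sum>\<^sub>\<infinity>k\<in>F. norm (c k)) = (\<Sum>k\<in>F. norm (c k))" using F by simp
      finally have "(\<Sum>\<^sub>\<infinity>k\<in>- F. norm (c k)) = (\<Sum>\<^sub>\<infinity>k. norm (c k)) - (\<Sum>k\<in>F. norm (c k))" by simp
      also have "\<dots> \<le> (\<Sum>\<^sub>\<infinity>k. norm (c k)) - (\<Sum>k\<in>F0. norm (c k))"
        using sum_mono2[of F F0 "\<lambda>k. norm (c k)"] F by auto
      also have "\<dots> \<le> e" using F0(2) by (simp add: dist_real_def)
      finally show ?thesis .
    qed
    have P: "norm (\<Sum>k\<in>F. c k * cexp k x) \<le> e" for x
    proof -
      have s: "(\<lambda>k. norm (c k * cexp k x)) summable_on (- F)" using abs' by (simp add: norm_mult)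
      have "0 = (\<Sum>\<^sub>\<infinity>k\<in>F \<union> - F. c k * cexp k x)" using assms[of x] by (simp add: infsumI)
      also have "\<dots> = (\<Sum>\<^sub>\<infinity>k\<in>F. c k * cexp k x) + (\<Sum>\<^sub>\<infinity>k\<in>- F. c k * cexp k x)"
        by (rule infsum_Un_disjoint) (use abs_summable_summable[OF s] F in auto)
      finally have "norm (\<Sum>k\<in>F. c k * cexp k x) = norm (\<Sum>\<^sub>\<infinity>k\<in>- F. c k * cexp k x)"
        using F by (simp add: add_eq_0_iff2)
      also have "\<dots> \<le> (\<Sum>\<^sub>\<infinity>k\<in>- F. norm (c k * cexp k x))"
        by (rule norm_infsum_bound[OF s])
      also have "\<dots> \<le> e" using tail by (simp add: norm_mult)
      finally show ?thesis .
    qed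
    have "((\<lambda>x. \<Sum>k\<in>F. c k * cexp (k - m) x) has_integral (\<Sum>k\<in>F. c k * (if k - m = 0 then 2 * pi else 0))) {0..2*pi}"
      by (intro has_integral_sum F has_integral_mult_right integral_cexp)
    moreover have "(\<Sum>k\<in>F. c k * complex_of_real (if k - m = 0 then 2 * pi else 0)) = c m * (2 * pi)"
      using F by (subst sum.remove[of _ m]) (auto intro!: sum.neutral)
    ultimately have int: "((\<lambda>x. \<Sum>k\<in>F. c k * cexp (k - m) x) has_integral (c m * (2 * pi))) {0..2*pi}"
      by simp
    have "norm (c m * (2 * pi)) \<le> e * measure lborel (cbox 0 (2*pi))"
    proof (rule has_integral_bound[OF _ int[unfolded interval_cbox]])
      fix x :: real
      have "(\<Sum>k\<in>F. c k * cexp (k - m) x) = (\<Sum>k\<in>F. c k * cexp k x) * cexp (- m) x"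
        using cexp_add[of _ "- m" x] by (simp add: sum_distrib_right mult.assoc)
      then show "norm (\<Sum>k\<in>F. c k * cexp (k - m) x) \<le> e"
        using P[of x] by (simp add: norm_mult)
    qed (use e in simp)
    then show ?thesis by (simp add: norm_mult)
  qed
  then have "norm (c m) \<le> 0" by (rule field_le_epsilon[of _ 0, simplified]) 
  then show ?thesis by simp
qed

section \<open>The coefficients of the square of a power series on a circle\<close>

definition corr :: "(nat \<Rightarrow> real) \<Rightarrow> real \<Rightarrow> int \<Rightarrow> real" where
  "corr b t m = (\<Sum>\<^sub>\<infinity>l. b (l + nat m) * b (l + nat (- m)) * t ^ (2 * l + nat \<bar>m\<bar>))"

lemma corr_sym: "corr b t (- m) = corr b t m"
  by (simp add: corr_def mult.commute)

lemma geometric_has_sum: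
  assumes "\<bar>t\<bar> < (1::real)"
  shows "((\<lambda>l. t ^ (2 * l + n)) has_sum (t ^ n / (1 - t\<^sup>2))) UNIV"
proof -
  have t2: "\<bar>t\<^sup>2\<bar> < 1" using assms by (simp add: abs_square_less_1)
  have "(\<lambda>l. (t\<^sup>2) ^ l) sums (1 / (1 - t\<^sup>2))" using t2 by (intro geometric_sums) simp
  then have "((\<lambda>l. (t\<^sup>2) ^ l) has_sum (1 / (1 - t\<^sup>2))) UNIV"
    by (rule norm_summable_imp_has_sum[rotated]) (use t2 in \<open>simp add: norm_power\<close>)
  from has_sum_cmult_right[OF this, of "t ^ n"] show ?thesis
    by (simp add: power_add power_mult[symmetric] mult.commute)
qed

context
  fixes b :: "nat \<Rightarrow> real" and t :: real
  assumes b: "\<And>j. \<bar>b j\<bar> \<le> 1" and t: "\<bar>t\<bar> < 1"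
begin

lemma corr_term_bound: "\<bar>b (l + nat m) * b (l + nat (- m)) * t ^ (2 * l + nat \<bar>m\<bar>)\<bar> \<le> \<bar>t\<bar> ^ (2 * l + nat \<bar>m\<bar>)"
proof -
  have "\<bar>b (l + nat m) * b (l + nat (- m))\<bar> \<le> 1 * 1"
    unfolding abs_mult by (intro mult_mono b) auto
  then show ?thesis by (simp add: abs_mult power_abs mult_left_le_one_le)
qed

lemma corr_has_sum: "((\<lambda>l. b (l + nat m) * b (l + nat (- m)) * t ^ (2 * l + nat \<bar>m\<bar>)) has_sum corr b t m) UNIV"
proof -
  have "(\<lambda>l. \<bar>t\<bar> ^ (2 * l + nat \<bar>m\<bar>)) summable_on UNIV"
    using geometric_has_sum[of "\<bar>t\<bar>"] t by (auto dest: has_sum_imp_summable)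
  then have "(\<lambda>l. norm (b (l + nat m) * b (l + nat (- m)) * t ^ (2 * l + nat \<bar>m\<bar>))) summable_on UNIV"
    by (rule summable_on_comparison_test) (simp_all only: real_norm_def corr_term_bound abs_ge_zero)
  then show ?thesis unfolding corr_def by (rule has_sum_infsum[OF abs_summable_summable])
qed

lemma corr_bound: "\<bar>corr b t m\<bar> \<le> \<bar>t\<bar> ^ nat \<bar>m\<bar> / (1 - t\<^sup>2)"
proof -
  have g: "((\<lambda>l. \<bar>t\<bar> ^ (2 * l + nat \<bar>m\<bar>)) has_sum (\<bar>t\<bar> ^ nat \<bar>m\<bar> / (1 - t\<^sup>2))) UNIV"
    using geometric_has_sum[of "\<bar>t\<bar>"] t by simp
  have "corr b t m \<le> \<bar>t\<bar> ^ nat \<bar>m\<bar> / (1 - t\<^sup>2)"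
    by (rule has_sum_mono[OF corr_has_sum g]) (rule abs_le_D1[OF corr_term_bound])
  moreover have "- corr b t m \<le> \<bar>t\<bar> ^ nat \<bar>m\<bar> / (1 - t\<^sup>2)"
    by (rule has_sum_mono[OF has_sum_uminusI[OF corr_has_sum] g]) (rule abs_le_D2[OF corr_term_bound])
  ultimately show ?thesis by linarith
qed

lemma corr_series:
  assumes B: "(\<lambda>j. of_real (b j) * (of_real t * cexp 1 x) ^ j) sums B"
  shows "((\<lambda>m. of_real (corr b t m) * cexp m x) has_sum (of_real ((norm B)\<^sup>2))) UNIV"
proof -
  let ?y = "of_real t * cexp 1 x"
  have pow: "cexp 1 x ^ j = cexp (int j) x" for j
    by (induction j) (simp_all add: cexp_add)
  have s1: "((\<lambda>j. of_real (b j) * ?y ^ j) has_sum B) UNIV"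
  proof (rule norm_summable_imp_has_sum[OF _ B])
    have "summable (\<lambda>j. \<bar>t\<bar> ^ j)" using t by (intro summable_geometric) simp
    then show "summable (\<lambda>j. norm (of_real (b j) * ?y ^ j))"
      by (rule summable_comparison_test[rotated])
         (use b in \<open>auto simp: norm_mult norm_power intro!: mult_left_le_one_le\<close>)
  qed
  then have s2: "((\<lambda>j. cnj (of_real (b j) * ?y ^ j)) has_sum cnj B) UNIV"
    by (simp only: has_sum_cnj_iff)
  let ?f = "\<lambda>(j, k). of_real (b j) * ?y ^ j * cnj (of_real (b k) * ?y ^ k)"
  have "(?f has_sum (B * cnj B)) (UNIV \<times> UNIV)"
    by (rule has_sum_product_complex[OF s1 s2])
  then have f: "(?f has_sum (of_real ((norm B)\<^sup>2))) UNIV"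
    by (simp only: complex_norm_square UNIV_Times_UNIV)
  have bij: "bij_betw (\<lambda>(m, l). (l + nat m, l + nat (- m))) UNIV UNIV"
  proof (rule bij_betw_byWitness[of _ "\<lambda>(j, k). (int j - int k, min j k)"])
    show "\<forall>a\<in>UNIV. (\<lambda>(j, k). (int j - int k, min j k)) ((\<lambda>(m, l). (l + nat m, l + nat (- m))) a) = a"
    proof
      fix a :: "int \<times> nat"
      obtain m l where a: "a = (m, l)" by (cases a)
      show "(\<lambda>(j, k). (int j - int k, min j k)) ((\<lambda>(m, l). (l + nat m, l + nat (- m))) a) = a"
        by (cases "0 \<le> m") (simp_all add: a)
    qed
    show "\<forall>a\<in>UNIV. (\<lambda>(m, l). (l + nat m, l + nat (- m))) ((\<lambda>(j, k). (int j - int k, min j k)) a) = a"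
    proof
      fix a :: "nat \<times> nat"
      obtain j k where a: "a = (j, k)" by (cases a)
      show "(\<lambda>(m, l). (l + nat m, l + nat (- m))) ((\<lambda>(j, k). (int j - int k, min j k)) a) = a"
        by (cases "k \<le> j") (simp_all add: a nat_diff_distrib min_def)
    qed
  qed auto
  from f have "((\<lambda>i. ?f ((\<lambda>(m, l). (l + nat m, l + nat (- m))) i)) has_sum (of_real ((norm B)\<^sup>2))) UNIV"
    by (subst has_sum_reindex_bij_betw[OF bij])
  then have "((\<lambda>i. ?f ((\<lambda>(m, l). (l + nat m, l + nat (- m))) i)) has_sum (of_real ((norm B)\<^sup>2))) (UNIV \<times> UNIV)" by simp
  then show ?thesis
  proof (rule has_sum_SigmaD)
    fix m :: int
    have eq: "?f ((\<lambda>(m, l). (l + nat m, l + nat (- m))) (m, l))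
        = of_real (b (l + nat m) * b (l + nat (- m)) * t ^ (2 * l + nat \<bar>m\<bar>)) * cexp m x" for l
    proof -
      have "cexp (int (l + nat m)) x * cexp (- int (l + nat (- m))) x = cexp m x"
        by (cases "0 \<le> m") (simp_all add: cexp_add[symmetric])
      moreover have "t ^ (l + nat m) * t ^ (l + nat (- m)) = t ^ (2 * l + nat \<bar>m\<bar>)"
        by (cases "0 \<le> m") (simp_all add: power_add[symmetric] mult_2 add_ac)
      ultimately show ?thesis
        by (simp add: power_mult_distrib pow cexp_cnj mult_ac flip: of_real_mult of_real_power)
    qed
    show "((\<lambda>l. ?f ((\<lambda>(m, l). (l + nat m, l + nat (- m))) (m, l))) has_sum (of_real (corr b t m) * cexp m x)) UNIV"
      unfolding eq by (intro has_sum_cmult_left has_sum_of_real corr_has_sum)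
  qed
qed

end

section \<open>The coefficients of the deformation\<close>

definition bcoef :: "nat \<Rightarrow> real" where
  "bcoef j = (-1) ^ j * ((-1/2) gchoose j)"

lemma bcoef_bound: "\<bar>bcoef j\<bar> \<le> 1"
proof (induction j)
  case (Suc j)
  have "((-1/2::real) gchoose Suc j) = ((-1/2) gchoose j) * ((-1/2 - real j) / (1 + real j))"
    using gbinomial_absorption'[of "Suc j" "-1/2::real"] gbinomial_mult_1[of "-1/2::real" j]
    by (simp add: field_simps)
  then have "\<bar>bcoef (Suc j)\<bar> = \<bar>bcoef j\<bar> * (\<bar>-1/2 - real j\<bar> / (1 + real j))"
    by (simp add: bcoef_def abs_mult abs_divide)
  also have "\<dots> \<le> 1 * 1"
    using Suc by (intro mult_mono) (auto simp: field_simps)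
  finally show ?case by simp
qed (simp add: bcoef_def)

lemma bcoef_sums:
  fixes y :: complex
  assumes "norm y < 1"
  shows "(\<lambda>j. of_real (bcoef j) * y ^ j) sums ((1 - y) powr (-1/2))"
proof -
  have "complex_of_real ((-1/2) gchoose j) = (-1/2) gchoose j" for j
    by (simp add: gbinomial_prod_rev)
  then have "of_real (bcoef j) * y ^ j = ((-1/2) gchoose j) * (- y) ^ j" for j
    by (simp add: bcoef_def power_minus[of y] mult_ac)
  then show ?thesis using gen_binomial_complex[of "- y" "-1/2"] assms by simp
qed

lemma norm_one_minus:
  "(norm (1 - of_real t * cexp 1 x))\<^sup>2 = 1 - 2 * cos x * t + t\<^sup>2"
proof -
  have c: "cexp 1 x = cis x" by (simp add: cexp_def cis_conv_exp)
  have "(norm (1 - of_real t * cexp 1 x))\<^sup>2 = (1 - t * cos x)\<^sup>2 + (t * sin x)\<^sup>2"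
    by (simp add: cmod_power2 c)
  also have "\<dots> = 1 - 2 * cos x * t + t\<^sup>2 * ((sin x)\<^sup>2 + (cos x)\<^sup>2)"
    by algebra
  finally show ?thesis by simp
qed

lemma abs_sin_less_1: "cos (\<theta>::real) \<noteq> 0 \<Longrightarrow> \<bar>sin \<theta>\<bar> < 1"
  using sin_cos_squared_add[of \<theta>] zero_less_power2[of "cos \<theta>"]
  by (subst abs_square_less_1[symmetric]) linarith

lemma one_minus_sin2: "1 - (sin (\<theta>::real))\<^sup>2 = (cos \<theta>)\<^sup>2"
  using sin_cos_squared_add[of \<theta>] by linarith

lemma wcoef_eq:
  assumes "cos \<theta> \<noteq> 0"
  shows "wcoef \<theta> = corr bcoef (sin \<theta>)"
    "((\<lambda>k. of_real (wcoef \<theta> k) * cexp k x) has_sum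
       complex_of_real ((1 - 2 * cos x * sin \<theta> + (sin \<theta>)\<^sup>2) powr (-1/2))) UNIV"
proof -
  let ?t = "sin \<theta>"
  have t: "\<bar>?t\<bar> < 1" by (rule abs_sin_less_1[OF assms])
  have main: "((\<lambda>k. of_real (corr bcoef ?t k) * cexp k x) has_sum
       complex_of_real ((1 - 2 * cos x * ?t + ?t\<^sup>2) powr (-1/2))) UNIV" for x
  proof -
    let ?y = "of_real ?t * cexp 1 x"
    have "norm ?y < 1" using t by (simp add: norm_mult)
    from corr_series[OF bcoef_bound t bcoef_sums[OF this]]
    have "((\<lambda>k. of_real (corr bcoef ?t k) * cexp k x) has_sum
       complex_of_real ((norm ((1 - ?y) powr (-1/2)))\<^sup>2)) UNIV" .
    also have "norm ((1 - ?y) powr (-1/2)) = norm (1 - ?y) powr (-1/2)"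
      using norm_powr_real_powr'[of "-1/2" "1 - ?y"] by simp
    also have "(norm (1 - ?y) powr (-1/2))\<^sup>2 = ((norm (1 - ?y))\<^sup>2) powr (-1/2)"
      by (simp add: power2_eq_square powr_mult)
    finally show ?thesis by (simp only: norm_one_minus)
  qed
  have "wcoef \<theta> = corr bcoef ?t"
    unfolding wcoef_def
  proof (rule the_equality)
    show "\<forall>x. ((\<lambda>k. complex_of_real (corr bcoef ?t k) * exp (\<i> * of_int k * of_real x)) has_sum
       complex_of_real ((1 - 2 * cos x * sin \<theta> + (sin \<theta>)\<^sup>2) powr (-1/2))) UNIV"
      using main by (simp add: cexp_def)
    fix w assume w: "\<forall>x. ((\<lambda>k. complex_of_real (w k) * exp (\<i> * of_int k * of_real x)) has_sum
       complex_of_real ((1 - 2 * cos x * sin \<theta> + (sin \<theta>)\<^sup>2) powr (-1/2))) UNIV"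
    show "w = corr bcoef ?t"
    proof
      fix m
      have "complex_of_real (w m) - of_real (corr bcoef ?t m) = 0"
      proof (rule fourier_unique)
        fix x
        have "((\<lambda>k. complex_of_real (w k) * cexp k x + - (of_real (corr bcoef ?t k) * cexp k x)) has_sum
          (complex_of_real ((1 - 2 * cos x * sin \<theta> + (sin \<theta>)\<^sup>2) powr (-1/2)) +
            - complex_of_real ((1 - 2 * cos x * sin \<theta> + (sin \<theta>)\<^sup>2) powr (-1/2)))) UNIV"
          by (intro has_sum_add has_sum_uminusI main) (use w in \<open>simp add: cexp_def\<close>)
        then show "((\<lambda>k. (complex_of_real (w k) - of_real (corr bcoef ?t k)) * cexp k x) has_sum 0) UNIV"
          by (simp add: left_diff_distrib)
      qed
      then show "w m = corr bcoef ?t m" by simp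
    qed
  qed
  then show "wcoef \<theta> = corr bcoef ?t"
    "((\<lambda>k. of_real (wcoef \<theta> k) * cexp k x) has_sum
       complex_of_real ((1 - 2 * cos x * sin \<theta> + (sin \<theta>)\<^sup>2) powr (-1/2))) UNIV"
    using main by simp_all
qed

lemma wcoef_sym: "cos \<theta> \<noteq> 0 \<Longrightarrow> wcoef \<theta> (- k) = wcoef \<theta> k"
  by (simp add: wcoef_eq corr_sym)

lemma wcoef_bound: "cos \<theta> \<noteq> 0 \<Longrightarrow> \<bar>wcoef \<theta> k\<bar> \<le> \<bar>sin \<theta>\<bar> ^ nat \<bar>k\<bar> / (cos \<theta>)\<^sup>2"
  using corr_bound[OF bcoef_bound abs_sin_less_1] by (simp add: wcoef_eq one_minus_sin2)

definition gcoef :: "real \<Rightarrow> int \<Rightarrow> real" where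
  "gcoef \<theta> k = sin \<theta> ^ nat \<bar>k\<bar> / (cos \<theta>)\<^sup>2"

lemma gcoef_series:
  assumes "cos \<theta> \<noteq> 0"
  shows "((\<lambda>k. of_real (gcoef \<theta> k) * cexp k x) has_sum
       complex_of_real (1 / (1 - 2 * cos x * sin \<theta> + (sin \<theta>)\<^sup>2))) UNIV"
proof -
  let ?t = "sin \<theta>" and ?y = "of_real (sin \<theta>) * cexp 1 x"
  have t: "\<bar>?t\<bar> < 1" by (rule abs_sin_less_1[OF assms])
  have c: "corr (\<lambda>_. 1) ?t k = gcoef \<theta> k" for k
    using geometric_has_sum[OF t, of "nat \<bar>k\<bar>"] by (simp add: corr_def gcoef_def infsumI one_minus_sin2)
  have y: "norm ?y < 1" using t by (simp add: norm_mult)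
  have "((\<lambda>m. of_real (corr (\<lambda>_. 1) ?t m) * cexp m x) has_sum (of_real ((norm (1 / (1 - ?y)))\<^sup>2))) UNIV"
    by (rule corr_series) (use t geometric_sums[OF y] in auto)
  moreover have "(norm (1 / (1 - ?y)))\<^sup>2 = 1 / (norm (1 - ?y))\<^sup>2"
    by (simp add: norm_divide power_divide)
  ultimately show ?thesis unfolding c norm_one_minus by simp
qed

lemma wcoef_conv:
  assumes "cos \<theta> \<noteq> 0"
  shows "((\<lambda>j. wcoef \<theta> (x - j) * wcoef \<theta> (y - j)) has_sum gcoef \<theta> (x - y)) UNIV"
proof -
  let ?w = "wcoef \<theta>"
  define V where "V x = (1 - 2 * cos x * sin \<theta> + (sin \<theta>)\<^sup>2) powr (-1/2)" for x
  have V: "(V x)\<^sup>2 = 1 / (1 - 2 * cos x * sin \<theta> + (sin \<theta>)\<^sup>2)" for x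
  proof -
    have "0 \<le> 1 - 2 * cos x * sin \<theta> + (sin \<theta>)\<^sup>2"
      using norm_one_minus[of "sin \<theta>" x] by (metis zero_le_power2)
    then show ?thesis unfolding V_def
      by (simp add: power2_eq_square powr_add[symmetric] powr_minus_divide)
  qed
  have s: "((\<lambda>k. of_real (?w k) * cexp k x) has_sum complex_of_real (V x)) UNIV" for x
    unfolding V_def by (rule wcoef_eq(2)[OF assms])
  have prod: "((\<lambda>(m, j). of_real (?w j) * cexp j x * (of_real (?w (m - j)) * cexp (m - j) x)) has_sum
      of_real ((V x)\<^sup>2)) (UNIV \<times> UNIV)" for x
  proof -
    have bij: "bij_betw (\<lambda>(m, j). (j, m - j)) (UNIV :: (int \<times> int) set) UNIV"
      by (rule bij_betw_byWitness[of _ "\<lambda>(j, k). (j + k, j)"]) auto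
    have "((\<lambda>(j, k). of_real (?w j) * cexp j x * (of_real (?w k) * cexp k x)) has_sum
      of_real ((V x)\<^sup>2)) UNIV"
      using has_sum_product_complex[OF s s, of x x] by (simp add: power2_eq_square)
    then have "((\<lambda>i. (\<lambda>(j, k). of_real (?w j) * cexp j x * (of_real (?w k) * cexp k x)) ((\<lambda>(m, j). (j, m - j)) i)) has_sum
      of_real ((V x)\<^sup>2)) UNIV"
      by (subst has_sum_reindex_bij_betw[OF bij])
    then show ?thesis by (simp add: case_prod_unfold)
  qed
  define u where "u m = (\<Sum>\<^sub>\<infinity>j. ?w j * ?w (m - j))" for m
  have u: "((\<lambda>j. ?w j * ?w (m - j)) has_sum u m) UNIV" for m
  proof -
    have "(\<lambda>(m, j). complex_of_real (?w j * ?w (m - j))) summable_on UNIV \<times> UNIV"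
      using prod[of 0] by (auto dest!: has_sum_imp_summable simp: case_prod_unfold)
    then have "(\<lambda>j. complex_of_real (?w j * ?w (m - j))) summable_on UNIV"
      by (rule summable_on_SigmaD1) simp
    then have "(\<lambda>j. ?w j * ?w (m - j)) summable_on UNIV"
      using summable_on_Re by fastforce
    then show ?thesis unfolding u_def by (rule has_sum_infsum)
  qed
  have us: "((\<lambda>m. of_real (u m) * cexp m x) has_sum of_real ((V x)\<^sup>2)) UNIV" for x
  proof (rule has_sum_SigmaD[OF prod])
    fix m
    have eq: "of_real (?w j) * cexp j x * (of_real (?w (m - j)) * cexp (m - j) x)
       = of_real (?w j * ?w (m - j)) * cexp m x" for j
      using cexp_add[of j "m - j" x] by (simp add: mult_ac)
    show "((\<lambda>j. (\<lambda>(m, j). of_real (?w j) * cexp j x * (of_real (?w (m - j)) * cexp (m - j) x)) (m, j))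
        has_sum (of_real (u m) * cexp m x)) UNIV"
      unfolding prod.case eq by (rule has_sum_cmult_left[OF has_sum_of_real[OF u]])
  qed
  have "complex_of_real (u m) - of_real (gcoef \<theta> m) = 0" for m
  proof (rule fourier_unique)
    fix x
    have "((\<lambda>k. complex_of_real (u k) * cexp k x + - (of_real (gcoef \<theta> k) * cexp k x)) has_sum
       (of_real ((V x)\<^sup>2) + - of_real ((V x)\<^sup>2))) UNIV"
      unfolding V by (intro has_sum_add has_sum_uminusI us[unfolded V] gcoef_series assms)
    then show "((\<lambda>k. (complex_of_real (u k) - of_real (gcoef \<theta> k)) * cexp k x) has_sum 0) UNIV"
      by (simp add: left_diff_distrib)
  qed
  then have ug: "u m = gcoef \<theta> m" for m by simp
  have bij: "bij_betw (\<lambda>j. x - j) (UNIV :: int set) UNIV"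
    by (rule bij_betw_byWitness[of _ "\<lambda>j. x - j"]) auto
  have "((\<lambda>j. ?w j * ?w (x - y - j)) has_sum gcoef \<theta> (x - y)) UNIV"
    using u[of "x - y"] by (simp add: ug)
  then have "((\<lambda>j. ?w (x - j) * ?w (x - y - (x - j))) has_sum gcoef \<theta> (x - y)) UNIV"
    by (subst has_sum_reindex_bij_betw[OF bij])
  moreover have "?w (x - y - (x - j)) = ?w (y - j)" for j
    using wcoef_sym[OF assms, of "y - j"] by simp
  ultimately show ?thesis by simp
qed

section \<open>Real matrices\<close>

definition rm :: "(int \<Rightarrow> int \<Rightarrow> real) \<Rightarrow> (int \<Rightarrow> int \<Rightarrow> real) \<Rightarrow> int \<Rightarrow> int \<Rightarrow> real" where
  "rm X Y n k = (\<Sum>\<^sub>\<infinity>l. X n l * Y l k)"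

definition id_mat :: "int \<Rightarrow> int \<Rightarrow> real" where
  "id_mat n k = of_bool (n = k)"

lemma rmul_ix: "rmul q M N (ix p n) (ix r k) = rm (\<lambda>n k. M (ix p n) (ix q k)) (\<lambda>n k. N (ix q n) (ix r k)) n k"
  by (simp add: rmul_def rm_def infsum_ZZ)

lemma two_point_has_sum:
  fixes f :: "int \<Rightarrow> real"
  shows "((\<lambda>l. (a * of_bool (l = n) + b * of_bool (l = m)) * f l) has_sum (a * f n + b * f m)) UNIV"
proof -
  have "((\<lambda>l. of_bool (l = n) * (c * f l)) has_sum (c * f n)) UNIV" for c n
    by (rule has_sum_finite_neutralI[of "{n}"]) auto
  from has_sum_add[OF this[of n a] this[of m b]] show ?thesis
    by (simp add: algebra_simps)
qed

lemma poly_geometric_bounded: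
  fixes r :: real
  assumes "0 \<le> r" "r < 1"
  shows "\<exists>C\<ge>0. \<forall>n. (1 + real n) ^ N * r ^ n \<le> C"
  using assms
proof (induction N arbitrary: r)
  case 0
  then show ?case by (intro exI[of _ 1]) (auto intro: power_le_one)
next
  case (Suc N)
  define q where "q = sqrt r"
  have q: "0 \<le> q" "q < 1" "r = q * q" using Suc.prems by (auto simp: q_def)
  from Suc.IH[OF q(1,2)] obtain C where C: "0 \<le> C" "\<And>n. (1 + real n) ^ N * q ^ n \<le> C" by blast
  have "(\<lambda>n. real n * q ^ n) \<longlonglongrightarrow> 0" using powser_times_n_limit_0[of q] q by simp
  then have "Bseq (\<lambda>n. real n * q ^ n)" by (intro convergent_imp_Bseq) (auto simp: convergent_def)
  then obtain D where D: "\<And>n. norm (real n * q ^ n) \<le> D" by (auto simp: Bseq_def)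
  have D': "(1 + real n) * q ^ n \<le> 1 + D" for n
    using D[of n] power_le_one[OF q(1), of n] q by (simp add: distrib_right)
  have D0: "0 \<le> D" using D[of 0] by simp
  have "(1 + real n) ^ Suc N * r ^ n \<le> C * (1 + D)" for n
  proof -
    have "(1 + real n) ^ Suc N * r ^ n = ((1 + real n) ^ N * q ^ n) * ((1 + real n) * q ^ n)"
      by (simp add: q(3) power_mult_distrib)
    also have "\<dots> \<le> C * (1 + D)"
      using C D' q by (intro mult_mono) auto
    finally show ?thesis .
  qed
  then show ?case using C(1) D0 by (intro exI[of _ "C * (1 + D)"]) auto
qed

context loop_algebra
begin

definition emb :: "(int \<Rightarrow> int \<Rightarrow> real) \<Rightarrow> int \<Rightarrow> int \<Rightarrow> 'a series" where
  "emb X n k = bscale (X n k) (bmono z 0)"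

lemma ev_emb: "ev (emb X n k) g = (if g = (Even, 0) then X n k *\<^sub>R 1 else 0)"
  by (cases g) (simp add: emb_def bscale_def bmono_def)

lemma bmul_bscale_one: "bmul (bscale r (bmono z 0)) c = bscale r c"
proof (intro ext)
  fix s k
  have "(\<Sum>\<^sub>\<infinity>n. bscale r (bmono z 0) Even n * c s (k - n) + bscale r (bmono z 0) Odd n * c (padd Odd s) (n - k))
      = bscale r (bmono z 0) Even 0 * c s (k - 0) + bscale r (bmono z 0) Odd 0 * c (padd Odd s) (0 - k)"
    by (rule infsum_single) (auto simp: bmono_def bscale_def)
  then show "bmul (bscale r (bmono z 0)) c s k = bscale r c s k"
    by (simp add: bmul_def bscale_def bmono_def)
qed

lemma cs_one: obtains p where "continuous_seminorm p" "1 \<le> p (1::'a)"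
proof -
  have "open (- {1::'a})" by auto
  from locally_convex[OF this, of 0] obtain p where "continuous_seminorm p" "{y. p (y - 0) < 1} \<subseteq> - {1::'a}" by auto
  then show ?thesis using that[of p] by (auto simp: not_less[symmetric])
qed

lemma tm_emb_iff:
  "tm (emb X) \<longleftrightarrow>
     (\<forall>N. (\<exists>K C. 0 \<le> C \<and> (\<forall>n k. (1 + \<bar>real_of_int n\<bar>) ^ N * \<bar>X n k\<bar> \<le> C * (1 + \<bar>real_of_int k\<bar>) ^ K)) \<and>
          (\<exists>K C. 0 \<le> C \<and> (\<forall>k n. (1 + \<bar>real_of_int k\<bar>) ^ N * \<bar>X n k\<bar> \<le> C * (1 + \<bar>real_of_int n\<bar>) ^ K)))"
    (is "_ \<longleftrightarrow> ?R")
proof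
  assume X: "tm (emb X)"
  obtain p where p: "continuous_seminorm p" "1 \<le> p (1::'a)" by (rule cs_one)
  have le: "w * \<bar>X n k\<bar> \<le> B" if "\<And>g. w * (1 + gsz g) ^ N * p (ev (emb X n k) g) \<le> B" "0 \<le> w" for w N n k B
  proof -
    have "w * \<bar>X n k\<bar> * 1 \<le> w * \<bar>X n k\<bar> * p 1"
      using p(2) that(2) by (intro mult_left_mono) auto
    also have "\<dots> \<le> B" using that(1)[of "(Even, 0)"] by (simp del: ev_pair add: ev_emb cs_scale[OF p(1)] gsz_def mult.assoc)
    finally show ?thesis by simp
  qed
  show ?R
  proof (intro allI conjI)
    fix N
    from tm_col[OF X p(1), where N = N] obtain K C where C: "0 \<le> C"
      "\<And>n k g. (1 + \<bar>real_of_int n\<bar>) ^ N * (1 + gsz g) ^ N * p (ev (emb X n k) g) \<le> C * (1 + \<bar>real_of_int k\<bar>) ^ K" by metis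
    show "\<exists>K C. 0 \<le> C \<and> (\<forall>n k. (1 + \<bar>real_of_int n\<bar>) ^ N * \<bar>X n k\<bar> \<le> C * (1 + \<bar>real_of_int k\<bar>) ^ K)"
      using C(1) le[OF C(2)] by (intro exI[of _ K] exI[of _ C]) simp
    from tm_row[OF X p(1), where N = N] obtain K C where C: "0 \<le> C"
      "\<And>n k g. (1 + \<bar>real_of_int k\<bar>) ^ N * (1 + gsz g) ^ N * p (ev (emb X n k) g) \<le> C * (1 + \<bar>real_of_int n\<bar>) ^ K" by metis
    show "\<exists>K C. 0 \<le> C \<and> (\<forall>k n. (1 + \<bar>real_of_int k\<bar>) ^ N * \<bar>X n k\<bar> \<le> C * (1 + \<bar>real_of_int n\<bar>) ^ K)"
      using C(1) le[OF C(2)] by (intro exI[of _ K] exI[of _ C]) simp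
  qed
next
  assume R: ?R
  have le: "w * (1 + gsz g) ^ N * p (ev (emb X n k) g) \<le> C * p 1 * B"
    if "continuous_seminorm p" "w * \<bar>X n k\<bar> \<le> C * B" "0 \<le> C * B" for p w N g n k C B
  proof (cases "g = (Even, 0)")
    case True
    have "w * \<bar>X n k\<bar> * p 1 \<le> C * B * p 1"
      using that by (intro mult_right_mono) (auto simp: cs_nonneg)
    then show ?thesis using True by (simp del: ev_pair add: ev_emb cs_scale[OF that(1)] gsz_def mult_ac)
  next
    case False
    have "0 \<le> C * B * p 1" using that by (auto simp: cs_nonneg)
    then show ?thesis using False by (simp add: ev_emb cs_zero[OF that(1)] mult_ac)
  qed
  show "tm (emb X)"
    unfolding tm_def
  proof (intro conjI allI impI)
    show "ev (emb X n k) g \<in> Hg g" for n k g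
      using zpow_Hg[of 0] by (auto simp: ev_emb Hg_scale)
    fix p :: "'a \<Rightarrow> real" and N assume p: "continuous_seminorm p"
    from R obtain K C where C: "0 \<le> C" "\<And>n k. (1 + \<bar>real_of_int n\<bar>) ^ N * \<bar>X n k\<bar> \<le> C * (1 + \<bar>real_of_int k\<bar>) ^ K" by blast
    then show "\<exists>K C. 0 \<le> C \<and> (\<forall>n k g. (1 + \<bar>real_of_int n\<bar>) ^ N * (1 + gsz g) ^ N * p (ev (emb X n k) g) \<le> C * (1 + \<bar>real_of_int k\<bar>) ^ K)"
      using le[OF p C(2)] cs_nonneg[OF p] by (intro exI[of _ K] exI[of _ "C * p 1"]) auto
    from R obtain K C where C: "0 \<le> C" "\<And>k n. (1 + \<bar>real_of_int k\<bar>) ^ N * \<bar>X n k\<bar> \<le> C * (1 + \<bar>real_of_int n\<bar>) ^ K" by blast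
    then show "\<exists>K C. 0 \<le> C \<and> (\<forall>n k g. (1 + \<bar>real_of_int k\<bar>) ^ N * (1 + gsz g) ^ N * p (ev (emb X n k) g) \<le> C * (1 + \<bar>real_of_int n\<bar>) ^ K)"
      using le[OF p C(2)] cs_nonneg[OF p] by (intro exI[of _ K] exI[of _ "C * p 1"]) auto
  qed
qed

lemma tempered_real_iff:
  assumes "i \<le> 1"
  shows "tempered i i (\<lambda>n k. \<bar>M n k\<bar>) \<longleftrightarrow> tm (emb (\<lambda>n k. M (ix i n) (ix i k)))"
  unfolding tm_emb_iff by (rule tempered_iff[OF assms assms]) auto

lemma emb_summable:
  assumes "tm (emb X)" "tm (emb Y)"
  shows "(\<lambda>l. X n l * Y l k) summable_on UNIV"
proof -
  obtain M where M: "(\<lambda>l::int. 1 / (1 + \<bar>real_of_int l\<bar>) ^ M) summable_on UNIV"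
    using poly_size_summable[OF poly_size_int] by blast
  from assms(1) obtain K C where C: "0 \<le> C" "\<And>k n. (1 + \<bar>real_of_int k\<bar>) ^ M * \<bar>X n k\<bar> \<le> C * (1 + \<bar>real_of_int n\<bar>) ^ K"
    unfolding tm_emb_iff by blast
  from assms(2) obtain K' C' where C': "0 \<le> C'" "\<And>n k. (1 + \<bar>real_of_int n\<bar>) ^ 0 * \<bar>Y n k\<bar> \<le> C' * (1 + \<bar>real_of_int k\<bar>) ^ K'"
    unfolding tm_emb_iff by blast
  let ?B = "C * (1 + \<bar>real_of_int n\<bar>) ^ K * (C' * (1 + \<bar>real_of_int k\<bar>) ^ K')"
  have "(\<lambda>l. norm (X n l * Y l k)) summable_on UNIV"
  proof (rule summable_on_comparison_test)
    show "(\<lambda>l::int. ?B * (1 / (1 + \<bar>real_of_int l\<bar>) ^ M)) summable_on UNIV"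
      by (rule summable_on_cmult_right[OF M])
    fix l :: int
    have "(1 + \<bar>real_of_int l\<bar>) ^ M * \<bar>X n l\<bar> * \<bar>Y l k\<bar> \<le> ?B"
      by (rule mult_mono[OF C(2)]) (use C C' C'(2)[of l k] in auto)
    moreover have "0 < (1 + \<bar>real_of_int l\<bar>) ^ M" by (intro zero_less_power) simp
    ultimately show "norm (X n l * Y l k) \<le> ?B * (1 / (1 + \<bar>real_of_int l\<bar>) ^ M)"
      by (simp add: abs_mult field_simps)
  qed auto
  then show ?thesis by (rule abs_summable_summable)
qed

lemma mm_emb:
  assumes "tm (emb X)" "tm (emb Y)"
  shows "mm (emb X) (emb Y) = emb (rm X Y)"
proof (intro ext)
  fix n k and s :: parity and m :: int
  have "((\<lambda>l. X n l * Y l k) has_sum rm X Y n k) UNIV"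
    unfolding rm_def by (rule has_sum_infsum[OF emb_summable[OF assms]])
  from has_sum_scaleR_elem[OF this, of "bmono z 0 s m"]
  have "((\<lambda>l. bmul (emb X n l) (emb Y l k) s m) has_sum emb (rm X Y) n k s m) UNIV"
    by (simp add: emb_def bmul_bscale_one) (simp add: bscale_def)
  then show "mm (emb X) (emb Y) n k s m = emb (rm X Y) n k s m"
    by (simp add: mm_def infsumI)
qed

lemma emb_eq_iff: "emb X = emb Y \<longleftrightarrow> X = Y"
proof
  assume "emb X = emb Y"
  then have "ev (emb X n k) (Even, 0) = ev (emb Y n k) (Even, 0)" for n k by simp
  then show "X = Y" by (intro ext) (simp del: ev_pair add: ev_emb)
qed simp

lemma emb_id: "emb id_mat = one_mat"
  by (intro ext) (simp add: emb_def id_mat_def one_mat_def Diag_def bscale_def)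

lemma tm_emb_band:
  assumes "\<And>n k. \<bar>X n k\<bar> \<le> R" "\<And>n k. X n k \<noteq> 0 \<Longrightarrow> \<bar>n - k\<bar> \<le> 1"
  shows "tm (emb X)"
proof -
  have *: "\<bar>real_of_int n\<bar> \<le> gsz g + \<bar>real_of_int k\<bar> + 3 \<and> \<bar>real_of_int k\<bar> \<le> gsz g + \<bar>real_of_int n\<bar> + 3"
    if "X n k \<noteq> 0" for n k g
    using assms(2)[OF that] gsz_nonneg[of g] by linarith
  have "tm (\<lambda>n k. gscale (\<lambda>_. X n k) (bmono z 0))"
    by (rule tm_gscale[where R = R]) (use assms * in auto)
  then show ?thesis by (simp add: emb_def[abs_def] bscale_gscale)
qed

lemma tm_emb_toeplitz:
  assumes "0 \<le> r" "r < 1" "0 \<le> B" and w: "\<And>k. \<bar>w k\<bar> \<le> B * r ^ nat \<bar>k\<bar>"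
  shows "tm (emb (\<lambda>n k. w (n - k)))"
proof -
  have main: "\<exists>C\<ge>0. \<forall>n k. (1 + \<bar>real_of_int n\<bar>) ^ N * \<bar>w (n - k)\<bar> \<le> C * (1 + \<bar>real_of_int k\<bar>) ^ N \<and>
     (1 + \<bar>real_of_int k\<bar>) ^ N * \<bar>w (n - k)\<bar> \<le> C * (1 + \<bar>real_of_int n\<bar>) ^ N" for N
  proof -
    from poly_geometric_bounded[OF assms(1,2), of N] obtain C where
      C: "0 \<le> C" "\<And>n. (1 + real n) ^ N * r ^ n \<le> C" by blast
    have le: "(1 + \<bar>real_of_int n\<bar>) ^ N * \<bar>w j\<bar> \<le> C * B * (1 + \<bar>real_of_int k\<bar>) ^ N" if "\<bar>n\<bar> \<le> \<bar>k\<bar> + \<bar>j\<bar>" for n k j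
    proof -
      have "0 \<le> \<bar>real_of_int k\<bar> * real (nat \<bar>j\<bar>)" by simp
      moreover have "(1 + \<bar>real_of_int k\<bar>) * (1 + real (nat \<bar>j\<bar>)) = 1 + \<bar>real_of_int k\<bar> + real (nat \<bar>j\<bar>) + \<bar>real_of_int k\<bar> * real (nat \<bar>j\<bar>)"
        by (simp add: algebra_simps)
      moreover have "\<bar>real_of_int n\<bar> \<le> \<bar>real_of_int k\<bar> + real (nat \<bar>j\<bar>)"
        using that by linarith
      ultimately have "1 + \<bar>real_of_int n\<bar> \<le> (1 + \<bar>real_of_int k\<bar>) * (1 + real (nat \<bar>j\<bar>))"
        by linarith
      then have "(1 + \<bar>real_of_int n\<bar>) ^ N \<le> (1 + \<bar>real_of_int k\<bar>) ^ N * (1 + real (nat \<bar>j\<bar>)) ^ N"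
        by (rule pow_shift_bound) simp
      then have "(1 + \<bar>real_of_int n\<bar>) ^ N * \<bar>w j\<bar> \<le> (1 + \<bar>real_of_int k\<bar>) ^ N * (1 + real (nat \<bar>j\<bar>)) ^ N * (B * r ^ nat \<bar>j\<bar>)"
        using w[of j] by (intro mult_mono) auto
      also have "\<dots> = B * (1 + \<bar>real_of_int k\<bar>) ^ N * ((1 + real (nat \<bar>j\<bar>)) ^ N * r ^ nat \<bar>j\<bar>)"
        by (simp add: mult_ac)
      also have "\<dots> \<le> B * (1 + \<bar>real_of_int k\<bar>) ^ N * C"
        by (rule mult_left_mono[OF C(2)]) (use assms(3) in auto)
      finally show ?thesis by (simp add: mult_ac)
    qed
    show ?thesis using C(1) assms(3) by (intro exI[of _ "C * B"]) (auto intro!: le)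
  qed
  show ?thesis
    unfolding tm_emb_iff using main by meson
qed

lemma rinvI:
  fixes Y :: "int \<Rightarrow> int \<Rightarrow> real"
  assumes i: "i \<le> 1"
    and X: "tm (emb (\<lambda>n k. M (ix i n) (ix i k)))" and Y: "tm (emb Y)"
    and inv: "rm (\<lambda>n k. M (ix i n) (ix i k)) Y = id_mat" "rm Y (\<lambda>n k. M (ix i n) (ix i k)) = id_mat"
  shows "rinv i M (ix i n) (ix i k) = Y n k"
proof -
  let ?X = "\<lambda>n k. M (ix i n) (ix i k)"
  define Z where "Z x y = (if x \<in> ZZ i \<and> y \<in> ZZ i then Y \<lfloor>x + real i / 2\<rfloor> \<lfloor>y + real i / 2\<rfloor> else 0)" for x y
  have Z: "Z (ix i n) (ix i k) = Y n k" for n k by (simp add: Z_def)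
  let ?P = "\<lambda>M'. (\<forall>n k. n \<notin> ZZ i \<or> k \<notin> ZZ i \<longrightarrow> M' n k = 0) \<and>
     tempered i i (\<lambda>n k. \<bar>M' n k\<bar>) \<and>
     mat_eq i i (rmul i M M') (\<lambda>n k. of_bool (n = k)) \<and>
     mat_eq i i (rmul i M' M) (\<lambda>n k. of_bool (n = k))"
  have "rinv i M = Z"
    unfolding rinv_def
  proof (rule the_equality)
    have "mat_eq i i (rmul i M Z) (\<lambda>n k. of_bool (n = k))" "mat_eq i i (rmul i Z M) (\<lambda>n k. of_bool (n = k))"
      using fun_cong[OF fun_cong[OF inv(1)]] fun_cong[OF fun_cong[OF inv(2)]]
      by (simp_all add: mat_eq_ix rmul_ix Z id_mat_def)
    then show "?P Z" using Y by (auto simp: tempered_real_iff[OF i] Z) (auto simp: Z_def)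
    fix M' assume M': "?P M'"
    let ?Y' = "\<lambda>n k. M' (ix i n) (ix i k)"
    have tY': "tm (emb ?Y')" using M' by (simp add: tempered_real_iff[OF i])
    have "rm ?X ?Y' = id_mat"
      using M' by (intro ext) (simp add: mat_eq_ix rmul_ix id_mat_def)
    then have "mm (emb ?X) (emb ?Y') = one_mat" "mm (emb Y) (emb ?X) = one_mat"
      using inv by (simp_all add: mm_emb X Y tY' emb_id)
    from mm_inverse_unique[OF X Y tY' this(2,1)] have "Y = ?Y'" by (simp add: emb_eq_iff)
    then have Ye: "Y n k = M' (ix i n) (ix i k)" for n k by (simp add: fun_eq_iff)
    show "M' = Z"
    proof (intro ext)
      fix x y
      show "M' x y = Z x y"
      proof (cases "x \<in> ZZ i \<and> y \<in> ZZ i")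
        case True
        then obtain n k where "x = ix i n" "y = ix i k" by (auto simp: ZZ_ix)
        then show ?thesis by (simp add: Z Ye)
      next
        case False
        then show ?thesis using M' by (auto simp: Z_def)
      qed
    qed
  qed
  then show ?thesis by (simp add: Z)
qed

end

section \<open>The deformation matrices\<close>

text \<open>Each row of the matrix \<open>F\<close> has the entry \<open>al\<close> on the diagonal and the entry \<open>be\<close> in column \<open>nb\<close>.\<close>

definition al :: "nat \<Rightarrow> real \<Rightarrow> int \<Rightarrow> real" where
  "al i \<theta> n = (if i = 0 then (if n = 0 then cos \<theta> else 1) else if n = 0 \<or> n = 1 then cos (\<theta>/2) else 1)"

definition be :: "nat \<Rightarrow> real \<Rightarrow> int \<Rightarrow> real" where
  "be i \<theta> n = (if i = 0 then (if n = 0 then 0 else - sin \<theta>) else if n = 0 \<or> n = 1 then - sin (\<theta>/2) else - sin \<theta>)"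

definition nb :: "nat \<Rightarrow> int \<Rightarrow> int" where
  "nb i n = (if i = 0 then n - sgn n else if n \<ge> 1 then n - 1 else n + 1)"

definition Fi :: "nat \<Rightarrow> real \<Rightarrow> int \<Rightarrow> int \<Rightarrow> real" where
  "Fi i \<theta> n l = al i \<theta> n * of_bool (l = n) + be i \<theta> n * of_bool (l = nb i n)"

definition Di :: "nat \<Rightarrow> real \<Rightarrow> int \<Rightarrow> int \<Rightarrow> real" where
  "Di i \<theta> n k = al i \<theta> n * wcoef \<theta> (n - k) + be i \<theta> n * wcoef \<theta> (nb i n - k)"

lemma Fmat_ix_0: "Fmat 0 \<theta> (ix 0 n) (ix 0 l) = Fi 0 \<theta> n l"
proof -
  consider "n = 0" | "n \<ge> 1" | "n \<le> -1" by linarith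
  then show ?thesis
    by cases (auto simp: Fmat_def ix_def Fi_def al_def be_def nb_def of_bool_def sgn_if)
qed

lemma Fmat_ix_1: "Fmat 1 \<theta> (ix 1 n) (ix 1 l) = Fi 1 \<theta> n l"
proof -
  have e: "real_of_int n - 1/2 = real_of_int m + 1/2 \<longleftrightarrow> n = m + 1"
    "real_of_int n - 1/2 = - (real_of_int m - 1/2) \<longleftrightarrow> n = 1 - m" for n m by linarith+
  have a: "\<bar>real_of_int n - 1/2\<bar> = 1/2 \<longleftrightarrow> n = 0 \<or> n = 1"
  proof
    assume "\<bar>real_of_int n - 1/2\<bar> = 1/2"
    then have "real_of_int n = 0 \<or> real_of_int n = 1" by (auto simp: abs_if split: if_splits)
    then show "n = 0 \<or> n = 1" by linarith
  qed auto
  have g: "real_of_int n - 1/2 \<ge> 3/2 \<longleftrightarrow> n \<ge> 2" "real_of_int n - 1/2 \<le> -3/2 \<longleftrightarrow> n \<le> -1" by linarith+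
  have m: "real_of_int l - 1/2 = real_of_int n - 1/2 - 1 \<longleftrightarrow> l = n - 1"
     "real_of_int l - 1/2 = real_of_int n - 1/2 + 1 \<longleftrightarrow> l = n + 1"
     "real_of_int n - 1/2 = real_of_int l - 1/2 \<longleftrightarrow> n = l" by linarith+
  consider "n = 0" | "n = 1" | "n \<ge> 2" | "n \<le> -1" by linarith
  then show ?thesis
    unfolding Fmat_def ix_def of_nat_1 a g m e(2)
    by cases (auto simp: Fi_def al_def be_def nb_def)
qed

lemma Dmat_ix:
  assumes "i \<le> 1"
  shows "Dmat i \<theta> (ix i n) (ix i k) = Di i \<theta> n k" "rm (Fi i \<theta>) (\<lambda>n k. wcoef \<theta> (n - k)) = Di i \<theta>"
proof -
  have 1: "rm (Fi i \<theta>) (\<lambda>n k. wcoef \<theta> (n - k)) n k = Di i \<theta> n k" for n k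
    using two_point_has_sum[of "al i \<theta> n" n "be i \<theta> n" "nb i n" "\<lambda>l. wcoef \<theta> (l - k)"]
    by (simp add: rm_def Fi_def Di_def infsumI)
  have i: "i = 0 \<or> i = 1" using assms by auto
  then have F: "Fmat i \<theta> (ix i n) (ix i l) = Fi i \<theta> n l" for n l
    using Fmat_ix_0 Fmat_ix_1 by auto
  have "\<lfloor>ix i n - ix i k\<rfloor> = n - k" for n k by (simp add: ix_def flip: of_int_diff)
  then show "Dmat i \<theta> (ix i n) (ix i k) = Di i \<theta> n k"
    unfolding Dmat_def rmul_ix by (simp add: F 1)
  show "rm (Fi i \<theta>) (\<lambda>n k. wcoef \<theta> (n - k)) = Di i \<theta>"
    using 1 by (intro ext)
qed

lemma wcoef_two_point:
  assumes "cos \<theta> \<noteq> 0"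
  shows "((\<lambda>j. (a * wcoef \<theta> (x - j) + b * wcoef \<theta> (y - j)) * (a' * wcoef \<theta> (x' - j) + b' * wcoef \<theta> (y' - j)))
    has_sum (a * a' * gcoef \<theta> (x - x') + a * b' * gcoef \<theta> (x - y') + b * a' * gcoef \<theta> (y - x') + b * b' * gcoef \<theta> (y - y'))) UNIV"
proof -
  note c = wcoef_conv[OF assms]
  have "((\<lambda>j. a * a' * (wcoef \<theta> (x - j) * wcoef \<theta> (x' - j)) + a * b' * (wcoef \<theta> (x - j) * wcoef \<theta> (y' - j))
      + b * a' * (wcoef \<theta> (y - j) * wcoef \<theta> (x' - j)) + b * b' * (wcoef \<theta> (y - j) * wcoef \<theta> (y' - j)))
    has_sum (a * a' * gcoef \<theta> (x - x') + a * b' * gcoef \<theta> (x - y') + b * a' * gcoef \<theta> (y - x') + b * b' * gcoef \<theta> (y - y'))) UNIV"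
    by (intro has_sum_add has_sum_cmult_right c)
  then show ?thesis by (simp add: algebra_simps)
qed

lemma gcoef_sym: "gcoef \<theta> (- k) = gcoef \<theta> k"
  by (simp add: gcoef_def)

lemma gcoef_step: "0 \<le> k \<Longrightarrow> gcoef \<theta> (k + 1) = sin \<theta> * gcoef \<theta> k"
  by (simp add: gcoef_def nat_add_distrib)

lemma gcoef_step': "k \<le> 0 \<Longrightarrow> gcoef \<theta> (k - 1) = sin \<theta> * gcoef \<theta> k"
  using gcoef_step[of "- k" \<theta>] gcoef_sym[of \<theta> "k - 1"] gcoef_sym[of \<theta> k] by (simp add: algebra_simps)

lemma gcoef_0: "cos \<theta> \<noteq> 0 \<Longrightarrow> gcoef \<theta> 0 * (cos \<theta>)\<^sup>2 = 1"
  by (simp add: gcoef_def)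

lemma half_angle:
  fixes \<theta> :: real
  shows "sin \<theta> = 2 * sin (\<theta>/2) * cos (\<theta>/2)" "cos \<theta> = (cos (\<theta>/2))\<^sup>2 - (sin (\<theta>/2))\<^sup>2"
    "(sin (\<theta>/2))\<^sup>2 + (cos (\<theta>/2))\<^sup>2 = 1"
  using sin_double[of "\<theta>/2"] cos_double[of "\<theta>/2"] by auto

text \<open>The inverse of the Toeplitz matrix of \<open>g\<close> is the Toeplitz matrix of the trigonometric
  polynomial \<open>1 - 2 t cos x + t\<^sup>2\<close>.\<close>

lemma gcoef_inverse:
  assumes "cos \<theta> \<noteq> 0"
  shows "(1 + (sin \<theta>)\<^sup>2) * gcoef \<theta> k - sin \<theta> * gcoef \<theta> (k - 1) - sin \<theta> * gcoef \<theta> (k + 1) = of_bool (k = 0)"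
proof -
  consider "k = 0" | "k \<ge> 1" | "k \<le> -1" by linarith
  then show ?thesis
  proof cases
    case 1
    have "(1 - (sin \<theta>)\<^sup>2) * gcoef \<theta> 0 = 1" using gcoef_0[OF assms] by (simp add: one_minus_sin2 mult.commute)
    then show ?thesis using 1 gcoef_step[of 0 \<theta>] gcoef_step'[of 0 \<theta>] by (simp add: power2_eq_square algebra_simps)
  next
    case 2
    then show ?thesis using gcoef_step[of "k - 1" \<theta>] gcoef_step[of k \<theta>] by (simp add: power2_eq_square algebra_simps)
  next
    case 3
    then show ?thesis using gcoef_step'[of "k + 1" \<theta>] gcoef_step'[of k \<theta>] by (simp add: power2_eq_square algebra_simps)
  qed
qed

lemma al_1_reflect: "al 1 \<theta> (1 - n) = al 1 \<theta> n" and be_1_reflect: "be 1 \<theta> (1 - n) = be 1 \<theta> n"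
  and nb_1_reflect: "nb 1 (1 - n) = 1 - nb 1 n"
  by (auto simp: al_def be_def nb_def)

lemma al_0_reflect: "al 0 \<theta> (- n) = al 0 \<theta> n" and be_0_reflect: "be 0 \<theta> (- n) = be 0 \<theta> n"
  and nb_0_reflect: "nb 0 (- n) = - nb 0 n"
  by (auto simp: al_def be_def nb_def)

text \<open>The rows of \<open>F\<close> times the Toeplitz matrix of \<open>g\<close>; unlike the factors they are one-sided.\<close>

definition Prow :: "nat \<Rightarrow> real \<Rightarrow> int \<Rightarrow> int \<Rightarrow> real" where
  "Prow i \<theta> n x = al i \<theta> n * gcoef \<theta> (n - x) + be i \<theta> n * gcoef \<theta> (nb i n - x)"

lemma Prow_0_reflect: "Prow 0 \<theta> (- n) (- x) = Prow 0 \<theta> n x"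
proof -
  have "gcoef \<theta> (- n - - x) = gcoef \<theta> (n - x)" "gcoef \<theta> (- nb 0 n - - x) = gcoef \<theta> (nb 0 n - x)"
    using gcoef_sym[of \<theta> "n - x"] gcoef_sym[of \<theta> "nb 0 n - x"] by simp_all
  then show ?thesis unfolding Prow_def al_0_reflect be_0_reflect nb_0_reflect by simp
qed

lemma Prow_1_reflect: "Prow 1 \<theta> (1 - n) (1 - x) = Prow 1 \<theta> n x"
proof -
  have "gcoef \<theta> (1 - n - (1 - x)) = gcoef \<theta> (n - x)" "gcoef \<theta> (1 - nb 1 n - (1 - x)) = gcoef \<theta> (nb 1 n - x)"
    using gcoef_sym[of \<theta> "n - x"] gcoef_sym[of \<theta> "nb 1 n - x"] by simp_all
  then show ?thesis unfolding Prow_def al_1_reflect be_1_reflect nb_1_reflect by simp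
qed

lemma Prow_outer:
  assumes c: "cos \<theta> \<noteq> 0" and n: "n \<ge> 1 + int i" and i: "i \<le> 1"
  shows "Prow i \<theta> n x = (if n \<le> x then sin \<theta> ^ nat (x - n) else 0)"
proof -
  have *: "Prow i \<theta> n x = gcoef \<theta> (n - x) - sin \<theta> * gcoef \<theta> (n - x - 1)"
    using n i by (auto simp: Prow_def al_def be_def nb_def algebra_simps)
  show ?thesis
  proof (cases "n \<le> x")
    case True
    then have "Prow i \<theta> n x = gcoef \<theta> (n - x) * (1 - (sin \<theta>)\<^sup>2)"
      unfolding * using gcoef_step'[of "n - x" \<theta>] by (simp add: power2_eq_square algebra_simps)
    then show ?thesis using True c unfolding one_minus_sin2 by (simp add: gcoef_def)
  next
    case False
    then show ?thesis unfolding * using gcoef_step[of "n - x - 1" \<theta>] by simp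
  qed
qed

lemma half_angle_identities:
  fixes \<theta> :: real
  defines "c \<equiv> cos (\<theta>/2)" and "s \<equiv> sin (\<theta>/2)"
  shows "c - s * sin \<theta> = c * cos \<theta>" "c * sin \<theta> - s = s * cos \<theta>"
proof -
  have 1: "sin \<theta> = 2 * s * c" "cos \<theta> = c\<^sup>2 - s\<^sup>2" "s\<^sup>2 + c\<^sup>2 = 1"
    using half_angle[of \<theta>] by (simp_all add: c_def s_def)
  show "c - s * sin \<theta> = c * cos \<theta>" "c * sin \<theta> - s = s * cos \<theta>"
    using 1 by algebra+
qed

lemma Prow_1_1:
  assumes C: "cos \<theta> \<noteq> 0"
  shows "Prow 1 \<theta> 1 x = (if 1 \<le> x then cos (\<theta>/2) * sin \<theta> ^ nat (x - 1) else sin (\<theta>/2) * sin \<theta> ^ nat (- x)) / cos \<theta>"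
proof -
  have *: "Prow 1 \<theta> 1 x = cos (\<theta>/2) * gcoef \<theta> (1 - x) - sin (\<theta>/2) * gcoef \<theta> (- x)"
    by (simp add: Prow_def al_def be_def nb_def)
  show ?thesis
  proof (cases "1 \<le> x")
    case True
    then have "gcoef \<theta> (- x) = sin \<theta> * gcoef \<theta> (1 - x)" using gcoef_step'[of "1 - x" \<theta>] by simp
    then have "Prow 1 \<theta> 1 x = (cos (\<theta>/2) - sin (\<theta>/2) * sin \<theta>) * gcoef \<theta> (1 - x)"
      unfolding * by (simp add: algebra_simps)
    also have "\<dots> = cos (\<theta>/2) * cos \<theta> * gcoef \<theta> (1 - x)" by (simp only: half_angle_identities)
    finally show ?thesis using True C by (simp add: gcoef_def power2_eq_square)
  next
    case False
    then have "gcoef \<theta> (1 - x) = sin \<theta> * gcoef \<theta> (- x)" using gcoef_step[of "- x" \<theta>] by (simp add: add.commute)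
    then have "Prow 1 \<theta> 1 x = (cos (\<theta>/2) * sin \<theta> - sin (\<theta>/2)) * gcoef \<theta> (- x)"
      unfolding * by (simp add: algebra_simps)
    also have "\<dots> = sin (\<theta>/2) * cos \<theta> * gcoef \<theta> (- x)" by (simp only: half_angle_identities)
    finally show ?thesis using False C by (simp add: gcoef_def power2_eq_square)
  qed
qed

lemma Prow_0_0:
  assumes C: "cos \<theta> \<noteq> 0"
  shows "Prow 0 \<theta> 0 x = sin \<theta> ^ nat \<bar>x\<bar> / cos \<theta>"
  using C by (simp add: Prow_def al_def be_def gcoef_def power2_eq_square)

lemma Di_orthonormal:
  assumes C: "cos \<theta> \<noteq> 0"
  shows "((\<lambda>j. Di 1 \<theta> n j * Di 1 \<theta> m j) has_sum id_mat n m) UNIV"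
proof -
  have pos: "al 1 \<theta> m * Prow 1 \<theta> n m + be 1 \<theta> m * Prow 1 \<theta> n (nb 1 m) = id_mat n m" if "n \<ge> 1" for n m
  proof (cases "n = 1")
    case False
    then have P: "Prow 1 \<theta> n x = (if n \<le> x then sin \<theta> ^ nat (x - n) else 0)" for x
      using that Prow_outer[OF C, of 1 n x] by simp
    show ?thesis
    proof (cases "n < m")
      case True
      then have "nat (m - n) = Suc (nat (m - 1 - n))" by simp
      then show ?thesis using True False that unfolding P by (simp add: al_def be_def nb_def id_mat_def)
    next
      case nm: False
      then show ?thesis using False that unfolding P by (auto simp: al_def be_def nb_def id_mat_def)
    qed
  next
    case True
    let ?c = "cos (\<theta>/2)" and ?s = "sin (\<theta>/2)"
    have P: "Prow 1 \<theta> n x = (if 1 \<le> x then ?c * sin \<theta> ^ nat (x - 1) else ?s * sin \<theta> ^ nat (- x)) / cos \<theta>" for x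
      using True Prow_1_1[OF C, of x] by simp
    consider "m \<ge> 2" | "m = 1" | "m = 0" | "m \<le> -1" by linarith
    then show ?thesis
    proof cases
      case 1
      then have "nat (m - 1) = Suc (nat (m - 2))" by simp
      then show ?thesis using 1 True unfolding P by (simp add: al_def be_def nb_def id_mat_def)
    next
      case 2
      have "?c * ?c - ?s * ?s = cos \<theta>" using half_angle(2)[of \<theta>] by (simp add: power2_eq_square)
      then show ?thesis using 2 True C unfolding P
        by (simp add: al_def be_def nb_def id_mat_def diff_divide_distrib[symmetric])
    next
      case 3
      then show ?thesis using True unfolding P by (simp add: al_def be_def nb_def id_mat_def)
    next
      case 4
      then have "nat (- m) = Suc (nat (- m - 1))" "nat (- (m + 1)) = nat (- m - 1)" by simp_all
      then show ?thesis using 4 True unfolding P by (simp add: al_def be_def nb_def id_mat_def)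
    qed
  qed
  have main: "al 1 \<theta> m * Prow 1 \<theta> n m + be 1 \<theta> m * Prow 1 \<theta> n (nb 1 m) = id_mat n m"
  proof (cases "n \<ge> 1")
    case False
    then have "1 - n \<ge> 1" by simp
    from pos[OF this, of "1 - m"] show ?thesis
      unfolding al_1_reflect be_1_reflect nb_1_reflect Prow_1_reflect by (simp add: id_mat_def)
  qed (rule pos)
  show ?thesis
    using wcoef_two_point[OF C, of "al 1 \<theta> n" n "be 1 \<theta> n" "nb 1 n" "al 1 \<theta> m" m "be 1 \<theta> m" "nb 1 m"]
    unfolding main[symmetric] Di_def Prow_def by (simp add: algebra_simps)
qed

section \<open>The coefficients of the deformed matrix\<close>

definition act :: "dih \<Rightarrow> int \<Rightarrow> int" where
  "act g j = (if fst g = Even then snd g + j else snd g - j)"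

definition rho_pos :: "real \<Rightarrow> int \<Rightarrow> int \<Rightarrow> int \<Rightarrow> real" where
  "rho_pos \<theta> n \<kappa> y =
    (if n \<ge> 1 then
       if \<kappa> \<ge> 2 then of_bool (y = 0)
       else if \<kappa> = 1 then
         (if y \<ge> 1 then sin \<theta> ^ nat (y - 1) * (sin (\<theta>/2) * cos \<theta>) else if y = 0 then cos (\<theta>/2) else 0)
       else if \<kappa> = 0 then
         (if y \<ge> 0 then sin \<theta> ^ nat y * (cos (\<theta>/2) * cos \<theta>) else if y = -1 then - sin (\<theta>/2) else 0)
       else (if y \<ge> 0 then sin \<theta> ^ nat y * (cos \<theta>)\<^sup>2 else if y = -1 then - sin \<theta> else 0)
     else if \<kappa> \<ge> 2 then (if y \<le> 0 then cos \<theta> * sin \<theta> ^ nat (- y) else 0)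
     else (if y \<ge> 1 then sin (\<theta>/2) * sin \<theta> ^ nat (y - 1) else cos (\<theta>/2) * sin \<theta> ^ nat (- y)))"

definition rhoe :: "real \<Rightarrow> int \<Rightarrow> int \<Rightarrow> int \<Rightarrow> real" where
  "rhoe \<theta> n \<kappa> d = (if n > 0 \<or> (n = 0 \<and> \<kappa> > 0) then rho_pos \<theta> n \<kappa> (d + \<kappa> - n)
     else rho_pos \<theta> (- n) (1 - \<kappa>) (- (d + \<kappa> - n)))"

lemma rhoe_neg: "\<not> (n > 0 \<or> (n = 0 \<and> \<kappa> > 0)) \<Longrightarrow> rhoe \<theta> n \<kappa> d = rho_pos \<theta> (- n) (1 - \<kappa>) (- (d + \<kappa> - n))"
  unfolding rhoe_def by (rule if_not_P)

lemma rhoe_nonneg: "n > 0 \<or> (n = 0 \<and> \<kappa> > 0) \<Longrightarrow> rhoe \<theta> n \<kappa> d = rho_pos \<theta> n \<kappa> (d + \<kappa> - n)"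
  unfolding rhoe_def by (rule if_P)

text \<open>The entry \<open>(n, \<kappa>)\<close> of the deformed matrix is \<open>\<Sum>\<^sub>g rho \<theta> n \<kappa> g a\<^sub>g\<close>.\<close>

definition rho :: "real \<Rightarrow> int \<Rightarrow> int \<Rightarrow> dih \<Rightarrow> real" where
  "rho \<theta> n \<kappa> g = (if fst g = Even then rhoe \<theta> n \<kappa> (snd g) else rhoe \<theta> n (1 - \<kappa>) (snd g - 1))"

lemma rho_pos_eq:
  assumes C: "cos \<theta> \<noteq> 0" and n: "n \<ge> 1 \<or> (n = 0 \<and> \<kappa> \<ge> 1)"
  shows "al 1 \<theta> \<kappa> * Prow 0 \<theta> n (d + \<kappa>) + be 1 \<theta> \<kappa> * Prow 0 \<theta> n (d + nb 1 \<kappa>) = rho_pos \<theta> n \<kappa> (d + \<kappa> - n)"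
proof (cases "n \<ge> 1")
  case True
  have P: "Prow 0 \<theta> n x = (if n \<le> x then sin \<theta> ^ nat (x - n) else 0)" for x
    using True Prow_outer[OF C, of 0 n x] by simp
  define y where "y = d + \<kappa> - n"
  have d: "d = y - \<kappa> + n" by (simp add: y_def)
  consider "\<kappa> \<ge> 2" | "\<kappa> = 1" | "\<kappa> = 0" | "\<kappa> \<le> -1" by linarith
  then show ?thesis
  proof cases
    case 1
    have "nat y = Suc (nat (y - 1))" if "y \<ge> 1" using that by simp
    then show ?thesis using 1 True unfolding P y_def[symmetric] unfolding d
      by (cases "y \<ge> 1") (auto simp: al_def be_def nb_def rho_pos_def)
  next
    case 2
    have "nat y = Suc (nat (y - 1))" if "y \<ge> 1" using that by simp
    moreover have "cos (\<theta>/2) * (sin \<theta> * x) - sin (\<theta>/2) * x = x * (sin (\<theta>/2) * cos \<theta>)" for x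
      unfolding half_angle_identities(2)[symmetric] by (simp add: algebra_simps)
    ultimately show ?thesis using 2 True unfolding P y_def[symmetric] unfolding d
      by (cases "y \<ge> 1") (auto simp: al_def be_def nb_def rho_pos_def)
  next
    case 3
    have "nat (y + 1) = Suc (nat y)" if "y \<ge> 0" using that by simp
    moreover have "cos (\<theta>/2) * x - sin (\<theta>/2) * (sin \<theta> * x) = x * (cos (\<theta>/2) * cos \<theta>)" for x
      unfolding half_angle_identities(1)[symmetric] by (simp add: algebra_simps)
    ultimately show ?thesis using 3 True unfolding P y_def[symmetric] unfolding d
      by (cases "y \<ge> 0") (auto simp: al_def be_def nb_def rho_pos_def add.commute)
  next
    case 4
    have "nat (y + 1) = Suc (nat y)" if "y \<ge> 0" using that by simp
    moreover have "x - sin \<theta> * (sin \<theta> * x) = x * (cos \<theta>)\<^sup>2" for x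
      unfolding one_minus_sin2[symmetric] by (simp add: power2_eq_square algebra_simps)
    ultimately show ?thesis using 4 True unfolding P y_def[symmetric] unfolding d
      by (cases "y \<ge> 0") (auto simp: al_def be_def nb_def rho_pos_def add.commute)
  qed
next
  case False
  then have n: "n = 0" "\<kappa> \<ge> 1" using n by auto
  have P: "Prow 0 \<theta> n x = sin \<theta> ^ nat \<bar>x\<bar> / cos \<theta>" for x
    using n Prow_0_0[OF C] by simp
  define y where "y = d + \<kappa> - n"
  have d: "d = y - \<kappa>" using n by (simp add: y_def)
  consider "\<kappa> \<ge> 2" "y \<ge> 1" | "\<kappa> \<ge> 2" "y \<le> 0" | "\<kappa> = 1" "y \<ge> 1" | "\<kappa> = 1" "y \<le> 0" using n by linarith
  then show ?thesis
  proof cases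
    case 1
    then have "nat \<bar>y\<bar> = Suc (nat \<bar>y - 1\<bar>)" by simp
    then show ?thesis using 1 n unfolding P y_def[symmetric] unfolding d
      by (simp add: al_def be_def nb_def rho_pos_def)
  next
    case 2
    then have "nat \<bar>y - 1\<bar> = Suc (nat (- y))" "nat \<bar>y\<bar> = nat (- y)" by simp_all
    moreover have "x / cos \<theta> - sin \<theta> * (sin \<theta> * x) / cos \<theta> = cos \<theta> * x" for x
    proof -
      have "x - sin \<theta> * (sin \<theta> * x) = (1 - (sin \<theta>)\<^sup>2) * x" by (simp add: power2_eq_square algebra_simps)
      then show ?thesis using C unfolding one_minus_sin2 by (simp add: diff_divide_distrib[symmetric] power2_eq_square)
    qed
    ultimately show ?thesis using 2 n unfolding P y_def[symmetric] unfolding d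
      by (simp add: al_def be_def nb_def rho_pos_def)
  next
    case 3
    then have "nat \<bar>y\<bar> = Suc (nat \<bar>y - 1\<bar>)" "nat \<bar>y - 1\<bar> = nat (y - 1)" by simp_all
    moreover have "cos (\<theta>/2) * (sin \<theta> * x) / cos \<theta> - sin (\<theta>/2) * x / cos \<theta> = sin (\<theta>/2) * x" for x
    proof -
      have "cos (\<theta>/2) * (sin \<theta> * x) - sin (\<theta>/2) * x = (cos (\<theta>/2) * sin \<theta> - sin (\<theta>/2)) * x"
        by (simp add: algebra_simps)
      then show ?thesis using C unfolding half_angle_identities by (simp add: diff_divide_distrib[symmetric])
    qed
    ultimately show ?thesis using 3 n unfolding P y_def[symmetric] unfolding d
      by (simp add: al_def be_def nb_def rho_pos_def)
  next
    case 4
    then have "nat \<bar>y - 1\<bar> = Suc (nat (- y))" "nat \<bar>y\<bar> = nat (- y)" by simp_all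
    moreover have "cos (\<theta>/2) * x / cos \<theta> - sin (\<theta>/2) * (sin \<theta> * x) / cos \<theta> = cos (\<theta>/2) * x" for x
    proof -
      have "cos (\<theta>/2) * x - sin (\<theta>/2) * (sin \<theta> * x) = (cos (\<theta>/2) - sin (\<theta>/2) * sin \<theta>) * x"
        by (simp add: algebra_simps)
      then show ?thesis using C unfolding half_angle_identities by (simp add: diff_divide_distrib[symmetric])
    qed
    ultimately show ?thesis using 4 n unfolding P y_def[symmetric] unfolding d
      by (simp add: al_def be_def nb_def rho_pos_def)
  qed
qed

lemma rhoe_eq:
  assumes C: "cos \<theta> \<noteq> 0"
  shows "al 1 \<theta> \<kappa> * Prow 0 \<theta> n (d + \<kappa>) + be 1 \<theta> \<kappa> * Prow 0 \<theta> n (d + nb 1 \<kappa>) = rhoe \<theta> n \<kappa> d"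
proof (cases "n > 0 \<or> (n = 0 \<and> \<kappa> > 0)")
  case True
  then have "n \<ge> 1 \<or> (n = 0 \<and> \<kappa> \<ge> 1)" by auto
  from rho_pos_eq[OF C this] show ?thesis using True by (simp add: rhoe_def)
next
  case False
  then have "- n \<ge> 1 \<or> (- n = 0 \<and> 1 - \<kappa> \<ge> 1)" by auto
  from rho_pos_eq[OF C this, of "- d - 1"]
  have "al 1 \<theta> \<kappa> * Prow 0 \<theta> (- n) (- (d + \<kappa>)) + be 1 \<theta> \<kappa> * Prow 0 \<theta> (- n) (- (d + nb 1 \<kappa>))
      = rho_pos \<theta> (- n) (1 - \<kappa>) (- (d + \<kappa> - n))"
    unfolding al_1_reflect be_1_reflect nb_1_reflect by (simp add: algebra_simps)
  then show ?thesis unfolding Prow_0_reflect rhoe_neg[OF False] .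
qed

lemma rho_has_sum:
  assumes C: "cos \<theta> \<noteq> 0"
  shows "((\<lambda>j. Di 0 \<theta> n (act g j) * Di 1 \<theta> \<kappa> j) has_sum rho \<theta> n \<kappa> g) UNIV"
proof -
  obtain s d where g: "g = (s, d)" by (cases g)
  show ?thesis
  proof (cases s)
    case Even
    have "((\<lambda>j. (al 0 \<theta> n * wcoef \<theta> (n - d - j) + be 0 \<theta> n * wcoef \<theta> (nb 0 n - d - j)) * Di 1 \<theta> \<kappa> j)
      has_sum (al 1 \<theta> \<kappa> * Prow 0 \<theta> n (d + \<kappa>) + be 1 \<theta> \<kappa> * Prow 0 \<theta> n (d + nb 1 \<kappa>))) UNIV"
      using wcoef_two_point[OF C, of "al 0 \<theta> n" "n - d" "be 0 \<theta> n" "nb 0 n - d" "al 1 \<theta> \<kappa>" \<kappa> "be 1 \<theta> \<kappa>" "nb 1 \<kappa>"]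
      by (simp add: Di_def Prow_def algebra_simps)
    then show ?thesis
      unfolding rhoe_eq[OF C] by (simp add: g Even act_def rho_def Di_def[of 0] diff_diff_eq)
  next
    case Odd
    have w: "wcoef \<theta> (x - (d - j)) = wcoef \<theta> (d - x - j)" for x j
      using wcoef_sym[OF C, of "d - x - j"] by (simp add: algebra_simps)
    have gs: "gcoef \<theta> (d - x - y) = gcoef \<theta> (x - (d - y))" for x y
      using gcoef_sym[of \<theta> "d - x - y"] by (simp add: algebra_simps)
    have "((\<lambda>j. (al 0 \<theta> n * wcoef \<theta> (d - n - j) + be 0 \<theta> n * wcoef \<theta> (d - nb 0 n - j)) * Di 1 \<theta> \<kappa> j)
      has_sum (al 1 \<theta> \<kappa> * Prow 0 \<theta> n (d - \<kappa>) + be 1 \<theta> \<kappa> * Prow 0 \<theta> n (d - nb 1 \<kappa>))) UNIV"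
      using wcoef_two_point[OF C, of "al 0 \<theta> n" "d - n" "be 0 \<theta> n" "d - nb 0 n" "al 1 \<theta> \<kappa>" \<kappa> "be 1 \<theta> \<kappa>" "nb 1 \<kappa>"]
      unfolding gs by (simp add: Di_def Prow_def distrib_left distrib_right add_ac mult_ac)
    moreover have "al 1 \<theta> \<kappa> * Prow 0 \<theta> n (d - \<kappa>) + be 1 \<theta> \<kappa> * Prow 0 \<theta> n (d - nb 1 \<kappa>) = rhoe \<theta> n (1 - \<kappa>) (d - 1)"
      using rhoe_eq[OF C, of "1 - \<kappa>" n "d - 1"] unfolding al_1_reflect be_1_reflect nb_1_reflect
      by (simp add: algebra_simps)
    ultimately show ?thesis
      by (simp add: g Odd act_def rho_def Di_def[of 0] w)
  qed
qed

lemma continuous_on_if_const: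
  assumes "b \<Longrightarrow> continuous_on S f" "\<not> b \<Longrightarrow> continuous_on S g"
  shows "continuous_on S (\<lambda>x. if b then f x else g x)"
  using assms by (cases b) auto

lemma continuous_rho: "continuous_on UNIV (\<lambda>\<theta>. rho \<theta> n \<kappa> g)"
proof -
  have "continuous_on UNIV (\<lambda>\<theta>. rho_pos \<theta> n \<kappa> y)" for n \<kappa> y
    unfolding rho_pos_def by (intro continuous_on_if_const continuous_intros) auto
  then show ?thesis unfolding rho_def rhoe_def by (intro continuous_on_if_const)
qed

lemma rho_bound: "\<bar>rho \<theta> n \<kappa> g\<bar> \<le> 1"
proof -
  have p: "\<bar>sin \<theta> ^ k\<bar> \<le> 1" for k
    by (simp add: power_abs power_le_one)
  have m: "\<bar>x * y\<bar> \<le> 1" if "\<bar>x\<bar> \<le> 1" "\<bar>y\<bar> \<le> 1" for x y :: real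
    using mult_mono[OF that] by (simp add: abs_mult)
  have q: "\<bar>(cos \<theta>)\<^sup>2\<bar> \<le> 1"
    unfolding power2_eq_square by (intro m) auto
  have i: "\<bar>if b then x else y\<bar> \<le> 1" if "\<bar>x\<bar> \<le> 1" "\<bar>y\<bar> \<le> 1" for b and x y :: real
    using that by simp
  have "\<bar>rho_pos \<theta> n \<kappa> y\<bar> \<le> 1" for n \<kappa> y
    unfolding rho_pos_def by (intro i m p q) auto
  then show ?thesis unfolding rho_def rhoe_def by (intro i)
qed

lemma rho_pos_support:
  assumes "rho_pos \<theta> n \<kappa> y \<noteq> 0"
  shows "n \<ge> 1 \<Longrightarrow> -1 \<le> y" "\<kappa> \<ge> 2 \<Longrightarrow> y \<le> 0"
  using assms by (auto simp: rho_pos_def split: if_splits)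

lemma rhoe_support:
  assumes "rhoe \<theta> n \<kappa> d \<noteq> 0"
  shows "\<bar>n\<bar> \<le> \<bar>d\<bar> + \<bar>\<kappa>\<bar> + 1 \<and> \<bar>\<kappa>\<bar> \<le> \<bar>d\<bar> + \<bar>n\<bar> + 1"
proof (cases "n > 0 \<or> (n = 0 \<and> \<kappa> > 0)")
  case True
  from rho_pos_support[OF assms[unfolded rhoe_nonneg[OF True]]] show ?thesis
    using True by (smt (verit))
next
  case False
  from rho_pos_support[OF assms[unfolded rhoe_neg[OF False]]] show ?thesis
    using False by (smt (verit))
qed

lemma rho_support:
  assumes "rho \<theta> n \<kappa> g \<noteq> 0"
  shows "\<bar>real_of_int n\<bar> \<le> gsz g + \<bar>real_of_int \<kappa>\<bar> + 3" "\<bar>real_of_int \<kappa>\<bar> \<le> gsz g + \<bar>real_of_int n\<bar> + 3"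
proof -
  have "\<bar>n\<bar> \<le> \<bar>snd g\<bar> + \<bar>\<kappa>\<bar> + 3 \<and> \<bar>\<kappa>\<bar> \<le> \<bar>snd g\<bar> + \<bar>n\<bar> + 3"
  proof (cases "fst g")
    case Even
    then show ?thesis using assms rhoe_support[of \<theta> n \<kappa> "snd g"] by (simp add: rho_def)
  next
    case Odd
    then have "rhoe \<theta> n (1 - \<kappa>) (snd g - 1) \<noteq> 0" using assms by (simp add: rho_def)
    from rhoe_support[OF this] show ?thesis by linarith
  qed
  then show "\<bar>real_of_int n\<bar> \<le> gsz g + \<bar>real_of_int \<kappa>\<bar> + 3" "\<bar>real_of_int \<kappa>\<bar> \<le> gsz g + \<bar>real_of_int n\<bar> + 3"
    unfolding gsz_def by linarith+
qed

text \<open>The part of the deformed matrix that depends on the angle is concentrated at the origin.\<close>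

lemma rho_pos_diff_support:
  assumes "rho_pos \<theta> n \<kappa> y \<noteq> rho_pos \<theta>' n \<kappa> y"
  shows "n \<ge> 1 \<Longrightarrow> -1 \<le> y \<and> \<kappa> \<le> 1" "\<not> n \<ge> 1 \<Longrightarrow> \<kappa> \<ge> 2 \<Longrightarrow> y \<le> 0"
  using assms by (auto simp: rho_pos_def split: if_splits)

lemma rhoe_diff_support:
  assumes "rhoe \<theta> n \<kappa> d \<noteq> rhoe \<theta>' n \<kappa> d"
  shows "\<bar>n\<bar> + \<bar>\<kappa>\<bar> \<le> \<bar>d\<bar> + 3"
proof (cases "n > 0 \<or> (n = 0 \<and> \<kappa> > 0)")
  case True
  from rho_pos_diff_support[OF assms[unfolded rhoe_nonneg[OF True]]] show ?thesis
    using True by (smt (verit))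
next
  case False
  from rho_pos_diff_support[OF assms[unfolded rhoe_neg[OF False]]] show ?thesis
    using False by (smt (verit))
qed

lemma rho_diff_support:
  assumes "rho \<theta> n \<kappa> g \<noteq> rho \<theta>' n \<kappa> g"
  shows "\<bar>real_of_int n\<bar> + \<bar>real_of_int \<kappa>\<bar> \<le> gsz g + 5"
proof -
  have "\<bar>n\<bar> + \<bar>\<kappa>\<bar> \<le> \<bar>snd g\<bar> + 5"
  proof (cases "fst g")
    case Even
    then show ?thesis using assms rhoe_diff_support[of \<theta> n \<kappa> "snd g" \<theta>'] by (simp add: rho_def)
  next
    case Odd
    then have "rhoe \<theta> n (1 - \<kappa>) (snd g - 1) \<noteq> rhoe \<theta>' n (1 - \<kappa>) (snd g - 1)" using assms by (simp add: rho_def)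
    from rhoe_diff_support[OF this] show ?thesis by linarith
  qed
  then show ?thesis unfolding gsz_def by linarith
qed

lemma rho_zero: "rho 0 n \<kappa> g = of_bool (act g \<kappa> = n)"
proof -
  have z: "(0::real) ^ nat y = of_bool (y \<le> 0)" for y by (simp add: power_0_left)
  have "rhoe 0 n \<kappa> d = of_bool (d + \<kappa> = n)" for \<kappa> d
    unfolding rhoe_def rho_pos_def sin_zero cos_zero div_0 z by auto
  then show ?thesis by (auto simp: rho_def act_def)
qed

declare One_nat_def [simp del]

lemma nb_near: "\<bar>n - nb i n\<bar> \<le> 1"
  by (auto simp: nb_def sgn_if)

lemma Fi_band: "Fi i \<theta> n l \<noteq> 0 \<Longrightarrow> \<bar>n - l\<bar> \<le> 1"
  using nb_near[of n i] by (cases "l = n"; cases "l = nb i n") (auto simp: Fi_def)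

lemma Fi_bound: "\<bar>Fi i \<theta> n l\<bar> \<le> 2"
proof -
  have "\<bar>al i \<theta> n\<bar> \<le> 1" "\<bar>be i \<theta> n\<bar> \<le> 1" by (auto simp: al_def be_def)
  then show ?thesis by (auto simp: Fi_def)
qed

text \<open>The columns of \<open>F\<close> give a Toeplitz matrix, although the rows do not.\<close>

lemma rm_Fi_transpose:
  "rm (\<lambda>n l. Fi 1 \<theta> l n) (Fi 1 \<theta>) n k =
     (1 + (sin \<theta>)\<^sup>2) * of_bool (k = n) - sin \<theta> * of_bool (k = n - 1) - sin \<theta> * of_bool (k = n + 1)"
proof -
  have "rm (\<lambda>n l. Fi 1 \<theta> l n) (Fi 1 \<theta>) n k = (\<Sum>\<^sub>\<infinity>l\<in>{n - 1, n, n + 1}. Fi 1 \<theta> l n * Fi 1 \<theta> l k)"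
    unfolding rm_def
  proof (rule infsum_cong_neutral)
    fix l assume "l \<in> UNIV - {n - 1, n, n + 1}"
    then have "\<not> \<bar>l - n\<bar> \<le> 1" by auto
    then have "Fi 1 \<theta> l n = 0" using Fi_band by blast
    then show "Fi 1 \<theta> l n * Fi 1 \<theta> l k = 0" by simp
  qed auto
  also have "\<dots> = Fi 1 \<theta> (n - 1) n * Fi 1 \<theta> (n - 1) k + (Fi 1 \<theta> n n * Fi 1 \<theta> n k + Fi 1 \<theta> (n + 1) n * Fi 1 \<theta> (n + 1) k)"
    by simp
  also have "\<dots> = (1 + (sin \<theta>)\<^sup>2) * of_bool (k = n) - sin \<theta> * of_bool (k = n - 1) - sin \<theta> * of_bool (k = n + 1)"
  proof -
    let ?c = "cos (\<theta>/2)" and ?s = "sin (\<theta>/2)"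
    have cs: "?c * ?c + ?s * ?s = 1" using half_angle(3)[of \<theta>] by (simp add: power2_eq_square)
    have st: "sin \<theta> = ?c * ?s + ?c * ?s" using half_angle(1)[of \<theta>] by simp
    consider "n \<ge> 2" | "n = 1" | "n = 0" | "n \<le> -1" by linarith
    then show ?thesis
    proof cases
      case 1
      then show ?thesis by (auto simp: Fi_def al_def be_def nb_def power2_eq_square)
    next
      case 2
      then show ?thesis using cs st by (auto simp: Fi_def al_def be_def nb_def power2_eq_square)
    next
      case 3
      then show ?thesis using cs st by (auto simp: Fi_def al_def be_def nb_def power2_eq_square)
    next
      case 4
      then show ?thesis by (auto simp: Fi_def al_def be_def nb_def power2_eq_square)
    qed
  qed
  finally show ?thesis .
qed

context loop_algebra
begin

lemma tm_emb_transpose: "tm (emb X) \<Longrightarrow> tm (emb (\<lambda>n k. X k n))"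
  unfolding tm_emb_iff by blast

lemma tm_emb_Fi: "tm (emb (Fi i \<theta>))"
  by (rule tm_emb_band[OF Fi_bound Fi_band])

lemma tm_emb_W:
  assumes C: "cos \<theta> \<noteq> 0" shows "tm (emb (\<lambda>n k. wcoef \<theta> (n - k)))"
  by (rule tm_emb_toeplitz[of "\<bar>sin \<theta>\<bar>" "1 / (cos \<theta>)\<^sup>2"])
     (use abs_sin_less_1[OF C] wcoef_bound[OF C] in auto)

lemma emb_Di:
  assumes C: "cos \<theta> \<noteq> 0" and i: "i \<le> 1"
  shows "emb (Di i \<theta>) = mm (emb (Fi i \<theta>)) (emb (\<lambda>n k. wcoef \<theta> (n - k)))" "tm (emb (Di i \<theta>))"
proof -
  show 1: "emb (Di i \<theta>) = mm (emb (Fi i \<theta>)) (emb (\<lambda>n k. wcoef \<theta> (n - k)))"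
    by (simp add: mm_emb tm_emb_Fi tm_emb_W[OF C] Dmat_ix[OF i])
  show "tm (emb (Di i \<theta>))" unfolding 1 by (rule tm_mm[OF tm_emb_Fi tm_emb_W[OF C]])
qed

lemma Di_inverse:
  assumes C: "cos \<theta> \<noteq> 0"
  shows "rm (Di 1 \<theta>) (\<lambda>n k. Di 1 \<theta> k n) = id_mat" "rm (\<lambda>n k. Di 1 \<theta> k n) (Di 1 \<theta>) = id_mat"
proof -
  show "rm (Di 1 \<theta>) (\<lambda>n k. Di 1 \<theta> k n) = id_mat"
    using Di_orthonormal[OF C] by (intro ext) (simp add: rm_def infsumI)
  let ?W = "\<lambda>n k. wcoef \<theta> (n - k)" and ?F = "Fi 1 \<theta>" and ?T = "\<lambda>n k. Fi 1 \<theta> k n" and ?E = "\<lambda>n k. Di 1 \<theta> k n"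
  note tms = tm_emb_Fi[of 1 \<theta>] tm_emb_transpose[OF tm_emb_Fi[of 1 \<theta>]] tm_emb_W[OF C] emb_Di(2)[OF C, of 1]
    tm_emb_transpose[OF emb_Di(2)[OF C, of 1]]
  let ?Q = "rm ?T ?F"
  have W: "wcoef \<theta> (x - y) = wcoef \<theta> (y - x)" for x y
    using wcoef_sym[OF C, of "x - y"] by simp
  have WT: "rm ?W ?T n k = ?E n k" for n k
    using two_point_has_sum[of "al 1 \<theta> k" k "be 1 \<theta> k" "nb 1 k" "\<lambda>l. wcoef \<theta> (n - l)"]
    by (simp add: rm_def Fi_def Di_def infsumI W[of n] mult.commute[of "wcoef \<theta> _"])
  have "rm ?W ?T = ?E" by (intro ext) (rule WT)
  then have E: "emb ?E = mm (emb ?W) (emb ?T)" by (simp only: mm_emb[OF tms(3,2)])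
  have tmQ: "tm (emb ?Q)" using tm_mm[OF tms(2,1)] by (simp only: mm_emb[OF tms(2,1)])
  have QW: "rm ?Q ?W n k = (1 + (sin \<theta>)\<^sup>2) * wcoef \<theta> (n - k) - sin \<theta> * wcoef \<theta> (n - 1 - k) - sin \<theta> * wcoef \<theta> (n + 1 - k)" for n k
  proof -
    have "((\<lambda>l. ((1 + (sin \<theta>)\<^sup>2) * of_bool (l = n) + (- sin \<theta>) * of_bool (l = n - 1)) * wcoef \<theta> (l - k)
        + (0 * of_bool (l = n) + (- sin \<theta>) * of_bool (l = n + 1)) * wcoef \<theta> (l - k)) has_sum
      ((1 + (sin \<theta>)\<^sup>2) * wcoef \<theta> (n - k) + (- sin \<theta>) * wcoef \<theta> (n - 1 - k)
        + (0 * wcoef \<theta> (n - k) + (- sin \<theta>) * wcoef \<theta> (n + 1 - k)))) UNIV"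
      by (intro has_sum_add two_point_has_sum)
    then show ?thesis
      unfolding rm_def[of ?Q] rm_Fi_transpose by (intro infsumI) (simp add: algebra_simps)
  qed
  have WQW: "rm ?W (rm ?Q ?W) n k = id_mat n k" for n k
  proof -
    note c = wcoef_conv[OF C]
    have "((\<lambda>l. (1 + (sin \<theta>)\<^sup>2) * (wcoef \<theta> (n - l) * wcoef \<theta> (k - l)) + (- sin \<theta>) * (wcoef \<theta> (n - l) * wcoef \<theta> (k + 1 - l))
       + (- sin \<theta>) * (wcoef \<theta> (n - l) * wcoef \<theta> (k - 1 - l))) has_sum
      ((1 + (sin \<theta>)\<^sup>2) * gcoef \<theta> (n - k) + (- sin \<theta>) * gcoef \<theta> (n - (k + 1)) + (- sin \<theta>) * gcoef \<theta> (n - (k - 1)))) UNIV"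
      by (intro has_sum_add has_sum_cmult_right c)
    moreover have "wcoef \<theta> (l - k) = wcoef \<theta> (k - l)" "wcoef \<theta> (l - 1 - k) = wcoef \<theta> (k + 1 - l)"
      "wcoef \<theta> (l + 1 - k) = wcoef \<theta> (k - 1 - l)" for l
      using W[of l k] W[of "l - 1" k] W[of "l + 1" k] by (simp_all add: algebra_simps)
    moreover have "(1 + (sin \<theta>)\<^sup>2) * gcoef \<theta> (n - k) + (- sin \<theta>) * gcoef \<theta> (n - (k + 1)) + (- sin \<theta>) * gcoef \<theta> (n - (k - 1)) = id_mat n k"
      using gcoef_inverse[OF C, of "n - k"] by (simp add: id_mat_def algebra_simps)
    ultimately show ?thesis
      unfolding rm_def[of ?W] QW by (intro infsumI) (simp add: algebra_simps)
  qed
  have "emb (rm ?E (Di 1 \<theta>)) = mm (mm (emb ?W) (emb ?T)) (mm (emb ?F) (emb ?W))"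
    using mm_emb[OF tms(5,4)] E emb_Di(1)[OF C, of 1] by simp
  also have "\<dots> = mm (emb ?W) (mm (mm (emb ?T) (emb ?F)) (emb ?W))"
    by (simp only: mm_assoc tms tm_mm)
  also have "\<dots> = emb (rm ?W (rm ?Q ?W))"
    using tm_mm[OF tmQ tms(3)] by (simp only: mm_emb tms tmQ)
  also have "rm ?W (rm ?Q ?W) = id_mat" using WQW by (intro ext)
  finally show "rm ?E (Di 1 \<theta>) = id_mat" by (simp only: emb_eq_iff)
qed

lemma rinv_Dmat:
  assumes C: "cos \<theta> \<noteq> 0"
  shows "rinv 1 (Dmat 1 \<theta>) (ix 1 n) (ix 1 k) = Di 1 \<theta> k n"
proof -
  have D: "(\<lambda>n k. Dmat 1 \<theta> (ix 1 n) (ix 1 k)) = Di 1 \<theta>"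
    by (intro ext) (simp only: Dmat_ix(1)[of 1] order_refl)
  show ?thesis
    by (rule rinvI[where Y = "\<lambda>n k. Di 1 \<theta> k n"])
       (simp_all only: D Di_inverse[OF C] emb_Di(2)[OF C] tm_emb_transpose order_refl)
qed

section \<open>The deformed matrix\<close>

lemma lsh_bscale: "lsh d (bscale r b) = bscale r (lsh d b)" and rsh_bscale: "rsh d (bscale r b) = bscale r (rsh d b)"
  by (simp_all add: lsh_def rsh_def bscale_def fun_eq_iff)

lemma hmul_0 [simp]: "hmul z j 0 c = 0" "hmul z j b 0 = 0"
  by (simp_all add: hmul_alt)

lemma mmul_left_diagonal:
  assumes "n \<in> ZZ q" "\<And>l. l \<noteq> n \<Longrightarrow> M n l = 0"
  shows "mmul z q j M N n k = hmul z j (M n n) (N n k)"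
proof (intro ext)
  fix s m
  show "mmul z q j M N n k s m = hmul z j (M n n) (N n k) s m"
    unfolding mmul_def by (rule infsum_single) (use assms in auto)
qed

lemma mmul_right_diagonal:
  assumes "k \<in> ZZ q" "\<And>l. l \<noteq> k \<Longrightarrow> N l k = 0"
  shows "mmul z q j M N n k = hmul z j (M n k) (N k k)"
proof (intro ext)
  fix s m
  show "mmul z q j M N n k s m = hmul z j (M n k) (N k k) s m"
    unfolding mmul_def by (rule infsum_single) (use assms in auto)
qed

lemma Psi_conjugated:
  assumes i: "i \<le> 1"
  shows "Psi i i 0 (mmul z i i (mmul z i i (Rmat z i) (remb z i M)) (Rmat_inv z i)) = emb (\<lambda>n k. M (ix i n) (ix i k))"
proof (intro ext)
  fix n k s m
  have "i = 0 \<or> i = 1" using i by auto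
  then have fl: "\<lfloor>- ix i n - real i / 2\<rfloor> = - n" "\<lfloor>ix i k - real i / 2\<rfloor> = k - int i"
    by (auto simp: ix_def)
  have fl': "\<lfloor>- real i\<rfloor> = - int i" by linarith
  have "mmul z i i (mmul z i i (Rmat z i) (remb z i M)) (Rmat_inv z i) (ix i n) (ix i k)
      = hmul z i (hmul z i (Rmat z i (ix i n) (ix i n)) (remb z i M (ix i n) (ix i k))) (Rmat_inv z i (ix i k) (ix i k))"
    by (simp add: mmul_right_diagonal mmul_left_diagonal Rmat_def Rmat_inv_def)
  also have "\<dots> = bscale (M (ix i n) (ix i k)) (bmono z (k - n))"
    by (simp add: hmul_alt Rmat_def Rmat_inv_def remb_def hpow_def fl fl' rsh_bmono bmul_bmono_left bmul_bmono_right
        lsh_bscale rsh_bscale lsh_bmono algebra_simps)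
  finally have "Psi i i 0 (mmul z i i (mmul z i i (Rmat z i) (remb z i M)) (Rmat_inv z i)) n k = emb (\<lambda>n k. M (ix i n) (ix i k)) n k"
    by (simp add: Psi_def emb_def lsh_bscale rsh_bscale lsh_bmono rsh_bmono)
  then show "Psi i i 0 (mmul z i i (mmul z i i (Rmat z i) (remb z i M)) (Rmat_inv z i)) n k s m = emb (\<lambda>n k. M (ix i n) (ix i k)) n k s m"
    by simp
qed

lemma Psi_Upart_0: "Psi 0 1 0 (Upart z s 0 a) n \<kappa> = acomp s a (case s of Even \<Rightarrow> ix 0 n - ix 1 \<kappa> | Odd \<Rightarrow> ix 0 n + ix 1 \<kappa>)"
proof -
  have f: "\<lfloor>- ix 0 n\<rfloor> = - n" "\<lfloor>ix 1 \<kappa> - 1 / 2\<rfloor> = \<kappa> - 1" by (simp_all add: ix_def)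
  show ?thesis
    by (simp add: Psi_def Upart_def hmul_alt hpow_def f bmul_bmono_left bmul_bmono_right lsh_rsh lsh_lsh rsh_rsh)
qed

lemma Psi_Upart_1: "Psi 1 0 1 (Upart z s 1 a) \<kappa> n = lsh 1 (acomp s a (case s of Even \<Rightarrow> ix 1 \<kappa> - ix 0 n | Odd \<Rightarrow> ix 1 \<kappa> + ix 0 n))"
proof -
  have f: "\<lfloor>- ix 1 \<kappa> - 1 / 2\<rfloor> = - \<kappa>" "\<lfloor>ix 0 n - 1\<rfloor> = n - 1" "\<lfloor>ix 0 n\<rfloor> = n" by (simp_all add: ix_def)
  show ?thesis
    by (simp add: Psi_def Upart_def hmul_alt hpow_def f bmul_bmono_left bmul_bmono_right lsh_rsh lsh_lsh rsh_rsh)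
qed

lemma acomp_Even: "acomp Even a (ix 0 n - ix 1 \<kappa>) = gscale (\<lambda>g. of_bool (g = (Even, n - \<kappa>))) a"
    "acomp Even a (ix 1 \<kappa> - ix 0 n) = gscale (\<lambda>g. of_bool (g = (Even, \<kappa> - n - 1))) a"
  and acomp_Odd: "acomp Odd a (ix 0 n + ix 1 \<kappa>) = gscale (\<lambda>g. of_bool (g = (Odd, n + \<kappa>))) a"
    "acomp Odd a (ix 1 \<kappa> + ix 0 n) = gscale (\<lambda>g. of_bool (g = (Odd, \<kappa> + n))) a"
proof -
  have f: "\<lfloor>real_of_int n - (real_of_int \<kappa> - 1 / 2) - 1 / 2\<rfloor> = n - \<kappa>"
    "\<lfloor>real_of_int \<kappa> - 1 / 2 - real_of_int n - 1 / 2\<rfloor> = \<kappa> - n - 1"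
    "\<lfloor>real_of_int n + (real_of_int \<kappa> - 1 / 2) + 1 / 2\<rfloor> = n + \<kappa>"
    "\<lfloor>real_of_int \<kappa> - 1 / 2 + real_of_int n + 1 / 2\<rfloor> = \<kappa> + n" by linarith+
  show "acomp Even a (ix 0 n - ix 1 \<kappa>) = gscale (\<lambda>g. of_bool (g = (Even, n - \<kappa>))) a"
    "acomp Even a (ix 1 \<kappa> - ix 0 n) = gscale (\<lambda>g. of_bool (g = (Even, \<kappa> - n - 1))) a"
    "acomp Odd a (ix 0 n + ix 1 \<kappa>) = gscale (\<lambda>g. of_bool (g = (Odd, n + \<kappa>))) a"
    "acomp Odd a (ix 1 \<kappa> + ix 0 n) = gscale (\<lambda>g. of_bool (g = (Odd, \<kappa> + n))) a"
    unfolding acomp_def gscale_def fun_eq_iff ix_def by (auto simp: f Let_def)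
qed

lemma Psi_Umat: "Psi 0 1 0 (Umat z 0 a) n \<kappa> = gscale (\<lambda>g. of_bool (act g \<kappa> = n)) a"
proof -
  have "Psi 0 1 0 (Umat z 0 a) n \<kappa> = Psi 0 1 0 (Upart z Even 0 a) n \<kappa> + Psi 0 1 0 (Upart z Odd 0 a) n \<kappa>"
    by (auto simp: Psi_def Umat_def lsh_def rsh_def fun_eq_iff algebra_simps)
  also have "\<dots> = gscale (\<lambda>g. of_bool (act g \<kappa> = n)) a"
    unfolding Psi_Upart_0 parity.case acomp_Even acomp_Odd
    by (intro ev_eqI) (auto simp: ev_add ev_gscale act_def prod_eq_iff)
  finally show ?thesis .
qed

definition Vmat :: "'a series \<Rightarrow> real \<Rightarrow> int \<Rightarrow> int \<Rightarrow> 'a series" where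
  "Vmat a \<theta> n \<kappa> = gscale (rho \<theta> n \<kappa>) a"

lemma tm_Vmat:
  assumes "a \<in> B00 A z" shows "tm (Vmat a \<theta>)"
  unfolding Vmat_def[abs_def]
  by (rule tm_gscale[OF assms rho_bound]) (rule rho_support, assumption)+

lemma tm_U:
  assumes "a \<in> B00 A z" shows "tm (\<lambda>n \<kappa>. gscale (\<lambda>g. of_bool (act g \<kappa> = n)) a)"
  using tm_Vmat[OF assms, of 0] by (simp add: Vmat_def[abs_def] rho_zero[abs_def])

lemma ev_bmono_nonzero: "ev (bmono z d) g \<noteq> 0 \<Longrightarrow> g = (Even, d)"
  by (simp add: ev_bmono split: if_splits)

lemma Psi_Udef_regular:
  assumes a: "a \<in> B00 A z" and C: "cos \<theta> \<noteq> 0"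
  shows "Psi 0 1 0 (Udef_regular z a \<theta>) = Vmat a \<theta>"
proof -
  let ?X = "mmul z 0 0 (mmul z 0 0 (Rmat z 0) (remb z 0 (Dmat 0 \<theta>))) (Rmat_inv z 0)"
  let ?Y = "mmul z 1 1 (mmul z 1 1 (Rmat z 1) (remb z 1 (rinv 1 (Dmat 1 \<theta>)))) (Rmat_inv z 1)"
  let ?D = "Di 0 \<theta>" and ?E = "\<lambda>n k. Di 1 \<theta> k n"
  let ?U = "\<lambda>n \<kappa>. gscale (\<lambda>g. of_bool (act g \<kappa> = n)) a"
  have X: "Psi 0 0 0 ?X = emb ?D"
  proof -
    have "(\<lambda>n k. Dmat 0 \<theta> (ix 0 n) (ix 0 k)) = ?D" by (intro ext) (simp add: Dmat_ix)
    then show ?thesis using Psi_conjugated[of 0 "Dmat 0 \<theta>"] by simp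
  qed
  have Y: "Psi 1 1 0 ?Y = emb ?E"
    using Psi_conjugated[of 1 "rinv 1 (Dmat 1 \<theta>)"] by (simp only: rinv_Dmat[OF C] order_refl)
  have U: "Psi 0 1 0 (Umat z 0 a) = ?U" by (intro ext) (simp only: Psi_Umat)
  have tmX: "tm (emb ?D)" and tmY: "tm (emb ?E)"
    using emb_Di(2)[OF C] tm_emb_transpose by auto
  have "Psi 0 1 0 (mmul z 0 0 ?X (Umat z 0 a)) = mm (emb ?D) ?U"
    using mmul_Psi_tm[of 0 0 0 ?X 1 0 "Umat z 0 a"] tmX tm_U[OF a] unfolding X U by simp
  moreover have "tm (mm (emb ?D) ?U)" by (rule tm_mm[OF tmX tm_U[OF a]])
  ultimately have "Psi 0 1 0 (Udef_regular z a \<theta>) = mm (mm (emb ?D) ?U) (emb ?E)"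
    unfolding Udef_regular_def Let_def using mmul_Psi_tm[of 0 1 0 _ 1 0 ?Y] tmY unfolding Y by simp
  also have DU: "mm (emb ?D) ?U = (\<lambda>n \<kappa>. gscale (\<lambda>g. ?D n (act g \<kappa>)) a)"
  proof -
    have "mm (\<lambda>n k. gscale ((\<lambda>n k g. ?D n k) n k) (bmono z 0)) (\<lambda>n k. gscale ((\<lambda>n \<kappa> g. of_bool (act g \<kappa> = n)) n k) a)
      = (\<lambda>n k. gscale ((\<lambda>n \<kappa> g. ?D n (act g \<kappa>)) n k) (bmul (bmono z 0) a))"
    proof (rule mm_gscale)
      fix n k g h assume "ev (bmono z 0) g \<noteq> 0"
      then have "gm g h = h" using ev_bmono_nonzero by fastforce
      moreover have "((\<lambda>l. ?D n l * of_bool (act h k = l)) has_sum ?D n (act h k)) UNIV"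
        by (rule has_sum_finite_neutralI[of "{act h k}"]) auto
      ultimately show "((\<lambda>l. ?D n l * of_bool (act h k = l)) has_sum ?D n (act (gm g h) k)) UNIV" by simp
    qed (use a tm_U[OF a] tmX in \<open>auto simp: emb_def[abs_def] bscale_gscale\<close>)
    then show ?thesis by (simp add: emb_def[abs_def] bscale_gscale bmul_bmono_left)
  qed
  also have "mm (\<lambda>n \<kappa>. gscale (\<lambda>g. ?D n (act g \<kappa>)) a) (emb ?E) = Vmat a \<theta>"
  proof -
    have tmDU: "tm (\<lambda>n \<kappa>. gscale (\<lambda>g. ?D n (act g \<kappa>)) a)"
      using tm_mm[OF tmX tm_U[OF a]] unfolding DU .
    have "mm (\<lambda>n k. gscale ((\<lambda>n \<kappa> g. ?D n (act g \<kappa>)) n k) a) (\<lambda>n k. gscale ((\<lambda>n k g. ?E n k) n k) (bmono z 0))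
      = (\<lambda>n k. gscale (rho \<theta> n k) (bmul a (bmono z 0)))"
    proof (rule mm_gscale)
      fix n k g h assume "ev (bmono z 0) h \<noteq> 0"
      then have "gm g h = g" using ev_bmono_nonzero by fastforce
      then show "((\<lambda>l. ?D n (act g l) * ?E l k) has_sum rho \<theta> n k (gm g h)) UNIV"
        using rho_has_sum[OF C, of n g k] by simp
    qed (use a tmY tmDU in \<open>auto simp: emb_def[abs_def] bscale_gscale\<close>)
    then show ?thesis by (simp add: emb_def[abs_def] bscale_gscale bmul_bmono_right Vmat_def[abs_def])
  qed
  finally show ?thesis .
qed

lemma eventually_cos_nonzero: "\<forall>\<^sub>F \<theta>' in at \<theta>. cos (\<theta>'::real) \<noteq> 0"
proof (cases "cos \<theta> = 0")
  case True
  have "cos \<theta>' \<noteq> 0" if "\<theta>' \<noteq> \<theta>" "dist \<theta>' \<theta> < pi" for \<theta>'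
  proof
    assume "cos \<theta>' = 0"
    then have "sin (\<theta>' - \<theta>) = 0" using True by (simp add: sin_diff)
    moreover have "\<bar>\<theta>' - \<theta>\<bar> < pi" using that by (simp add: dist_real_def)
    ultimately have "\<theta>' - \<theta> = 0"
      using sin_eq_0_pi[of "\<theta>' - \<theta>"] by linarith
    then show False using that by simp
  qed
  then show ?thesis unfolding eventually_at by (intro exI[of _ pi]) auto
next
  case False
  have "(cos \<longlongrightarrow> cos \<theta>) (at \<theta>)" by (rule isCont_cos[unfolded isCont_def])
  then show ?thesis using False by (rule tendsto_imp_eventually_ne)
qed

lemma Udef_regular_entry:
  assumes a: "a \<in> B00 A z" and C: "cos \<theta> \<noteq> 0"
  shows "Udef_regular z a \<theta> (ix 0 n) (ix 1 \<kappa>) = lsh (- n) (rsh \<kappa> (Vmat a \<theta> n \<kappa>))"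
  by (subst entry_Psi[of _ _ _ _ _ 0]) (simp add: Psi_Udef_regular[OF a C])

lemma tendsto_rho: "((\<lambda>\<theta>'. rho \<theta>' n \<kappa> g) \<longlongrightarrow> rho \<theta> n \<kappa> g) (at \<theta>)"
  using continuous_rho[of n \<kappa> g] by (simp add: continuous_on_def)

lemma Udef_entry:
  assumes a: "a \<in> B00 A z"
  shows "Udef z a \<theta> (ix 0 n) (ix 1 \<kappa>) = lsh (- n) (rsh \<kappa> (Vmat a \<theta> n \<kappa>))"
proof (cases "cos \<theta> = 0")
  case False
  then show ?thesis by (simp add: Udef_def Udef_regular_entry[OF a])
next
  case True
  show ?thesis
  proof (intro ext)
    fix s m
    define g where "g = gm (gm (Even, n) (s, m)) (Even, - \<kappa>)"
    define x where "x = zpow z (- n) * ev a g * zpow z \<kappa>"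
    have V: "lsh (- n) (rsh \<kappa> (Vmat a \<theta> n \<kappa>)) s m = rho \<theta> n \<kappa> g *\<^sub>R x" for \<theta>
    proof -
      have "ev (lsh (- n) (rsh \<kappa> (Vmat a \<theta> n \<kappa>))) (s, m) = rho \<theta> n \<kappa> g *\<^sub>R x"
        by (simp del: ev_pair add: ev_lsh ev_rsh Vmat_def ev_gscale g_def x_def mult.assoc)
      then show ?thesis by simp
    qed
    have "((\<lambda>\<theta>'. rho \<theta>' n \<kappa> g *\<^sub>R x) \<longlongrightarrow> rho \<theta> n \<kappa> g *\<^sub>R x) (at \<theta>)"
      by (rule filterlim_compose[OF tendsto_scaleR_elem tendsto_rho])
    then have "((\<lambda>\<theta>'. Udef_regular z a \<theta>' (ix 0 n) (ix 1 \<kappa>) s m) \<longlongrightarrow> rho \<theta> n \<kappa> g *\<^sub>R x) (at \<theta>)"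
      by (rule Lim_transform_eventually)
         (use eventually_cos_nonzero[of \<theta>] in \<open>eventually_elim, simp add: Udef_regular_entry[OF a] V\<close>)
    then have "Lim (at \<theta>) (\<lambda>\<theta>'. Udef_regular z a \<theta>' (ix 0 n) (ix 1 \<kappa>) s m) = rho \<theta> n \<kappa> g *\<^sub>R x"
      by (rule tendsto_Lim[rotated]) simp
    then show "Udef z a \<theta> (ix 0 n) (ix 1 \<kappa>) s m = lsh (- n) (rsh \<kappa> (Vmat a \<theta> n \<kappa>)) s m"
      using True by (simp add: Udef_def V)
  qed
qed

lemma Psi_Udef:
  assumes a: "a \<in> B00 A z"
  shows "Psi 0 1 0 (Udef z a \<theta>) = Vmat a \<theta>"
proof (intro ext)
  fix n \<kappa> s m
  have "Psi 0 1 0 (Udef z a \<theta>) n \<kappa> = Vmat a \<theta> n \<kappa>"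
    by (simp add: Psi_def Udef_entry[OF a] lsh_rsh lsh_lsh rsh_rsh)
  then show "Psi 0 1 0 (Udef z a \<theta>) n \<kappa> s m = Vmat a \<theta> n \<kappa> s m" by simp
qed

lemma gscale_tendsto:
  assumes a: "a \<in> B00 A z" and r: "\<And>x g. \<bar>r x g\<bar> \<le> 1" and r0: "\<And>g. \<bar>r0 g\<bar> \<le> 1"
    and lim: "\<And>g. ((\<lambda>x. r x g) \<longlongrightarrow> r0 g) F" and p: "continuous_seminorm p"
  shows "((\<lambda>x. bnorm p N (lsh d (rsh e (gscale (r x) a - gscale r0 a)))) \<longlongrightarrow> 0) F"
proof (rule tendstoI)
  fix \<epsilon> :: real assume \<epsilon>: "0 < \<epsilon>"
  define q where "q x = p (zpow z d * x * zpow z e)" for x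
  have q: "continuous_seminorm q" unfolding q_def by (rule cs_mult_both[OF p])
  define K where "K = ((1 + \<bar>real_of_int d\<bar>) * (1 + \<bar>real_of_int e\<bar>)) ^ N"
  have K: "0 < K" unfolding K_def by (intro zero_less_power mult_pos_pos) auto
  from B00_bound[OF a q] obtain C where C: "0 \<le> C" "\<And>g. (1 + gsz g) ^ (Suc N) * q (ev a g) \<le> C" by blast
  define M where "M = 2 * K * (2 * C + 1) / \<epsilon>"
  have M: "0 < M" using K C \<epsilon> by (simp add: M_def)
  define G where "G = {g :: dih. gsz g \<le> M}"
  have "G \<subseteq> UNIV \<times> {- \<lceil>M\<rceil>..\<lceil>M\<rceil>}"
  proof
    fix g assume "g \<in> G"
    then have "\<bar>real_of_int (snd g)\<bar> \<le> M" by (simp add: G_def gsz_def)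
    then have "snd g \<in> {- \<lceil>M\<rceil>..\<lceil>M\<rceil>}" by (simp add: abs_le_iff) linarith
    then show "g \<in> UNIV \<times> {- \<lceil>M\<rceil>..\<lceil>M\<rceil>}" by (cases g) auto
  qed
  moreover have "finite (UNIV :: parity set)" by (simp add: parity_UNIV)
  ultimately have G: "finite G" by (meson finite_SigmaI finite_atLeastAtMost_int finite_subset)
  have "\<forall>\<^sub>F x in F. \<forall>g\<in>G. \<bar>r x g - r0 g\<bar> * (2 * K * (C + 1)) < \<epsilon>"
  proof (rule eventually_ball_finite[OF G], rule ballI)
    fix g
    have "((\<lambda>x. \<bar>r x g - r0 g\<bar> * (2 * K * (C + 1))) \<longlongrightarrow> \<bar>r0 g - r0 g\<bar> * (2 * K * (C + 1))) F"
      by (intro tendsto_intros lim)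
    then show "\<forall>\<^sub>F x in F. \<bar>r x g - r0 g\<bar> * (2 * K * (C + 1)) < \<epsilon>"
      by (rule order_tendstoD) (use \<epsilon> in simp)
  qed
  then show "\<forall>\<^sub>F x in F. dist (bnorm p N (lsh d (rsh e (gscale (r x) a - gscale r0 a)))) 0 < \<epsilon>"
  proof eventually_elim
    case (elim x)
    let ?b = "lsh d (rsh e (gscale (r x) a - gscale r0 a))"
    have b: "gscale (r x) a - gscale r0 a = gscale (\<lambda>g. r x g - r0 g) a"
      by (simp add: gscale_def fun_eq_iff scaleR_diff_left)
    have diff2: "\<bar>r x g - r0 g\<bar> \<le> 2" for g using r[of x g] r0[of g] by linarith
    have "gscale (\<lambda>g. r x g - r0 g) a \<in> B00 A z" by (rule gscale_B00[OF a diff2])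
    then have bB: "?b \<in> B00 A z" unfolding b by simp
    have "(1 + gsz u) ^ N * p (ev ?b u) \<le> \<epsilon> / 2" for u
    proof -
      define g where "g = gm (gm (Even, - d) u) (Even, - e)"
      have u: "u = gm (gm (Even, d) g) (Even, e)"
      proof -
        have "gi (Even, d) = (Even, - d)" "gi (Even, e) = (Even, - e)" by (simp_all add: gi_def)
        then show ?thesis unfolding g_def by (metis gm_assoc gm_gi_cancel(2) gm_gi(1) gm_one(2))
      qed
      have pe: "p (ev ?b u) = \<bar>r x g - r0 g\<bar> * q (ev a g)"
        unfolding b by (simp add: ev_lsh ev_rsh ev_gscale g_def[symmetric] q_def cs_scale[OF p] mult.assoc)
      have "1 + gsz u \<le> (1 + gsz (gm (Even, d) g)) * (1 + gsz (Even, e))" unfolding u by (rule gsz_gm_mult)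
      also have "\<dots> \<le> (1 + gsz (Even, d)) * (1 + gsz g) * (1 + gsz (Even, e))"
        by (intro mult_right_mono gsz_gm_mult) auto
      finally have "(1 + gsz u) ^ N \<le> ((1 + gsz (Even, d)) * (1 + gsz g) * (1 + gsz (Even, e))) ^ N"
        by (intro power_mono) auto
      also have "\<dots> = K * (1 + gsz g) ^ N"
        by (simp add: K_def gsz_def power_mult_distrib mult_ac)
      finally have "(1 + gsz u) ^ N * p (ev ?b u) \<le> K * (1 + gsz g) ^ N * (\<bar>r x g - r0 g\<bar> * q (ev a g))"
        unfolding pe by (intro mult_right_mono mult_nonneg_nonneg) (auto simp: cs_nonneg[OF q])
      also have "\<dots> = K * \<bar>r x g - r0 g\<bar> * ((1 + gsz g) ^ N * q (ev a g))" by (simp add: mult_ac)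
      also have "\<dots> \<le> \<epsilon> / 2"
      proof (cases "g \<in> G")
        case True
        have "1 * ((1 + gsz g) ^ N * q (ev a g)) \<le> (1 + gsz g) * ((1 + gsz g) ^ N * q (ev a g))"
          by (intro mult_right_mono mult_nonneg_nonneg) (auto simp: cs_nonneg[OF q])
        then have "(1 + gsz g) ^ N * q (ev a g) \<le> C + 1" using C(2)[of g] by (simp add: mult.assoc)
        then have "K * \<bar>r x g - r0 g\<bar> * ((1 + gsz g) ^ N * q (ev a g)) \<le> K * \<bar>r x g - r0 g\<bar> * (C + 1)"
          using K by (intro mult_left_mono) auto
        moreover have "\<bar>r x g - r0 g\<bar> * (2 * K * (C + 1)) < \<epsilon>" using elim True by blast
        moreover have "\<bar>r x g - r0 g\<bar> * (2 * K * (C + 1)) = 2 * (K * \<bar>r x g - r0 g\<bar> * (C + 1))" by simp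
        ultimately show ?thesis by linarith
      next
        case False
        then have g: "M < gsz g" by (simp add: G_def)
        have "M * ((1 + gsz g) ^ N * q (ev a g)) \<le> (1 + gsz g) * ((1 + gsz g) ^ N * q (ev a g))"
          using g by (intro mult_right_mono mult_nonneg_nonneg) (auto simp: cs_nonneg[OF q])
        also have "\<dots> \<le> C" using C(2)[of g] by (simp add: mult.assoc)
        finally have *: "(1 + gsz g) ^ N * q (ev a g) \<le> C / M" using M by (simp add: field_simps)
        have "K * \<bar>r x g - r0 g\<bar> * ((1 + gsz g) ^ N * q (ev a g)) \<le> K * 2 * (C / M)"
          using K diff2[of g] * by (intro mult_mono) (auto simp: cs_nonneg[OF q])
        also have "\<dots> \<le> \<epsilon> / 2"
        proof -
          have "\<epsilon> * M = 2 * K * (2 * C + 1)" using \<epsilon> by (simp add: M_def)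
          also have "\<dots> = 4 * K * C + 2 * K" by (simp add: algebra_simps)
          finally have "4 * K * C \<le> \<epsilon> * M" using K by linarith
          then show ?thesis using M by (simp add: field_simps)
        qed
        finally show ?thesis .
      qed
      finally show ?thesis .
    qed
    then have "bnorm p N ?b \<le> \<epsilon> / 2" by (rule bnorm_least)
    then show ?case using bnorm_nonneg[OF bB p, of N] \<epsilon> by (simp add: dist_real_def)
  qed
qed

lemma Udef_extends:
  assumes a: "a \<in> B00 A z"
  shows "Udef_extends A z a"
  unfolding Udef_extends_def ZZ_ix
proof (intro conjI allI impI ballI; elim rangeE; simp only: )
  fix \<theta> n \<kappa>
  show "Udef z a \<theta> (ix 0 n) (ix 1 \<kappa>) \<in> B00 A z"
    unfolding Udef_entry[OF a] using tm_B00[OF tm_Vmat[OF a]] by simp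
next
  fix \<theta> n \<kappa> and p :: "'a \<Rightarrow> real" and N assume p: "continuous_seminorm p"
  have "Udef z a \<theta>' (ix 0 n) (ix 1 \<kappa>) - Udef z a \<theta> (ix 0 n) (ix 1 \<kappa>)
    = lsh (- n) (rsh \<kappa> (gscale (rho \<theta>' n \<kappa>) a - gscale (rho \<theta> n \<kappa>) a))" for \<theta>'
    by (simp add: Udef_entry[OF a] Vmat_def lsh_def rsh_def fun_eq_iff algebra_simps)
  then show "((\<lambda>\<theta>'. bnorm p N (Udef z a \<theta>' (ix 0 n) (ix 1 \<kappa>) - Udef z a \<theta> (ix 0 n) (ix 1 \<kappa>))) \<longlongrightarrow> 0) (at \<theta>)"
    using gscale_tendsto[OF a rho_bound rho_bound tendsto_rho p] by simp
qed

end

section \<open>The exceptional angle\<close>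

text \<open>At the angle \<open>pi/2\<close> the deformed matrix is, up to signs and a rotation of two columns, the direct
  sum of the matrix of left multiplication with respect to a shifted basis and of the entry \<open>a\<close>.\<close>

definition act1 :: "dih \<Rightarrow> int \<Rightarrow> int" where
  "act1 g j = (if fst g = Even then snd g + j else snd g - 1 - j)"

definition chi :: "dih \<Rightarrow> real" where
  "chi g = (if fst g = Even then 1 else -1)"

definition en :: "int \<Rightarrow> real" where
  "en n = (if n \<ge> 1 then -1 else 1)"

definition nu :: "int \<Rightarrow> int" where
  "nu n = (if n \<ge> 1 then n - 1 else n)"

definition om :: "int \<Rightarrow> real" where
  "om \<kappa> = (if \<kappa> \<le> -1 then 1 else if \<kappa> = 0 then sqrt 2 / 2 else if \<kappa> = 1 then - (sqrt 2 / 2) else -1)"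

definition jj :: "int \<Rightarrow> int" where
  "jj \<kappa> = (if \<kappa> \<ge> 1 then \<kappa> - 1 else \<kappa>)"

definition ve :: "int \<Rightarrow> real" where
  "ve \<kappa> = (if \<kappa> = 0 \<or> \<kappa> = 1 then sqrt 2 / 2 else 0)"

definition rho_inv :: "int \<Rightarrow> int \<Rightarrow> dih \<Rightarrow> real" where
  "rho_inv \<kappa> n h = (if n = 0 then ve \<kappa> else en n * om \<kappa> * chi h * of_bool (act1 h (nu n) = jj \<kappa>))"

lemma act1_gm: "act1 (gm g h) j = act1 g (act1 h j)"
  by (auto simp: act1_def gm_def padd_def)

lemma act1_one [simp]: "act1 (Even, 0) j = j"
  by (simp add: act1_def)

lemma chi_gm: "chi (gm g h) = chi g * chi h"
  by (auto simp: chi_def gm_def padd_def)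

lemma chi_one [simp]: "chi (Even, 0) = 1" by (simp add: chi_def)

lemma act1_inj: "act1 g i = act1 g j \<longleftrightarrow> i = j"
  by (auto simp: act1_def)

lemma om_reflect: "om (1 - \<kappa>) = - om \<kappa>" and jj_reflect: "jj (1 - \<kappa>) = - jj \<kappa>"
  and ve_reflect: "ve (1 - \<kappa>) = ve \<kappa>"
  by (auto simp: om_def jj_def ve_def)

lemma rho_pos_half_pi:
  "rho_pos (pi/2) n \<kappa> y =
    (if n \<ge> 1 then om \<kappa> * - of_bool (y = (if \<kappa> \<ge> 1 then 0 else -1))
     else if \<kappa> \<ge> 2 then 0 else sqrt 2 / 2)"
proof -
  have t: "pi / 2 / 2 = pi / 4" by simp
  show ?thesis
    unfolding rho_pos_def sin_pi_half cos_pi_half t sin_45 cos_45 by (auto simp: om_def)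
qed

lemma rhoe_half_pi:
  "rhoe (pi/2) n \<kappa> d = (if n = 0 then ve \<kappa> else en n * om \<kappa> * of_bool (d + jj \<kappa> = nu n))"
proof -
  consider "n \<ge> 1" | "n = 0" "\<kappa> \<ge> 1" | "n = 0" "\<kappa> \<le> 0" | "n \<le> -1" by linarith
  then show ?thesis
  proof cases
    case 1
    then have "rhoe (pi/2) n \<kappa> d = rho_pos (pi/2) n \<kappa> (d + \<kappa> - n)" by (intro rhoe_nonneg) auto
    then show ?thesis using 1 unfolding rho_pos_half_pi by (auto simp: en_def jj_def nu_def)
  next
    case 2
    then have "rhoe (pi/2) n \<kappa> d = rho_pos (pi/2) n \<kappa> (d + \<kappa> - n)" by (intro rhoe_nonneg) auto
    then show ?thesis using 2 unfolding rho_pos_half_pi by (auto simp: ve_def)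
  next
    case 3
    then have "rhoe (pi/2) n \<kappa> d = rho_pos (pi/2) (- n) (1 - \<kappa>) (- (d + \<kappa> - n))" by (intro rhoe_neg) auto
    then show ?thesis using 3 unfolding rho_pos_half_pi by (auto simp: ve_def)
  next
    case 4
    then have "rhoe (pi/2) n \<kappa> d = rho_pos (pi/2) (- n) (1 - \<kappa>) (- (d + \<kappa> - n))" by (intro rhoe_neg) auto
    then show ?thesis using 4 unfolding rho_pos_half_pi om_reflect by (auto simp: en_def jj_def nu_def)
  qed
qed

lemma rho_half_pi:
  "rho (pi/2) n \<kappa> g = (if n = 0 then ve \<kappa> else en n * om \<kappa> * chi g * of_bool (act1 g (jj \<kappa>) = nu n))"
  unfolding rho_def rhoe_half_pi om_reflect jj_reflect ve_reflect by (auto simp: chi_def act1_def)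

lemma om_square_has_sum: "((\<lambda>\<kappa>. om \<kappa> * om \<kappa> * of_bool (jj \<kappa> = J)) has_sum 1) UNIV"
proof -
  have "((\<lambda>\<kappa>. om \<kappa> * om \<kappa> * of_bool (jj \<kappa> = J)) has_sum (\<Sum>\<kappa>\<in>{J, J + 1}. om \<kappa> * om \<kappa> * of_bool (jj \<kappa> = J))) UNIV"
    by (rule has_sum_finite_neutralI[of "{J, J + 1}"]) (auto simp: jj_def split: if_splits)
  moreover have "sum f {J, J + 1} = f J + f (J + 1)" for f :: "int \<Rightarrow> real" by simp
  moreover have "om J * om J * of_bool (jj J = J) + om (J + 1) * om (J + 1) * of_bool (jj (J + 1) = J) = 1"
    by (auto simp: om_def jj_def)
  ultimately show ?thesis by simp
qed

lemma ve_om_has_sum: "((\<lambda>\<kappa>. ve \<kappa> * (om \<kappa> * of_bool (jj \<kappa> = J))) has_sum 0) UNIV"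
proof -
  have "((\<lambda>\<kappa>. ve \<kappa> * (om \<kappa> * of_bool (jj \<kappa> = J))) has_sum (\<Sum>\<kappa>\<in>{0, 1}. ve \<kappa> * (om \<kappa> * of_bool (jj \<kappa> = J)))) UNIV"
    by (rule has_sum_finite_neutralI[of "{0, 1}"]) (auto simp: ve_def)
  moreover have "(\<Sum>\<kappa>\<in>{0, 1}. ve \<kappa> * (om \<kappa> * of_bool (jj \<kappa> = J))) = 0"
    by (simp add: om_def jj_def ve_def)
  ultimately show ?thesis by simp
qed

lemma ve_square_has_sum: "((\<lambda>\<kappa>. ve \<kappa> * ve \<kappa>) has_sum 1) UNIV"
proof -
  have "((\<lambda>\<kappa>. ve \<kappa> * ve \<kappa>) has_sum (\<Sum>\<kappa>\<in>{0, 1}. ve \<kappa> * ve \<kappa>)) UNIV"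
    by (rule has_sum_finite_neutralI[of "{0, 1}"]) (auto simp: ve_def)
  moreover have "(\<Sum>\<kappa>\<in>{0, 1}. ve \<kappa> * ve \<kappa>) = 1"
    by (simp add: ve_def)
  ultimately show ?thesis by simp
qed

lemma rho_rho_inv_has_sum:
  "((\<lambda>\<kappa>. rho (pi/2) n \<kappa> g * rho_inv \<kappa> m h) has_sum
    (if n = 0 \<and> m = 0 then 1 else if n = 0 \<or> m = 0 then 0
     else en n * en m * chi (gm g h) * of_bool (act1 (gm g h) (nu m) = nu n))) UNIV"
proof -
  consider "n = 0" "m = 0" | "n = 0" "m \<noteq> 0" | "n \<noteq> 0" "m = 0" | "n \<noteq> 0" "m \<noteq> 0" by blast
  then show ?thesis
  proof cases
    case 1
    then show ?thesis using ve_square_has_sum by (simp add: rho_half_pi rho_inv_def)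
  next
    case 2
    have "((\<lambda>\<kappa>. en m * chi h * (ve \<kappa> * (om \<kappa> * of_bool (jj \<kappa> = act1 h (nu m))))) has_sum (en m * chi h * 0)) UNIV"
      by (rule has_sum_cmult_right[OF ve_om_has_sum])
    then show ?thesis using 2 by (simp add: rho_half_pi rho_inv_def mult_ac eq_commute[of "jj _"])
  next
    case 3
    obtain J where J: "act1 g J = nu n" by (metis act1_gm act1_one gm_gi(2))
    have "((\<lambda>\<kappa>. en n * chi g * (ve \<kappa> * (om \<kappa> * of_bool (jj \<kappa> = J)))) has_sum (en n * chi g * 0)) UNIV"
      by (rule has_sum_cmult_right[OF ve_om_has_sum])
    then show ?thesis using 3 by (simp add: rho_half_pi rho_inv_def mult_ac J[symmetric] act1_inj)
  next
    case 4
    let ?J = "act1 h (nu m)"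
    have "((\<lambda>\<kappa>. en n * en m * chi g * chi h * of_bool (act1 g ?J = nu n) * (om \<kappa> * om \<kappa> * of_bool (jj \<kappa> = ?J))) has_sum
      (en n * en m * chi g * chi h * of_bool (act1 g ?J = nu n) * 1)) UNIV"
      by (rule has_sum_cmult_right[OF om_square_has_sum])
    moreover have "rho (pi/2) n \<kappa> g * rho_inv \<kappa> m h
      = en n * en m * chi g * chi h * of_bool (act1 g ?J = nu n) * (om \<kappa> * om \<kappa> * of_bool (jj \<kappa> = ?J))" for \<kappa>
      using 4 by (cases "jj \<kappa> = ?J") (auto simp: rho_half_pi rho_inv_def)
    ultimately show ?thesis using 4 by (simp add: chi_gm act1_gm mult_ac)
  qed
qed

lemma rho_inv_rho_has_sum:
  "((\<lambda>n. rho_inv \<kappa> n g * rho (pi/2) n \<kappa>' h) has_sum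
    (ve \<kappa> * ve \<kappa>' + om \<kappa> * om \<kappa>' * chi (gm g h) * of_bool (act1 (gm g h) (jj \<kappa>') = jj \<kappa>))) UNIV"
proof -
  define x where "x = act1 h (jj \<kappa>')"
  define n0 where "n0 = (if x \<ge> 0 then x + 1 else x)"
  have n0: "n0 \<noteq> 0" "nu n0 = x" by (auto simp: n0_def nu_def)
  have inj: "nu n = x \<Longrightarrow> n \<noteq> 0 \<Longrightarrow> n = n0" for n by (auto simp: n0_def nu_def split: if_splits)
  have "((\<lambda>n. rho_inv \<kappa> n g * rho (pi/2) n \<kappa>' h) has_sum (\<Sum>n\<in>{0, n0}. rho_inv \<kappa> n g * rho (pi/2) n \<kappa>' h)) UNIV"
  proof (rule has_sum_finite_neutralI[of "{0, n0}"])
    fix n assume "n \<in> UNIV - {0, n0}"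
    then have "n \<noteq> 0" "nu n \<noteq> x" using inj by auto
    then show "rho_inv \<kappa> n g * rho (pi/2) n \<kappa>' h = 0" by (simp add: rho_half_pi x_def)
  qed auto
  moreover have "(\<Sum>n\<in>{0, n0}. rho_inv \<kappa> n g * rho (pi/2) n \<kappa>' h)
      = ve \<kappa> * ve \<kappa>' + om \<kappa> * om \<kappa>' * chi (gm g h) * of_bool (act1 (gm g h) (jj \<kappa>') = jj \<kappa>)"
  proof -
    have "en n0 = 1 \<or> en n0 = -1" by (simp add: en_def)
    then show ?thesis
      using n0 by (elim disjE) (simp_all add: rho_half_pi rho_inv_def x_def[symmetric] chi_gm act1_gm mult_ac)
  qed
  ultimately show ?thesis by simp
qed

lemma rho_inv_bound: "\<bar>rho_inv \<kappa> n h\<bar> \<le> 1"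
proof -
  have "sqrt 2 \<le> (2::real)" using real_sqrt_le_mono[of 2 4] by simp
  then have "\<bar>ve \<kappa>\<bar> \<le> 1" "\<bar>om \<kappa>\<bar> \<le> 1" by (auto simp: ve_def om_def)
  then show ?thesis by (auto simp: rho_inv_def abs_mult en_def chi_def)
qed

lemma rho_inv_support:
  assumes "rho_inv \<kappa> n h \<noteq> 0"
  shows "\<bar>real_of_int \<kappa>\<bar> \<le> gsz h + \<bar>real_of_int n\<bar> + 3" "\<bar>real_of_int n\<bar> \<le> gsz h + \<bar>real_of_int \<kappa>\<bar> + 3"
proof -
  have "\<bar>\<kappa>\<bar> \<le> \<bar>snd h\<bar> + \<bar>n\<bar> + 3 \<and> \<bar>n\<bar> \<le> \<bar>snd h\<bar> + \<bar>\<kappa>\<bar> + 3"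
  proof (cases "n = 0")
    case True
    then show ?thesis using assms by (auto simp: rho_inv_def ve_def split: if_splits)
  next
    case False
    then have "act1 h (nu n) = jj \<kappa>" using assms by (auto simp: rho_inv_def)
    then show ?thesis by (auto simp: act1_def nu_def jj_def split: if_splits)
  qed
  then show "\<bar>real_of_int \<kappa>\<bar> \<le> gsz h + \<bar>real_of_int n\<bar> + 3" "\<bar>real_of_int n\<bar> \<le> gsz h + \<bar>real_of_int \<kappa>\<bar> + 3"
    unfolding gsz_def by linarith+
qed

lemma floor_neg_one [simp]: "\<lfloor>- 1 :: real\<rfloor> = - 1"
  by linarith

context loop_algebra
begin

lemma bscale_0 [simp]: "bscale 0 b = 0"
  by (simp add: bscale_def fun_eq_iff)

lemma invertible01_iff: "invertible01 A z a \<longleftrightarrow> (\<exists>c\<in>B00 A z. bmul a c = bmono z 0 \<and> bmul c a = bmono z 0)"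
proof -
  have "hpow z 1 0 (-1/2) = bmono z (-1)" by (simp add: hpow_def)
  then show ?thesis by (simp add: invertible01_def hmul_alt bmul_bmono_right)
qed

definition L1 :: "int \<Rightarrow> 'a series" where
  "L1 \<kappa> = (if \<kappa> \<le> 0 then bmono z 0 else bmono z (-1))"

definition L1i :: "int \<Rightarrow> 'a series" where
  "L1i \<kappa> = (if \<kappa> \<le> 0 then bmono z 0 else bmono z 1)"

definition LZ :: "'a series \<Rightarrow> int \<Rightarrow> 'a series" where
  "LZ u n = (if n < 0 then bmono z 0 else if n = 0 then u else bmono z (-1))"

definition LZi :: "'a series \<Rightarrow> int \<Rightarrow> 'a series" where
  "LZi u n = (if n < 0 then bmono z 0 else if n = 0 then u else bmono z 1)"

lemma tm_L:
  "tm (Diag L1)" "tm (Diag L1i)" "u \<in> B00 A z \<Longrightarrow> tm (Diag (LZ u))" "u \<in> B00 A z \<Longrightarrow> tm (Diag (LZi u))"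
proof -
  show "tm (Diag L1)" by (rule tm_Diag[where S = "{bmono z 0, bmono z (-1)}"]) (auto simp: L1_def)
  show "tm (Diag L1i)" by (rule tm_Diag[where S = "{bmono z 0, bmono z 1}"]) (auto simp: L1i_def)
  show "tm (Diag (LZ u))" if "u \<in> B00 A z"
    by (rule tm_Diag[where S = "{bmono z 0, u, bmono z (-1)}"]) (use that in \<open>auto simp: LZ_def\<close>)
  show "tm (Diag (LZi u))" if "u \<in> B00 A z"
    by (rule tm_Diag[where S = "{bmono z 0, u, bmono z 1}"]) (use that in \<open>auto simp: LZi_def\<close>)
qed

lemma mm_Diag_Diag: "mm (Diag d) (Diag e) = Diag (\<lambda>n. bmul (d n) (e n))"
  by (intro ext) (simp add: mm_Diag_left Diag_def)

lemma L_inverse: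
  "mm (Diag L1) (Diag L1i) = one_mat" "mm (Diag L1i) (Diag L1) = one_mat"
  "bmul u w = bmono z 0 \<Longrightarrow> mm (Diag (LZ u)) (Diag (LZi w)) = one_mat"
  "bmul w u = bmono z 0 \<Longrightarrow> mm (Diag (LZi w)) (Diag (LZ u)) = one_mat"
proof -
  have b: "bmul (bmono z d) (bmono z e) = bmono z (d + e)" for d e
    by (simp add: bmul_bmono_left lsh_bmono)
  show "mm (Diag L1) (Diag L1i) = one_mat" "mm (Diag L1i) (Diag L1) = one_mat"
    unfolding mm_Diag_Diag one_mat_def by (auto simp: L1_def L1i_def b intro!: arg_cong[of _ _ Diag])
  show "mm (Diag (LZ u)) (Diag (LZi w)) = one_mat" if "bmul u w = bmono z 0"
    unfolding mm_Diag_Diag one_mat_def using that by (auto simp: LZ_def LZi_def b intro!: arg_cong[of _ _ Diag])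
  show "mm (Diag (LZi w)) (Diag (LZ u)) = one_mat" if "bmul w u = bmono z 0"
    unfolding mm_Diag_Diag one_mat_def using that by (auto simp: LZ_def LZi_def b intro!: arg_cong[of _ _ Diag])
qed

lemma Psi_Lmat1: "Psi 1 1 0 (Lmat1 z) = Diag L1"
proof (intro ext)
  fix n k s m
  have "ix 1 n < 0 \<longleftrightarrow> n \<le> 0" for n by (simp add: ix_def) linarith
  then have "Psi 1 1 0 (Lmat1 z) n k = Diag L1 n k"
    by (simp add: Psi_def Lmat1_def Diag_def L1_def hpow_def lsh_bmono rsh_bmono)
  then show "Psi 1 1 0 (Lmat1 z) n k s m = Diag L1 n k s m" by simp
qed

lemma Psi_Lmat: "Psi 0 0 0 (Lmat z u) = Diag (LZ u)"
proof (intro ext)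
  fix n k s m
  have "ix 0 n < 0 \<longleftrightarrow> n < 0" "ix 0 n = 0 \<longleftrightarrow> n = 0" for n by (simp_all add: ix_def)
  then have "Psi 0 0 0 (Lmat z u) n k = Diag (LZ u) n k"
    by (simp add: Psi_def Lmat_def Diag_def LZ_def hpow_def lsh_bmono rsh_bmono)
  then show "Psi 0 0 0 (Lmat z u) n k s m = Diag (LZ u) n k s m" by simp
qed

definition Vinv :: "'a series \<Rightarrow> int \<Rightarrow> int \<Rightarrow> 'a series" where
  "Vinv c \<kappa> n = gscale (rho_inv \<kappa> n) c"

lemma tm_Vinv:
  assumes "c \<in> B00 A z" shows "tm (Vinv c)"
  unfolding Vinv_def[abs_def]
  by (rule tm_gscale[OF assms rho_inv_bound]) (rule rho_inv_support, assumption)+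

lemma gscale_one:
  assumes "\<And>n k. \<tau> n k (Even, 0) = of_bool (n = k)"
  shows "(\<lambda>n k. gscale (\<tau> n k) (bmono z 0)) = one_mat"
proof (intro ext)
  fix n k s m
  have "ev (gscale (\<tau> n k) (bmono z 0)) (s, m) = ev (one_mat n k) (s, m)"
    by (simp del: ev_pair add: ev_gscale ev_bmono one_mat_def Diag_def assms)
  then show "gscale (\<tau> n k) (bmono z 0) s m = one_mat n k s m" by simp
qed

lemma Vmat_Vinv:
  assumes a: "a \<in> B00 A z" and c: "c \<in> B00 A z" and ac: "bmul a c = bmono z 0"
  shows "mm (Vmat a (pi/2)) (Vinv c) = one_mat"
proof -
  define \<tau> where "\<tau> n m u = (if n = 0 \<and> m = 0 then 1 else if n = 0 \<or> m = 0 then 0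
     else en n * en m * chi u * of_bool (act1 u (nu m) = nu n))" for n m u
  have "mm (\<lambda>n k. gscale (rho (pi/2) n k) a) (\<lambda>n k. gscale (rho_inv n k) c) = (\<lambda>n k. gscale (\<tau> n k) (bmul a c))"
    by (rule mm_gscale[OF a c tm_Vmat[OF a, unfolded Vmat_def[abs_def]] tm_Vinv[OF c, unfolded Vinv_def[abs_def]]])
       (unfold \<tau>_def, rule rho_rho_inv_has_sum)
  also have "\<dots> = one_mat"
    unfolding ac by (rule gscale_one) (auto simp: \<tau>_def en_def nu_def)
  finally show ?thesis by (simp add: Vmat_def[abs_def] Vinv_def[abs_def])
qed

lemma Vinv_Vmat:
  assumes a: "a \<in> B00 A z" and c: "c \<in> B00 A z" and ca: "bmul c a = bmono z 0"
  shows "mm (Vinv c) (Vmat a (pi/2)) = one_mat"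
proof -
  define \<tau> where "\<tau> \<kappa> \<kappa>' u = ve \<kappa> * ve \<kappa>' + om \<kappa> * om \<kappa>' * chi u * of_bool (act1 u (jj \<kappa>') = jj \<kappa>)" for \<kappa> \<kappa>' u
  have "mm (\<lambda>n k. gscale (rho_inv n k) c) (\<lambda>n k. gscale (rho (pi/2) n k) a) = (\<lambda>n k. gscale (\<tau> n k) (bmul c a))"
    by (rule mm_gscale[OF c a tm_Vinv[OF c, unfolded Vinv_def[abs_def]] tm_Vmat[OF a, unfolded Vmat_def[abs_def]]])
       (unfold \<tau>_def, rule rho_inv_rho_has_sum)
  also have "\<dots> = one_mat"
    unfolding ca by (rule gscale_one) (auto simp: \<tau>_def ve_def om_def jj_def)
  finally show ?thesis by (simp add: Vmat_def[abs_def] Vinv_def[abs_def])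
qed

section \<open>The reduced matrix\<close>

definition Uone :: "'a series \<Rightarrow> int \<Rightarrow> int \<Rightarrow> 'a series" where
  "Uone a n j = gscale (\<lambda>g. chi g * of_bool (act1 g j = n)) a"

lemma Psi_Udiff: "Psi 1 0 1 (Upart z Even 1 a - Upart z Odd 1 a) \<kappa> j = lsh 1 (Uone a (\<kappa> - 1) j)"
proof -
  have "Psi 1 0 1 (Upart z Even 1 a - Upart z Odd 1 a) \<kappa> j
      = Psi 1 0 1 (Upart z Even 1 a) \<kappa> j - Psi 1 0 1 (Upart z Odd 1 a) \<kappa> j"
    by (auto simp: Psi_def lsh_def rsh_def fun_eq_iff algebra_simps)
  also have "\<dots> = lsh 1 (acomp Even a (ix 1 \<kappa> - ix 0 j) - acomp Odd a (ix 1 \<kappa> + ix 0 j))"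
    unfolding Psi_Upart_1 parity.case by (auto simp: lsh_def fun_eq_iff algebra_simps)
  also have "acomp Even a (ix 1 \<kappa> - ix 0 j) - acomp Odd a (ix 1 \<kappa> + ix 0 j) = Uone a (\<kappa> - 1) j"
    unfolding acomp_Even acomp_Odd Uone_def
    by (intro ev_eqI) (auto simp: ev_diff ev_gscale act1_def chi_def prod_eq_iff)
  finally show ?thesis .
qed

lemma hmat_ix:
  "hmat (ix 0 n) (ix 1 \<kappa>) = (if n \<noteq> 0 \<and> \<kappa> - 1 = nu n then en n else 0)"
proof -
  have e: "ix 1 \<kappa> < 0 \<longleftrightarrow> \<kappa> \<le> 0" "ix 1 \<kappa> > 0 \<longleftrightarrow> \<kappa> \<ge> 1" "ix 0 n = ix 1 \<kappa> - 1/2 \<longleftrightarrow> n = \<kappa> - 1" "ix 0 n = ix 1 \<kappa> + 1/2 \<longleftrightarrow> n = \<kappa>"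
    unfolding ix_def by (simp_all; linarith)+
  show ?thesis unfolding hmat_def e by (auto simp: en_def nu_def)
qed

lemma hmat'_ix: "hmat' (ix 0 j) (ix 1 \<kappa>) = (if j = jj \<kappa> then om \<kappa> else 0)"
proof -
  have e: "ix 0 j < 0 \<longleftrightarrow> j < 0" "ix 0 j > 0 \<longleftrightarrow> j > 0" "ix 0 j = 0 \<longleftrightarrow> j = 0"
    "ix 1 \<kappa> = ix 0 j - 1/2 \<longleftrightarrow> j = \<kappa>" "ix 1 \<kappa> = ix 0 j + 1/2 \<longleftrightarrow> \<kappa> = j + 1"
    "ix 1 \<kappa> = -1/2 \<longleftrightarrow> \<kappa> = 0" "ix 1 \<kappa> = 1/2 \<longleftrightarrow> \<kappa> = 1"
    unfolding ix_def by (simp_all; linarith)+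
  show ?thesis unfolding hmat'_def hmat_pre_def e by (auto simp: om_def jj_def)
qed

lemma bmul_bscale_bmono:
  assumes "b \<in> B00 A z"
  shows "bmul b (bscale r (bmono z d)) = bscale r (rsh d b)"
proof -
  have "bmul b (bscale r (bmono z 0)) = bscale r b"
  proof (intro ext)
    fix s k
    have "(\<Sum>\<^sub>\<infinity>n. b Even n * bscale r (bmono z 0) s (k - n) + b Odd n * bscale r (bmono z 0) (padd Odd s) (n - k))
        = b Even k * bscale r (bmono z 0) s (k - k) + b Odd k * bscale r (bmono z 0) (padd Odd s) (k - k)"
      by (rule infsum_single) (auto simp: bmono_def bscale_def)
    then show "bmul b (bscale r (bmono z 0)) s k = bscale r b s k"
      by (cases s) (simp_all add: bmul_def bscale_def bmono_def)
  qed
  then have "bmul (bmul b (bscale r (bmono z 0))) (bmono z d) = bscale r (rsh d b)"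
    by (simp add: bmul_bmono_right rsh_bscale)
  moreover have "bmul (bscale r (bmono z 0)) (bmono z d) = bscale r (bmono z d)"
    by (simp add: bmul_bscale_one)
  ultimately show ?thesis using bmul_assoc[of b "bscale r (bmono z 0)" "bmono z d"] assms bscale_B00 by simp
qed

lemma Psi_Uhat:
  assumes a: "a \<in> B00 A z" and c: "c \<in> B00 A z" and ca: "bmul c a = bmono z 0"
  shows "Psi 0 1 1 (Uhat z a) = mm (Diag (LZi c)) (mm (Vmat a (pi/2)) (Diag L1))"
proof (intro ext)
  fix n \<kappa> s m
  let ?U = "Upart z Even 1 a - Upart z Odd 1 a"
  let ?hU = "mmul z 1 1 (remb z 1 hmat) ?U"
  have UB: "Uone a i j \<in> B00 A z" for i j
    unfolding Uone_def by (rule gscale_B00[OF a, where R = 1]) (auto simp: chi_def)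
  have B1: "remb z 1 M (ix p n) (ix q k) \<in> B00 A z" for M p q n k
    by (simp add: remb_def hpow_def bscale_B00)
  have B2: "?U (ix 1 n) (ix 0 k) \<in> B00 A z" for n k
    by (subst entry_Psi[of _ _ _ _ _ 1]) (simp add: Psi_Udiff UB)
  have P1: "Psi 0 0 1 ?hU = mm (Psi 0 1 1 (remb z 1 hmat)) (Psi 1 0 1 ?U)"
    by (rule mmul_Psi) (rule B1, rule B2)
  have hU: "Psi 0 0 1 ?hU n j = (if n = 0 then 0 else bscale (en n) (lsh (n - nu n) (Uone a (nu n) j)))" for n j
  proof (cases "n = 0")
    case True
    then show ?thesis
      unfolding P1
      by (intro ext) (simp add: mm_def Psi_remb hmat_ix)
  next
    case False
    have "mm (Psi 0 1 1 (remb z 1 hmat)) (Psi 1 0 1 ?U) n j s m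
       = bmul (Psi 0 1 1 (remb z 1 hmat) n (nu n + 1)) (Psi 1 0 1 ?U (nu n + 1) j) s m" for s m
      unfolding mm_def by (rule infsum_single) (auto simp: Psi_remb hmat_ix)
    then have "Psi 0 0 1 ?hU n j = bmul (bscale (en n) (bmono z (n - (nu n + 1)))) (lsh 1 (Uone a (nu n) j))"
      unfolding P1 using False
      by (intro ext) (simp add: Psi_remb hmat_ix Psi_Udiff)
    also have "\<dots> = bmul (bmul (bscale (en n) (bmono z 0)) (bmono z (n - (nu n + 1)))) (lsh 1 (Uone a (nu n) j))"
      by (simp add: bmul_bscale_one)
    also have "\<dots> = bscale (en n) (lsh (n - nu n) (Uone a (nu n) j))"
      by (subst bmul_assoc) (simp_all add: UB bscale_B00 bmul_bscale_one bmul_bmono_left lsh_lsh)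
    finally show ?thesis using False by simp
  qed
  have hUB: "Psi 0 0 1 ?hU n j \<in> B00 A z" for n j
    by (simp add: hU bscale_B00 UB)
  then have B3: "?hU (ix 0 n) (ix 0 k) \<in> B00 A z" for n k
    by (subst entry_Psi[of _ _ _ _ _ 1]) simp
  have P2: "Psi 0 1 1 (mmul z 0 1 ?hU (remb z 1 hmat')) = mm (Psi 0 0 1 ?hU) (Psi 0 1 1 (remb z 1 hmat'))"
    by (rule mmul_Psi) (rule B3, rule B1)
  have "mm (Psi 0 0 1 ?hU) (Psi 0 1 1 (remb z 1 hmat')) n \<kappa> s m
     = bmul (Psi 0 0 1 ?hU n (jj \<kappa>)) (Psi 0 1 1 (remb z 1 hmat') (jj \<kappa>) \<kappa>) s m" for s m
    unfolding mm_def by (rule infsum_single) (auto simp: Psi_remb hmat'_ix)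
  then have hUh: "Psi 0 1 1 (mmul z 0 1 ?hU (remb z 1 hmat')) n \<kappa>
     = bmul (Psi 0 0 1 ?hU n (jj \<kappa>)) (bscale (om \<kappa>) (bmono z (jj \<kappa> - \<kappa>)))"
    unfolding P2
    by (intro ext) (simp add: Psi_remb hmat'_ix)
  have Psi_add: "Psi p q i (M + N) n k = Psi p q i M n k + Psi p q i N n k" for p q i M N n k
    by (auto simp: Psi_def lsh_def rsh_def fun_eq_iff algebra_simps)
  have L1k: "L1 \<kappa> = bmono z (jj \<kappa> - \<kappa>)" by (simp add: L1_def jj_def)
  have e0: "Psi 0 1 1 (remb z 1 (\<lambda>n k. sqrt 2 / 2 * of_bool (n = 0 \<and> (k = -1/2 \<or> k = 1/2)))) n \<kappa>
     = (if n = 0 then bscale (ve \<kappa>) (L1 \<kappa>) else 0)"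
  proof -
    have e: "ix 0 n = 0 \<longleftrightarrow> n = 0" "ix 1 \<kappa> = -1/2 \<longleftrightarrow> \<kappa> = 0" "ix 1 \<kappa> = 1/2 \<longleftrightarrow> \<kappa> = 1"
      unfolding ix_def by (simp_all; linarith)+
    show ?thesis unfolding Psi_remb e by (auto simp: ve_def L1_def bscale_def fun_eq_iff)
  qed
  have V: "Vmat a (pi/2) n \<kappa> = (if n = 0 then bscale (ve \<kappa>) a else bscale (en n * om \<kappa>) (Uone a (nu n) (jj \<kappa>)))"
    by (intro ev_eqI) (simp add: Vmat_def Uone_def bscale_gscale ev_gscale rho_half_pi mult_ac)
  have VB: "Vmat a (pi/2) n \<kappa> \<in> B00 A z" for n \<kappa> by (rule tm_B00[OF tm_Vmat[OF a]])
  have R: "mm (Diag (LZi c)) (mm (Vmat a (pi/2)) (Diag L1)) n \<kappa> = bmul (LZi c n) (rsh (jj \<kappa> - \<kappa>) (Vmat a (pi/2) n \<kappa>))"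
    by (simp add: mm_Diag_left mm_Diag_right L1k bmul_bmono_right)
  have UE: "Psi 0 1 1 (Uhat z a) n \<kappa> = bmul (Psi 0 0 1 ?hU n (jj \<kappa>)) (bscale (om \<kappa>) (bmono z (jj \<kappa> - \<kappa>)))
      + (if n = 0 then bscale (ve \<kappa>) (L1 \<kappa>) else 0)"
    unfolding Uhat_def Psi_add hUh e0 ..
  have "Psi 0 1 1 (Uhat z a) n \<kappa> = mm (Diag (LZi c)) (mm (Vmat a (pi/2)) (Diag L1)) n \<kappa>"
  proof (cases "n = 0")
    case True
    have "bmul c (rsh d (bscale r a)) = bscale r (bmono z d)" for d r
    proof -
      have "bscale r a = bmul a (bscale r (bmono z 0))"
        using bmul_bscale_bmono[OF a, of r 0] by simp
      then have "bmul c (bscale r a) = bscale r (bmono z 0)"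
        using a c ca by (simp add: bmul_assoc[symmetric] bscale_B00 bmul_bmono_left)
      moreover have "bmul c (rsh d (bscale r a)) = rsh d (bmul c (bscale r a))"
        by (rule bmul_rsh) (use c a bscale_B00 in auto)
      ultimately show ?thesis by (simp add: rsh_bscale rsh_bmono)
    qed
    then show ?thesis
      unfolding R V UE hU using True by (simp add: LZi_def L1k)
  next
    case False
    have bb: "bscale r (bscale r' b) = bscale (r * r') b" for r r' b by (simp add: bscale_def)
    have "n - nu n = (if n < 0 then 0 else 1)" using False by (simp add: nu_def)
    then have "LZi c n = bmono z (n - nu n)" using False by (simp add: LZi_def)
    then show ?thesis
      unfolding R V UE hU using False
      by (simp add: bmul_bscale_bmono UB bscale_B00 bmul_bmono_left
          lsh_bscale rsh_bscale bb lsh_rsh mult.commute)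
  qed
  then show "Psi 0 1 1 (Uhat z a) n \<kappa> s m = mm (Diag (LZi c)) (mm (Vmat a (pi/2)) (Diag L1)) n \<kappa> s m"
    by simp
qed

end

section \<open>Rotations of two coordinates\<close>

definition Rot :: "int \<Rightarrow> real \<Rightarrow> int \<Rightarrow> int \<Rightarrow> real" where
  "Rot b \<phi> n k = (if n = b then cos \<phi> * of_bool (k = b) + sin \<phi> * of_bool (k = b + 1)
     else if n = b + 1 then cos \<phi> * of_bool (k = b + 1) + (- sin \<phi>) * of_bool (k = b)
     else 1 * of_bool (k = n) + 0 * of_bool (k = n))"

lemma Rot_has_sum: "((\<lambda>l. Rot b \<phi> n l * f l) has_sum
    (if n = b then cos \<phi> * f b + sin \<phi> * f (b + 1)
     else if n = b + 1 then cos \<phi> * f (b + 1) + (- sin \<phi>) * f b else 1 * f n + 0 * f n)) UNIV"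
proof (cases "n = b")
  case True
  then show ?thesis using two_point_has_sum[of "cos \<phi>" b "sin \<phi>" "b + 1" f] by (simp add: Rot_def)
next
  case n: False
  show ?thesis
  proof (cases "n = b + 1")
    case True
    then show ?thesis using two_point_has_sum[of "cos \<phi>" "b + 1" "- sin \<phi>" b f] by (simp add: Rot_def)
  next
    case False
    then show ?thesis using n two_point_has_sum[of 1 n 0 n f] by (simp add: Rot_def)
  qed
qed

lemma Rot_mult_has_sum: "((\<lambda>l. Rot b \<phi> n l * Rot b \<psi> l k) has_sum Rot b (\<phi> + \<psi>) n k) UNIV"
proof -
  have "(if n = b then cos \<phi> * Rot b \<psi> b k + sin \<phi> * Rot b \<psi> (b + 1) k
     else if n = b + 1 then cos \<phi> * Rot b \<psi> (b + 1) k + (- sin \<phi>) * Rot b \<psi> b k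
     else 1 * Rot b \<psi> n k + 0 * Rot b \<psi> n k) = Rot b (\<phi> + \<psi>) n k"
    by (auto simp: Rot_def cos_add sin_add algebra_simps)
  then show ?thesis using Rot_has_sum[of b \<phi> n "\<lambda>l. Rot b \<psi> l k"] by simp
qed

lemma Rot_0: "Rot b 0 = id_mat"
  by (intro ext) (auto simp: Rot_def id_mat_def)

lemma rm_Rot: "rm (Rot b \<phi>) (Rot b \<psi>) = Rot b (\<phi> + \<psi>)"
  using Rot_mult_has_sum by (intro ext) (simp add: rm_def infsumI)

lemma Aprime_ix:
  "Aprime (1/2) \<theta> (ix 0 n) (ix 0 k) = Rot 0 (\<theta>/2) n k"
  "Aprime (-1/2) \<theta> (ix 0 n) (ix 0 k) = Rot (-1) (\<theta>/2) n k"
  by (auto simp: Aprime_def Rot_def ix_def)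

lemma rho_Even_0: "rho \<theta> n \<kappa> (Even, 0) = Rot 0 (\<theta>/2) n \<kappa>"
proof -
  consider "n \<ge> 2" | "n = 1" | "n = 0" "\<kappa> \<ge> 1" | "n = 0" "\<kappa> \<le> 0" | "n \<le> -1" by linarith
  then show ?thesis
  proof cases
    case 1
    then have "rhoe \<theta> n \<kappa> 0 = rho_pos \<theta> n \<kappa> (0 + \<kappa> - n)" by (intro rhoe_nonneg) auto
    then show ?thesis using 1 by (auto simp: rho_def rho_pos_def Rot_def)
  next
    case 2
    then have "rhoe \<theta> n \<kappa> 0 = rho_pos \<theta> n \<kappa> (0 + \<kappa> - n)" by (intro rhoe_nonneg) auto
    then show ?thesis using 2 by (auto simp: rho_def rho_pos_def Rot_def)
  next
    case 3
    then have "rhoe \<theta> n \<kappa> 0 = rho_pos \<theta> n \<kappa> (0 + \<kappa> - n)" by (intro rhoe_nonneg) auto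
    then show ?thesis using 3 by (auto simp: rho_def rho_pos_def Rot_def)
  next
    case 4
    then have "rhoe \<theta> n \<kappa> 0 = rho_pos \<theta> (- n) (1 - \<kappa>) (- (0 + \<kappa> - n))" by (intro rhoe_neg) auto
    then show ?thesis using 4 by (auto simp: rho_def rho_pos_def Rot_def)
  next
    case 5
    then have "rhoe \<theta> n \<kappa> 0 = rho_pos \<theta> (- n) (1 - \<kappa>) (- (0 + \<kappa> - n))" by (intro rhoe_neg) auto
    then show ?thesis using 5 by (auto simp: rho_def rho_pos_def Rot_def)
  qed
qed

lemma rho_Even_m1: "rho \<theta> n \<kappa> (Even, -1) = Rot (-1) (- (\<theta>/2)) n (\<kappa> - 1)"
proof -
  consider "n \<ge> 1" | "n = 0" "\<kappa> \<ge> 1" | "n = 0" "\<kappa> \<le> 0" | "n = -1" | "n \<le> -2" by linarith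
  then show ?thesis
  proof cases
    case 1
    then have "rhoe \<theta> n \<kappa> (-1) = rho_pos \<theta> n \<kappa> (-1 + \<kappa> - n)" by (intro rhoe_nonneg) auto
    then show ?thesis using 1 by (auto simp: rho_def rho_pos_def Rot_def)
  next
    case 2
    then have "rhoe \<theta> n \<kappa> (-1) = rho_pos \<theta> n \<kappa> (-1 + \<kappa> - n)" by (intro rhoe_nonneg) auto
    then show ?thesis using 2 by (auto simp: rho_def rho_pos_def Rot_def)
  next
    case 3
    then have "rhoe \<theta> n \<kappa> (-1) = rho_pos \<theta> (- n) (1 - \<kappa>) (- (-1 + \<kappa> - n))" by (intro rhoe_neg) auto
    then show ?thesis using 3 by (auto simp: rho_def rho_pos_def Rot_def)
  next
    case 4
    then have "rhoe \<theta> n \<kappa> (-1) = rho_pos \<theta> (- n) (1 - \<kappa>) (- (-1 + \<kappa> - n))" by (intro rhoe_neg) auto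
    then show ?thesis using 4 by (auto simp: rho_def rho_pos_def Rot_def)
  next
    case 5
    then have "rhoe \<theta> n \<kappa> (-1) = rho_pos \<theta> (- n) (1 - \<kappa>) (- (-1 + \<kappa> - n))" by (intro rhoe_neg) auto
    then show ?thesis using 5 by (auto simp: rho_def rho_pos_def Rot_def)
  qed
qed

context loop_algebra
begin

section \<open>Rapidly decreasing matrices\<close>

definition rap :: "(int \<Rightarrow> int \<Rightarrow> 'a series) \<Rightarrow> bool" where
  "rap X \<longleftrightarrow> (\<forall>n k g. ev (X n k) g \<in> Hg g) \<and>
     (\<forall>p N. continuous_seminorm p \<longrightarrow> (\<exists>C\<ge>0. \<forall>n k g.
        (1 + \<bar>real_of_int n\<bar>) ^ N * (1 + \<bar>real_of_int k\<bar>) ^ N * (1 + gsz g) ^ N * p (ev (X n k) g) \<le> C))"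

lemma rapD:
  assumes "rap X" "continuous_seminorm p"
  obtains C where "0 \<le> C"
    "\<And>n k g. (1 + \<bar>real_of_int n\<bar>) ^ N * (1 + \<bar>real_of_int k\<bar>) ^ N * (1 + gsz g) ^ N * p (ev (X n k) g) \<le> C"
  using assms unfolding rap_def by metis

lemma rap_mm:
  assumes X: "rap X" and tX: "tm X" and Y: "tm Y"
  shows "rap (mm X Y)"
  unfolding rap_def
proof (intro conjI allI impI)
  show "ev (mm X Y n k) g \<in> Hg g" for n k g by (rule mm_has_sum(2)[OF tX Y])
  obtain M where M: "(\<lambda>i. 1 / (1 + lsz i) ^ M) summable_on UNIV"
    using poly_size_summable[OF poly_size_lsz] by blast
  have S: "0 \<le> (\<Sum>\<^sub>\<infinity>i. 1 / (1 + lsz i) ^ M)"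
    by (rule infsum_nonneg) (auto simp: case_prod_unfold)
  fix p :: "'a \<Rightarrow> real" and N assume p: "continuous_seminorm p"
  from cs_mult_bound[OF p] obtain q where q: "continuous_seminorm q" "\<And>x y. p (x * y) \<le> q x * q y" by metis
  from tm_row[OF Y q(1), where N = "N + M"] obtain K C1 where 1: "0 \<le> C1"
    "\<And>l k g. (1 + \<bar>real_of_int k\<bar>) ^ (N + M) * (1 + gsz g) ^ (N + M) * q (ev (Y l k) g) \<le> C1 * (1 + \<bar>real_of_int l\<bar>) ^ K" by metis
  from rapD[OF X q(1), where N = "K + N + M"] obtain C2 where 2: "0 \<le> C2"
    "\<And>n l g. (1 + \<bar>real_of_int n\<bar>) ^ (K + N + M) * (1 + \<bar>real_of_int l\<bar>) ^ (K + N + M) * (1 + gsz g) ^ (K + N + M) * q (ev (X n l) g) \<le> C2" by metis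
  have B: "(1 + \<bar>real_of_int n\<bar>) ^ N * (1 + \<bar>real_of_int k\<bar>) ^ N * (1 + gsz u) ^ N * (1 + lsz i) ^ M * p (mterm X Y n k u i) \<le> C1 * C2" for n k u i
  proof -
    obtain l g where i: "i = (l, g)" by (cases i)
    define w a b s t where "w = 1 + \<bar>real_of_int n\<bar>" "a = 1 + \<bar>real_of_int k\<bar>" "b = 1 + \<bar>real_of_int l\<bar>" "s = 1 + gsz (gm (gi g) u)" "t = 1 + gsz g"
    note d = w_a_b_s_t_def
    have sz: "1 + gsz u \<le> s * t" "1 + lsz i \<le> b * s * t"
      using mterm_sizes(1)[where g = g and u = u] mterm_sizes(2)[where g = g and u = u and l = l] by (simp_all add: d i mult_ac)
    have "w ^ N * a ^ N * (1 + gsz u) ^ N * (1 + lsz i) ^ M * p (mterm X Y n k u i)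
       \<le> w ^ N * a ^ N * (s * t) ^ N * (b * s * t) ^ M * (q (ev (X n l) g) * q (ev (Y l k) (gm (gi g) u)))"
      using sz q(2)[of "ev (X n l) g" "ev (Y l k) (gm (gi g) u)"]
      by (intro mult_mono power_mono) (auto simp: i mterm_def d cs_nonneg[OF p])
    also have "\<dots> = a ^ N * (s * t) ^ N * (b * s * t) ^ M * (q (ev (Y l k) (gm (gi g) u)) * (w ^ N * q (ev (X n l) g)))"
      by (simp add: mult_ac)
    also have "\<dots> \<le> C1 * C2 * 1"
    proof (rule tempered_product_bound[where ?N1.0 = "N + M" and ?N2.0 = "K + N + M" and ?K1.0 = K])
      show "a ^ (N + M) * s ^ (N + M) * q (ev (Y l k) (gm (gi g) u)) \<le> C1 * b ^ K"
        unfolding d by (rule 1)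
      have "w ^ N * (b ^ (K + N + M) * t ^ (K + N + M) * q (ev (X n l) g))
         \<le> w ^ (K + N + M) * (b ^ (K + N + M) * t ^ (K + N + M) * q (ev (X n l) g))"
        by (intro mult_right_mono power_increasing mult_nonneg_nonneg) (auto simp: d cs_nonneg[OF q(1)])
      also have "\<dots> \<le> C2" using 2(2)[of n l g] by (simp add: d mult_ac)
      finally show "b ^ (K + N + M) * t ^ (K + N + M) * (w ^ N * q (ev (X n l) g)) \<le> C2 * 1"
        by (simp add: mult_ac)
    qed (use 1(1) in \<open>auto simp: d cs_nonneg[OF q(1)]\<close>)
    finally show ?thesis by (simp add: d)
  qed
  have "(1 + \<bar>real_of_int n\<bar>) ^ N * (1 + \<bar>real_of_int k\<bar>) ^ N * (1 + gsz g) ^ N * p (ev (mm X Y n k) g)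
      \<le> C1 * C2 * (\<Sum>\<^sub>\<infinity>i. 1 / (1 + lsz i) ^ M)" for n k g
    by (rule mm_cs_le[OF tX Y p M _ B]) (auto intro!: mult_pos_pos zero_less_power add_pos_nonneg)
  then show "\<exists>C\<ge>0. \<forall>n k g. (1 + \<bar>real_of_int n\<bar>) ^ N * (1 + \<bar>real_of_int k\<bar>) ^ N * (1 + gsz g) ^ N * p (ev (mm X Y n k) g) \<le> C"
    using 1(1) 2(1) S by (intro exI[of _ "C1 * C2 * (\<Sum>\<^sub>\<infinity>i. 1 / (1 + lsz i) ^ M)"]) auto
qed

lemma rap_gscale:
  assumes b: "b \<in> B00 A z" and r: "\<And>n k g. \<bar>\<rho> n k g\<bar> \<le> R"
    and s: "\<And>n k g. \<rho> n k g \<noteq> 0 \<Longrightarrow> \<bar>real_of_int n\<bar> + \<bar>real_of_int k\<bar> \<le> gsz g + 5"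
  shows "rap (\<lambda>n k. gscale (\<rho> n k) b)"
  unfolding rap_def
proof (intro conjI allI impI)
  show "ev (gscale (\<rho> n k) b) g \<in> Hg g" for n k g
    by (simp add: ev_gscale Hg_scale B00_ev[OF b])
  fix p :: "'a \<Rightarrow> real" and N assume p: "continuous_seminorm p"
  from B00_bound[OF b p] obtain C where C: "0 \<le> C" "\<And>g. (1 + gsz g) ^ (N + N + N) * p (ev b g) \<le> C" by blast
  have R: "0 \<le> R" using r[of 0 0 undefined] by linarith
  have "(1 + \<bar>real_of_int n\<bar>) ^ N * (1 + \<bar>real_of_int k\<bar>) ^ N * (1 + gsz g) ^ N * p (ev (gscale (\<rho> n k) b) g)
      \<le> 6 ^ N * 6 ^ N * R * C" for n k g
  proof (cases "\<rho> n k g = 0")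
    case True
    then show ?thesis using R C(1) by (simp add: ev_gscale cs_zero[OF p])
  next
    case False
    define y where "y = 1 + gsz g"
    have y: "1 \<le> y" by (simp add: y_def)
    have n6: "1 + \<bar>real_of_int n\<bar> \<le> 6 * y"
      unfolding y_def using s[OF False] gsz_nonneg[of g] by argo
    have k6: "1 + \<bar>real_of_int k\<bar> \<le> 6 * y"
      unfolding y_def using s[OF False] gsz_nonneg[of g] by argo
    note sz = n6 k6
    have "(1 + \<bar>real_of_int n\<bar>) ^ N * (1 + \<bar>real_of_int k\<bar>) ^ N * y ^ N * p (ev (gscale (\<rho> n k) b) g)
      \<le> (6 * y) ^ N * (6 * y) ^ N * y ^ N * (R * p (ev b g))"
      using sz y r[of n k g] by (intro mult_mono power_mono) (auto simp: ev_gscale cs_scale[OF p] cs_nonneg[OF p] mult_right_mono)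
    also have "\<dots> = 6 ^ N * 6 ^ N * R * (y ^ (N + N + N) * p (ev b g))"
      by (simp add: power_mult_distrib power_add mult_ac)
    also have "\<dots> \<le> 6 ^ N * 6 ^ N * R * C"
      using C R unfolding y_def by (intro mult_left_mono) auto
    finally show ?thesis by (simp add: y_def)
  qed
  then show "\<exists>C\<ge>0. \<forall>n k g. (1 + \<bar>real_of_int n\<bar>) ^ N * (1 + \<bar>real_of_int k\<bar>) ^ N * (1 + gsz g) ^ N * p (ev (gscale (\<rho> n k) b) g) \<le> C"
    using R C(1) by (intro exI[of _ "6 ^ N * 6 ^ N * R * C"]) auto
qed

lemma rap_add:
  assumes X: "rap X" and Y: "rap Y" shows "rap (\<lambda>n k. X n k + Y n k)"
  unfolding rap_def
proof (intro conjI allI impI)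
  show "ev (X n k + Y n k) g \<in> Hg g" for n k g
    using X Y by (simp add: ev_add Hg_add rap_def)
  fix p :: "'a \<Rightarrow> real" and N assume p: "continuous_seminorm p"
  let ?w = "\<lambda>n k g. (1 + \<bar>real_of_int n\<bar>) ^ N * (1 + \<bar>real_of_int k\<bar>) ^ N * (1 + gsz g) ^ N"
  from rapD[OF X p, where N = N] obtain C where C: "0 \<le> C" "\<And>n k g. ?w n k g * p (ev (X n k) g) \<le> C" by metis
  from rapD[OF Y p, where N = N] obtain D where D: "0 \<le> D" "\<And>n k g. ?w n k g * p (ev (Y n k) g) \<le> D" by metis
  have "?w n k g * p (ev (X n k + Y n k) g) \<le> C + D" for n k g
  proof -
    have "?w n k g * p (ev (X n k + Y n k) g) \<le> ?w n k g * (p (ev (X n k) g) + p (ev (Y n k) g))"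
      by (intro mult_left_mono) (auto simp: ev_add cs_triangle[OF p])
    then show ?thesis using C(2)[of n k g] D(2)[of n k g] by (simp add: distrib_left)
  qed
  then show "\<exists>C\<ge>0. \<forall>n k g. ?w n k g * p (ev (X n k + Y n k) g) \<le> C"
    using C(1) D(1) by (intro exI[of _ "C + D"]) auto
qed

lemma rapidly_decreasing_matI:
  assumes X: "rap (Psi 0 0 0 M)"
  shows "rapidly_decreasing_mat A z M"
  unfolding rapidly_decreasing_mat_def ZZ_ix
proof (intro conjI ballI allI impI; (elim rangeE; simp only: )?)
  fix n k
  have "Psi 0 0 0 M n k \<in> B00 A z"
    unfolding B00_iff rapid_fam_def
  proof (intro conjI allI impI)
    show "ev (Psi 0 0 0 M n k) g \<in> Hg g" for g using X by (simp add: rap_def)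
    fix p :: "'a \<Rightarrow> real" and N assume p: "continuous_seminorm p"
    from rapD[OF X p, where N = N] obtain C where
      C: "\<And>n k g. (1 + \<bar>real_of_int n\<bar>) ^ N * (1 + \<bar>real_of_int k\<bar>) ^ N * (1 + gsz g) ^ N * p (ev (Psi 0 0 0 M n k) g) \<le> C" by metis
    have "(1 + gsz g) ^ N * p (ev (Psi 0 0 0 M n k) g) \<le> C" for g
    proof -
      have "1 * 1 * ((1 + gsz g) ^ N * p (ev (Psi 0 0 0 M n k) g))
        \<le> (1 + \<bar>real_of_int n\<bar>) ^ N * (1 + \<bar>real_of_int k\<bar>) ^ N * ((1 + gsz g) ^ N * p (ev (Psi 0 0 0 M n k) g))"
        by (intro mult_right_mono mult_mono one_le_power mult_nonneg_nonneg) (auto simp: cs_nonneg[OF p])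
      then show ?thesis using C[of n k g] by (simp add: mult.assoc)
    qed
    then show "\<exists>C. \<forall>g\<in>UNIV. (1 + gsz g) ^ N * p (ev (Psi 0 0 0 M n k) g) \<le> C" by blast
  qed
  then show "M (ix 0 n) (ix 0 k) \<in> B00 A z"
    by (subst entry_Psi[of _ _ _ _ _ 0]) simp
next
  fix p :: "'a \<Rightarrow> real" and N K :: nat assume p: "continuous_seminorm p"
  let ?L = "max N K"
  from rapD[OF X p, where N = ?L] obtain C where
    C: "\<And>n k g. (1 + \<bar>real_of_int n\<bar>) ^ ?L * (1 + \<bar>real_of_int k\<bar>) ^ ?L * (1 + gsz g) ^ ?L * p (ev (Psi 0 0 0 M n k) g) \<le> C" by metis
  have "(1 + \<bar>ix 0 n\<bar> + \<bar>ix 0 k\<bar>) ^ K * bnorm p N (zconj z 0 0 0 1 M (ix 0 n) (ix 0 k)) \<le> C" for n k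
  proof -
    let ?w = "1 + \<bar>real_of_int n\<bar> + \<bar>real_of_int k\<bar>"
    have w: "0 < ?w ^ K" by (intro zero_less_power) linarith
    have "(1 + gsz g) ^ N * p (ev (Psi 0 0 0 M n k) g) \<le> C / ?w ^ K" for g
    proof -
      have "0 \<le> \<bar>real_of_int n\<bar> * \<bar>real_of_int k\<bar>" by simp
      moreover have "(1 + \<bar>real_of_int n\<bar>) * (1 + \<bar>real_of_int k\<bar>) = ?w + \<bar>real_of_int n\<bar> * \<bar>real_of_int k\<bar>"
        by (simp add: algebra_simps)
      ultimately have "?w \<le> (1 + \<bar>real_of_int n\<bar>) * (1 + \<bar>real_of_int k\<bar>)" by linarith
      then have "?w ^ K \<le> (1 + \<bar>real_of_int n\<bar>) ^ K * (1 + \<bar>real_of_int k\<bar>) ^ K"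
        by (rule pow_shift_bound) simp
      also have "\<dots> \<le> (1 + \<bar>real_of_int n\<bar>) ^ ?L * (1 + \<bar>real_of_int k\<bar>) ^ ?L"
        by (intro mult_mono power_increasing) auto
      finally have "?w ^ K * ((1 + gsz g) ^ N * p (ev (Psi 0 0 0 M n k) g))
        \<le> (1 + \<bar>real_of_int n\<bar>) ^ ?L * (1 + \<bar>real_of_int k\<bar>) ^ ?L * ((1 + gsz g) ^ ?L * p (ev (Psi 0 0 0 M n k) g))"
        by (intro mult_mono power_increasing) (auto simp: cs_nonneg[OF p])
      also have "\<dots> \<le> C" using C[of n k g] by (simp add: mult.assoc)
      finally show ?thesis using w by (simp add: pos_le_divide_eq mult.commute)
    qed
    then have "bnorm p N (Psi 0 0 0 M n k) \<le> C / ?w ^ K" by (rule bnorm_least)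
    then show ?thesis
      unfolding zconj_Psi_00 using w by (simp add: ix_def pos_le_divide_eq mult.commute)
  qed
  then show "\<exists>C. \<forall>n\<in>range (ix 0). \<forall>k\<in>range (ix 0). (1 + \<bar>n\<bar> + \<bar>k\<bar>) ^ K * bnorm p N (zconj z 0 0 0 1 M n k) \<le> C"
    by auto
qed

section \<open>The matrix of the theorem\<close>

lemma mm_add_left:
  assumes "tm X" "tm X'" "tm Z" "tm Y" "\<And>n k. Z n k = X n k + X' n k"
  shows "mm Z Y n k = mm X Y n k + mm X' Y n k"
proof (rule ev_eqI)
  fix u
  have "((\<lambda>i. mterm X Y n k u i + mterm X' Y n k u i) has_sum (ev (mm X Y n k) u + ev (mm X' Y n k) u)) UNIV"
    by (intro has_sum_add mm_has_sum assms)
  moreover have "mterm X Y n k u i + mterm X' Y n k u i = mterm Z Y n k u i" for i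
    by (simp add: mterm_def case_prod_unfold assms(5) ev_add distrib_right)
  ultimately show "ev (mm Z Y n k) u = ev (mm X Y n k + mm X' Y n k) u"
    using mm_has_sum(1)[OF assms(3,4), of n k u] by (simp add: ev_add has_sum_unique)
qed

lemma mm_support:
  assumes "tm X" "tm Y" "\<And>l g h. ev (X n l) g \<noteq> 0 \<Longrightarrow> ev (Y l k) h \<noteq> 0 \<Longrightarrow> gm g h \<in> S" "u \<notin> S"
  shows "ev (mm X Y n k) u = 0"
proof -
  have "mterm X Y n k u i = 0" for i
  proof (rule ccontr)
    assume "mterm X Y n k u i \<noteq> 0"
    then have "ev (X n (fst i)) (snd i) \<noteq> 0" "ev (Y (fst i) k) (gm (gi (snd i)) u) \<noteq> 0"
      by (auto simp: mterm_def case_prod_unfold)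
    from assms(3)[OF this] show False using assms(4) by simp
  qed
  then have "mterm X Y n k u = (\<lambda>_. 0)" by (intro ext)
  then show ?thesis using mm_has_sum(1)[OF assms(1,2), of n k u] by (metis has_sum_0_simp has_sum_unique)
qed

lemma two_diagonals:
  assumes E: "E \<in> B00 A z" and 0: "\<And>m. m \<noteq> 0 \<Longrightarrow> m \<noteq> -1 \<Longrightarrow> E Even m = 0" "\<And>m. m \<noteq> 0 \<Longrightarrow> m \<noteq> 1 \<Longrightarrow> E Odd m = 0"
  shows "\<exists>u\<in>A Even. \<exists>v\<in>A Odd. \<exists>u'\<in>A Even. \<exists>v'\<in>A Odd.
    E = hmul z 0 (embA u v) (hpow z 0 1 (1/2)) + hmul z 0 (embA u' v') (hpow z 0 1 (-1/2))"
proof -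
  have "hpow z 0 1 (1/2) = bmono z 0" "hpow z 0 1 (-1/2) = bmono z (-1)"
    by (simp_all add: hpow_def)
  then have h: "hmul z 0 b (hpow z 0 1 (1/2)) = b" "hmul z 0 b (hpow z 0 1 (-1/2)) = rsh (-1) b" for b
    by (simp_all add: hmul_alt bmul_bmono_right)
  have m: "E s m \<in> Hg (s, m)" for s m using B00_ev[OF E, of "(s, m)"] by simp
  have u: "E Even 0 \<in> A Even" "E Odd 0 \<in> A Odd"
    using m[of Even 0] m[of Odd 0] by (simp_all add: Hg_iff)
  have "zpow z 1 * E Even (-1) \<in> A Even" "zpow z (-1) * E Odd 1 \<in> A Odd"
    using m[of Even "-1"] m[of Odd 1] by (simp_all add: Hg_iff)
  from zpow_conj_Even[OF this(1), of "-1"] zpow_conj_Odd[OF this(2), of 1]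
  have u': "E Even (-1) * zpow z 1 \<in> A Even" "E Odd 1 * zpow z 1 \<in> A Odd"
    by (simp_all add: mult.assoc[symmetric] flip: zpow_add)
  have "E = embA (E Even 0) (E Odd 0) + rsh (-1) (embA (E Even (-1) * zpow z 1) (E Odd 1 * zpow z 1))"
  proof (intro ext)
    fix s m
    have zz: "x * zpow z 1 * zpow z (-1) = x" for x by (simp add: mult.assoc)
    show "E s m = (embA (E Even 0) (E Odd 0) + rsh (-1) (embA (E Even (-1) * zpow z 1) (E Odd 1 * zpow z 1))) s m"
      using 0[of m] by (cases s; cases "m = 0"; cases "m = 1"; cases "m = -1") (auto simp: embA_def rsh_def zz)
  qed
  then show ?thesis unfolding h using u u' by blast
qed

lemma Tw_product:
  assumes L: "\<And>n. L n \<in> B00 A z" and X: "\<And>n k. ((\<lambda>l. X n l * Y l k) has_sum E n k) UNIV"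
  shows "mm (mm (Diag L) (\<lambda>n k. bscale (X n k) (bmono z (n - k)))) (\<lambda>n k. bscale (Y n k) (bmono z (n - k))) n k
    = bscale (E n k) (rsh (n - k) (L n))"
proof (intro ext)
  fix s m
  have t: "bmul (mm (Diag L) (\<lambda>n k. bscale (X n k) (bmono z (n - k))) n l) (bscale (Y l k) (bmono z (l - k))) s m
    = (X n l * Y l k) *\<^sub>R rsh (n - k) (L n) s m" for l
  proof -
    have "bmul (mm (Diag L) (\<lambda>n k. bscale (X n k) (bmono z (n - k))) n l) (bscale (Y l k) (bmono z (l - k)))
      = bscale (Y l k) (bscale (X n l) (rsh (n - k) (L n)))"
      by (simp add: mm_Diag_left bmul_bscale_bmono L bscale_B00 rsh_bscale rsh_rsh)
    then show ?thesis by (simp add: bscale_def mult.commute)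
  qed
  show "mm (mm (Diag L) (\<lambda>n k. bscale (X n k) (bmono z (n - k)))) (\<lambda>n k. bscale (Y n k) (bmono z (n - k))) n k s m
    = bscale (E n k) (rsh (n - k) (L n)) s m"
    using has_sum_scaleR_elem[OF X[of n k], of "rsh (n - k) (L n) s m"]
    unfolding mm_def[of "mm _ _"] t by (simp add: infsumI bscale_def)
qed

lemma tm_emb_Rot: "tm (emb (Rot b \<phi>))"
proof (rule tm_emb_band[where R = 2])
  show "\<bar>Rot b \<phi> n k\<bar> \<le> 2" for n k
    using abs_cos_le_one[of \<phi>] abs_sin_le_one[of \<phi>] by (auto simp: Rot_def simp del: abs_cos_le_one abs_sin_le_one)
  show "Rot b \<phi> n k \<noteq> 0 \<Longrightarrow> \<bar>n - k\<bar> \<le> 1" for n k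
    by (cases "k = b"; cases "k = b + 1") (auto simp: Rot_def split: if_splits)
qed

lemma rinv_Rot:
  assumes "\<And>n k. M (ix 0 n) (ix 0 k) = Rot b \<phi> n k"
  shows "rinv 0 M (ix 0 n) (ix 0 k) = Rot b (- \<phi>) n k"
proof -
  have M: "(\<lambda>n k. M (ix 0 n) (ix 0 k)) = Rot b \<phi>" using assms by (intro ext)
  show ?thesis
    by (rule rinvI) (simp_all add: M tm_emb_Rot rm_Rot Rot_0)
qed

end

locale invertible_loop = loop_algebra +
  fixes a c
  assumes a: "a \<in> B00 A z" and c: "c \<in> B00 A z"
    and ac: "bmul a c = bmono z 0" and ca: "bmul c a = bmono z 0"
begin

lemmas tms = tm_Vmat[OF a] tm_Vinv[OF c] tm_L(1,2) tm_L(3)[OF a] tm_L(4)[OF c]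

lemma mm_cancel_middle:
  assumes "tm X" "tm Y" "tm Y'" "tm Z" "mm Y Y' = one_mat"
  shows "mm (mm X Y) (mm Y' Z) = mm X Z"
proof -
  have "mm (mm X Y) (mm Y' Z) = mm X (mm (mm Y Y') Z)"
    by (simp only: mm_assoc assms(1-4) tm_mm)
  then show ?thesis by (simp add: assms(5))
qed

lemma minv_Uhat:
  shows "is_minv A z 0 1 1 (Uhat z a) (minv A z 0 1 1 (Uhat z a))"
    "Psi 1 0 1 (minv A z 0 1 1 (Uhat z a)) = mm (Diag L1i) (mm (Vinv c) (Diag (LZ a)))"
proof -
  let ?V = "Vmat a (pi/2)" and ?W = "Vinv c"
  let ?H = "mm (Diag (LZi c)) (mm ?V (Diag L1))" and ?Y = "mm (Diag L1i) (mm ?W (Diag (LZ a)))"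
  have "mm ?H ?Y = mm (Diag (LZi c)) (mm (mm ?V (Diag L1)) (mm (Diag L1i) (mm ?W (Diag (LZ a)))))"
    by (simp only: mm_assoc tms tm_mm)
  also have "\<dots> = mm (Diag (LZi c)) (mm (mm ?V ?W) (Diag (LZ a)))"
    by (simp only: mm_cancel_middle[OF tms(1,3,4) tm_mm[OF tms(2,5)] L_inverse(1)] mm_assoc tms)
  also have "\<dots> = one_mat"
    by (simp add: Vmat_Vinv[OF a c ac] L_inverse(4)[OF ca])
  finally have HY: "mm ?H ?Y = one_mat" .
  have "mm ?Y ?H = mm (mm (mm (Diag L1i) ?W) (Diag (LZ a))) (mm (Diag (LZi c)) (mm ?V (Diag L1)))"
    by (simp only: mm_assoc tms tm_mm)
  also have "\<dots> = mm (mm (Diag L1i) ?W) (mm ?V (Diag L1))"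
    by (rule mm_cancel_middle[OF tm_mm[OF tms(4,2)] tms(5,6) tm_mm[OF tms(1,3)] L_inverse(3)[OF ac]])
  also have "\<dots> = mm (Diag L1i) (Diag L1)"
    by (rule mm_cancel_middle[OF tms(4,2,1,3) Vinv_Vmat[OF a c ca]])
  also have "\<dots> = one_mat" by (rule L_inverse(2))
  finally have YH: "mm ?Y ?H = one_mat" .
  have H: "Psi 0 1 1 (Uhat z a) = ?H" by (rule Psi_Uhat[OF a c ca])
  have tH: "tm (Psi 0 1 1 (Uhat z a))" and tY: "tm ?Y"
    unfolding H by (intro tm_mm tms)+
  show "is_minv A z 0 1 1 (Uhat z a) (minv A z 0 1 1 (Uhat z a))"
    "Psi 1 0 1 (minv A z 0 1 1 (Uhat z a)) = mm (Diag L1i) (mm (Vinv c) (Diag (LZ a)))"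
    using minvI[OF _ _ _ tH tY] HY YH unfolding H by simp_all
qed

lemma Psi_product_with_inverse:
  assumes M: "Psi 0 1 0 M = Vmat a \<theta>"
  shows "Psi 0 0 0 (mmul z 1 1 (mmul z 1 0 M (Lmat1 z)) (minv A z 0 1 1 (Uhat z a)))
    = mm (mm (Vmat a \<theta>) (Vinv c)) (Diag (LZ a))"
proof -
  have 1: "Psi 0 1 0 (mmul z 1 0 M (Lmat1 z)) = mm (Vmat a \<theta>) (Diag L1)"
    using mmul_Psi_tm[of 0 1 0 M 1 0 "Lmat1 z"] tms by (simp add: M Psi_Lmat1)
  have tmY: "tm (mm (Diag L1i) (mm (Vinv c) (Diag (LZ a))))" by (intro tm_mm tms)
  have "Psi 0 0 0 (mmul z 1 1 (mmul z 1 0 M (Lmat1 z)) (minv A z 0 1 1 (Uhat z a)))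
    = mm (mm (Vmat a \<theta>) (Diag L1)) (mm (Diag L1i) (mm (Vinv c) (Diag (LZ a))))"
    using mmul_Psi_tm[of 0 1 0 "mmul z 1 0 M (Lmat1 z)" 0 1 "minv A z 0 1 1 (Uhat z a)"] tm_mm[OF tms(1,3)] tmY
    by (simp add: 1 minv_Uhat(2))
  also have "\<dots> = mm (mm (Vmat a \<theta>) (Vinv c)) (Diag (LZ a))"
    by (simp only: mm_cancel_middle[OF tms(1,3,4) tm_mm[OF tms(2,5)] L_inverse(1)] mm_assoc tms)
  finally show ?thesis .
qed

lemma Psi_Nmat: "Psi 0 0 0 (Nmat A z a \<theta>) = mm (mm (Vmat a \<theta>) (Vinv c)) (Diag (LZ a))"
  unfolding Nmat_def by (rule Psi_product_with_inverse[OF Psi_Udef[OF a]])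

lemma tm_N: "tm (Psi 0 0 0 (Nmat A z a \<theta>))"
  unfolding Psi_Nmat by (intro tm_mm tms)

lemma minv_Udef:
  shows "is_minv A z 0 1 0 (Udef z a (pi/2)) (minv A z 0 1 0 (Udef z a (pi/2)))"
    "Psi 1 0 0 (minv A z 0 1 0 (Udef z a (pi/2))) = Vinv c"
  using minvI[of 0 1 0 "Udef z a (pi/2)" "Vinv c"] tms Vmat_Vinv[OF a c ac] Vinv_Vmat[OF a c ca]
  by (simp_all add: Psi_Udef[OF a])

lemma N_two_expressions:
  "mat_eq 0 0 (Nmat A z a \<theta>)
     (mmul z 0 0 (mmul z 1 0 (Udef z a \<theta>) (minv A z 0 1 0 (Udef z a (pi/2)))) (Lmat z a))"
proof -
  have 1: "Psi 0 0 0 (mmul z 1 0 (Udef z a \<theta>) (minv A z 0 1 0 (Udef z a (pi/2)))) = mm (Vmat a \<theta>) (Vinv c)"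
    using mmul_Psi_tm[of 0 1 0 "Udef z a \<theta>" 0 0 "minv A z 0 1 0 (Udef z a (pi/2))"] tms
    by (simp add: Psi_Udef[OF a] minv_Udef(2))
  have "Psi 0 0 0 (mmul z 0 0 (mmul z 1 0 (Udef z a \<theta>) (minv A z 0 1 0 (Udef z a (pi/2)))) (Lmat z a))
     = mm (mm (Vmat a \<theta>) (Vinv c)) (Diag (LZ a))"
    using mmul_Psi_tm[of 0 0 0 "mmul z 1 0 (Udef z a \<theta>) (minv A z 0 1 0 (Udef z a (pi/2)))" 0 0 "Lmat z a"]
      tm_mm[OF tms(1,2)] tms by (simp add: 1 Psi_Lmat)
  then show ?thesis by (simp add: Psi_eq_iff[of 0 0 0, symmetric] Psi_Nmat)
qed

lemma N_rapid:
  "Nmat A z a \<theta> (ix 0 n) (ix 0 k) \<in> B00 A z"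
  "rapidly_decreasing_mat A z (Nmat A z a \<theta> - Lmat z 0)"
proof -
  show "Nmat A z a \<theta> (ix 0 n) (ix 0 k) \<in> B00 A z" by (rule tm_entry_B00[OF tm_N])
  define \<Delta> where "\<Delta> n \<kappa> = gscale (\<lambda>g. rho \<theta> n \<kappa> g - rho (pi/2) n \<kappa> g) a" for n \<kappa>
  have bd: "\<bar>rho \<theta> n \<kappa> g - rho (pi/2) n \<kappa> g\<bar> \<le> 2" for n \<kappa> g
    using rho_bound[of \<theta> n \<kappa> g] rho_bound[of "pi/2" n \<kappa> g] by linarith
  have rap\<Delta>: "rap \<Delta>"
    unfolding \<Delta>_def[abs_def] by (rule rap_gscale[OF a bd]) (rule rho_diff_support[of \<theta> _ _ _ "pi/2"], simp)
  have nz: "rho \<theta> n \<kappa> g \<noteq> 0 \<or> rho (pi/2) n \<kappa> g \<noteq> 0" if "rho \<theta> n \<kappa> g - rho (pi/2) n \<kappa> g \<noteq> 0" for n \<kappa> g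
    using that by auto
  have tm\<Delta>: "tm \<Delta>"
    unfolding \<Delta>_def[abs_def]
    by (rule tm_gscale[OF a bd]) (use nz rho_support in blast)+
  have "Vmat a \<theta> n \<kappa> = Vmat a (pi/2) n \<kappa> + \<Delta> n \<kappa>" for n \<kappa>
    by (rule ev_eqI) (simp add: Vmat_def \<Delta>_def ev_gscale ev_add scaleR_diff_left)
  then have 1: "mm (Vmat a \<theta>) (mm (Vinv c) (Diag (LZ a))) n k
     = mm (Vmat a (pi/2)) (mm (Vinv c) (Diag (LZ a))) n k + mm \<Delta> (mm (Vinv c) (Diag (LZ a))) n k" for n k
    by (intro mm_add_left tms tm\<Delta> tm_mm)
  have 2: "mm (Vmat a (pi/2)) (mm (Vinv c) (Diag (LZ a))) = Diag (LZ a)"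
    by (simp add: mm_assoc[symmetric] tms Vmat_Vinv[OF a c ac])
  have N: "Psi 0 0 0 (Nmat A z a \<theta>) n k = Diag (LZ a) n k + mm \<Delta> (mm (Vinv c) (Diag (LZ a))) n k" for n k
    by (simp only: Psi_Nmat mm_assoc tms 1 2)
  define Z where "Z n k = gscale (\<lambda>g. of_bool (n = 0 \<and> k = 0)) a" for n k :: int
  have rapZ: "rap Z"
    unfolding Z_def[abs_def] by (rule rap_gscale[OF a, where R = 1]) (auto intro: add_nonneg_nonneg)
  have "Psi 0 0 0 (Nmat A z a \<theta> - Lmat z 0) n k = Z n k + mm \<Delta> (mm (Vinv c) (Diag (LZ a))) n k" for n k
  proof -
    have "Psi 0 0 0 (Nmat A z a \<theta> - Lmat z 0) n k = Psi 0 0 0 (Nmat A z a \<theta>) n k - Psi 0 0 0 (Lmat z 0) n k"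
      by (auto simp: Psi_def lsh_def rsh_def fun_eq_iff algebra_simps)
    moreover have "Diag (LZ a) n k - Diag (LZ 0) n k = Z n k"
      by (auto simp: Diag_def LZ_def Z_def gscale_def fun_eq_iff)
    ultimately show ?thesis unfolding N Psi_Lmat by (simp add: algebra_simps)
  qed
  then have "Psi 0 0 0 (Nmat A z a \<theta> - Lmat z 0) = (\<lambda>n k. Z n k + mm \<Delta> (mm (Vinv c) (Diag (LZ a))) n k)"
    by (intro ext) simp
  moreover have "rap \<dots>"
    by (intro rap_add rapZ rap_mm rap\<Delta> tm\<Delta> tm_mm tms)
  ultimately show "rapidly_decreasing_mat A z (Nmat A z a \<theta> - Lmat z 0)"
    by (intro rapidly_decreasing_matI) simp
qed

lemma N_half_pi: "mat_eq 0 0 (Nmat A z a (pi/2)) (Lmat z a)"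
  by (simp add: Psi_eq_iff[of 0 0 0, symmetric] Psi_Nmat Psi_Lmat Vmat_Vinv[OF a c ac])

lemma N_zero:
  "mat_eq 0 0 (Nmat A z a 0) (mmul z 1 1 (mmul z 1 0 (Umat z 0 a) (Lmat1 z)) (minv A z 0 1 1 (Uhat z a)))"
proof -
  have "Psi 0 1 0 (Umat z 0 a) = Vmat a 0"
    by (intro ext) (simp add: Psi_Umat Vmat_def rho_zero[abs_def])
  from Psi_product_with_inverse[OF this] show ?thesis
    by (simp add: Psi_eq_iff[of 0 0 0, symmetric] Psi_Nmat)
qed

lemma Vinv_LZ_support:
  assumes "ev (mm (Vinv c) (Diag (LZ a)) \<kappa> k) h \<noteq> 0"
  shows "act1 h k = jj \<kappa>"
proof (cases "k = 0")
  case True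
  have "Vinv c \<kappa> 0 = bmul (bscale (ve \<kappa>) (bmono z 0)) c"
    unfolding bmul_bscale_one by (simp add: Vinv_def bscale_def gscale_def rho_inv_def)
  then have "mm (Vinv c) (Diag (LZ a)) \<kappa> k = bscale (ve \<kappa>) (bmono z 0)"
    using True by (simp add: mm_Diag_right LZ_def bmul_assoc bscale_B00 a c ca) (simp add: bmul_bscale_one)
  then have "ve \<kappa> \<noteq> 0" "h = (Even, 0)"
    using assms ev_bmono_nonzero[of 0 h] by (auto simp: bscale_gscale ev_gscale)
  then show ?thesis using True by (auto simp: ve_def jj_def split: if_splits)
next
  case False
  then have "LZ a k = bmono z (nu k - k)" by (auto simp: LZ_def nu_def)
  then have "ev (Vinv c \<kappa> k) (gm h (Even, - (nu k - k))) \<noteq> 0"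
    using assms by (auto simp: mm_Diag_right bmul_bmono_right ev_rsh)
  then have "rho_inv \<kappa> k (gm h (Even, - (nu k - k))) \<noteq> 0" by (auto simp: Vinv_def ev_gscale)
  then have "act1 (gm h (Even, - (nu k - k))) (nu k) = jj \<kappa>" using False by (auto simp: rho_inv_def)
  then show ?thesis by (simp add: act1_gm) (simp add: act1_def)
qed

lemma N_zero_entries:
  "\<exists>u\<in>A Even. \<exists>v\<in>A Odd. \<exists>u'\<in>A Even. \<exists>v'\<in>A Odd.
    Nmat A z a 0 (ix 0 n) (ix 0 k) = hmul z 0 (embA u v) (hpow z 0 1 (1/2)) + hmul z 0 (embA u' v') (hpow z 0 1 (-1/2))"
proof -
  let ?P = "Psi 0 0 0 (Nmat A z a 0) n k"
  let ?S = "{(Even, n - k), (Even, n - k - 1), (Odd, n + k), (Odd, n + k + 1)}"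
  have supp: "ev ?P u = 0" if "u \<notin> ?S" for u
  proof -
    have "ev (mm (Vmat a 0) (mm (Vinv c) (Diag (LZ a))) n k) u = 0"
    proof (rule mm_support[OF tms(1) tm_mm[OF tms(2,5)] _ that])
      fix l g h assume g: "ev (Vmat a 0 n l) g \<noteq> 0" and h: "ev (mm (Vinv c) (Diag (LZ a)) l k) h \<noteq> 0"
      have "act g l = n" using g by (auto simp: Vmat_def ev_gscale rho_zero)
      moreover have "act1 h k = jj l" by (rule Vinv_LZ_support[OF h])
      ultimately show "gm g h \<in> ?S"
        by (cases "fst g"; cases "fst h") (auto simp: gm_def act_def act1_def jj_def split: if_splits)
    qed
    then show ?thesis by (simp only: Psi_Nmat mm_assoc tms)
  qed
  have e: "Nmat A z a 0 (ix 0 n) (ix 0 k) = lsh (- n) (rsh k ?P)"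
    by (subst entry_Psi[of _ _ _ _ _ 0]) simp
  have E: "Nmat A z a 0 (ix 0 n) (ix 0 k) s m = 0"
    if "gm (gm (Even, n) (s, m)) (Even, - k) \<notin> ?S" for s m
  proof -
    have "ev (lsh (- n) (rsh k ?P)) (s, m) = 0"
      using supp[OF that] by (simp del: ev_pair add: ev_lsh ev_rsh)
    then show ?thesis by (simp add: e)
  qed
  show ?thesis
    by (rule two_diagonals[OF tm_entry_B00[OF tm_N]]; rule E) (auto simp: gm_def)
qed

lemma N_special:
  assumes X: "\<And>\<theta> n k. M \<theta> (ix 0 n) (ix 0 k) = Rot b (\<sigma> * \<theta>/2) n k"
    and rho: "\<And>\<theta> n \<kappa> g. ev a g \<noteq> 0 \<Longrightarrow> rho \<theta> n \<kappa> g = Rot b (\<sigma> * \<theta>/2) n (f \<kappa>)"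
    and L: "\<And>n k. n \<noteq> k \<Longrightarrow> n = b \<or> n = b + 1 \<Longrightarrow> k = b \<or> k = b + 1 \<Longrightarrow> LZ a k = rsh (n - k) (LZ a n)"
  shows "mat_eq 0 0 (Nmat A z a \<theta>)
    (mmul z 0 1 (mmul z 0 1 (Lmat z a) (remb z 1 (M \<theta>))) (remb z 1 (rinv 0 (M (pi/2)))))"
proof -
  define E where "E = Rot b (\<sigma> * \<theta>/2 + - (\<sigma> * (pi/2)/2))"
  have B: "remb z 1 M' (ix p n) (ix q k) \<in> B00 A z" for M' p q n k
    by (simp add: remb_def hpow_def bscale_B00)
  have LB: "Lmat z a (ix 0 n) (ix 0 k) \<in> B00 A z" for n k
    by (rule tm_entry_B00[of 0 0 0]) (simp add: Psi_Lmat tms)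
  have R1: "Psi 0 0 1 (remb z 1 (M \<theta>)) = (\<lambda>n k. bscale (Rot b (\<sigma> * \<theta>/2) n k) (bmono z (n - k)))"
    by (intro ext) (simp add: Psi_remb X)
  have R2: "Psi 0 0 1 (remb z 1 (rinv 0 (M (pi/2)))) = (\<lambda>n k. bscale (Rot b (- (\<sigma> * (pi/2)/2)) n k) (bmono z (n - k)))"
    by (intro ext) (simp only: Psi_remb rinv_Rot[OF X])
  have 1: "Psi 0 0 0 (mmul z 0 1 (Lmat z a) (remb z 1 (M \<theta>))) = mm (Diag (LZ a)) (\<lambda>n k. bscale (Rot b (\<sigma> * \<theta>/2) n k) (bmono z (n - k)))"
    unfolding R1[symmetric] Psi_Lmat[symmetric] by (rule mmul_Psi) (rule LB, rule B)
  have LZB: "LZ a n \<in> B00 A z" for n by (simp add: LZ_def a)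
  have "Psi 0 0 0 (mmul z 0 1 (Lmat z a) (remb z 1 (M \<theta>))) n k \<in> B00 A z" for n k
  proof -
    have "bscale r (bmono z d) \<in> B00 A z" for r d by (simp add: bscale_B00)
    then show ?thesis unfolding 1 mm_Diag_left by (intro bmul_B00 LZB)
  qed
  then have MB: "mmul z 0 1 (Lmat z a) (remb z 1 (M \<theta>)) (ix 0 n) (ix 0 k) \<in> B00 A z" for n k
    by (subst entry_Psi[of _ _ _ _ _ 0]) simp
  have "Psi 0 0 0 (mmul z 0 1 (mmul z 0 1 (Lmat z a) (remb z 1 (M \<theta>))) (remb z 1 (rinv 0 (M (pi/2)))))
     = mm (mm (Diag (LZ a)) (\<lambda>n k. bscale (Rot b (\<sigma> * \<theta>/2) n k) (bmono z (n - k))))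
         (\<lambda>n k. bscale (Rot b (- (\<sigma> * (pi/2)/2)) n k) (bmono z (n - k)))"
    unfolding R2[symmetric] 1[symmetric] by (rule mmul_Psi) (rule MB, rule B)
  also have "\<dots> = (\<lambda>n k. bscale (E n k) (rsh (n - k) (LZ a n)))"
    unfolding E_def by (intro ext) (simp only: Tw_product[OF LZB Rot_mult_has_sum])
  also have "\<dots> = mm (emb E) (Diag (LZ a))"
  proof (intro ext)
    fix n k s m
    have "E n k = 0 \<or> LZ a k = rsh (n - k) (LZ a n)"
    proof (cases "n = k \<or> (n = b \<or> n = b + 1) \<and> (k = b \<or> k = b + 1)")
      case True
      then show ?thesis using L[of n k] by (cases "n = k") auto
    next
      case False
      then show ?thesis by (auto simp: E_def Rot_def)
    qed
    then show "bscale (E n k) (rsh (n - k) (LZ a n)) s m = mm (emb E) (Diag (LZ a)) n k s m"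
      by (auto simp: mm_Diag_right emb_def bmul_bscale_one)
  qed
  also have "\<dots> = Psi 0 0 0 (Nmat A z a \<theta>)"
  proof -
    have tmE: "tm (emb E)" unfolding E_def by (rule tm_emb_Rot)
    have "mm (\<lambda>n k. gscale ((\<lambda>n k g. E n k) n k) (bmono z 0)) (\<lambda>n k. gscale (rho (pi/2) n k) a)
       = (\<lambda>n k. gscale (rho \<theta> n k) (bmul (bmono z 0) a))"
    proof (rule mm_gscale)
      fix n k g h assume "ev (bmono z 0) g \<noteq> 0" and h: "ev a h \<noteq> 0"
      then have "gm g h = h" using ev_bmono_nonzero by fastforce
      moreover have "((\<lambda>l. E n l * Rot b (\<sigma> * (pi/2)/2) l (f k)) has_sum Rot b (\<sigma> * \<theta>/2) n (f k)) UNIV"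
        using Rot_mult_has_sum[of b "\<sigma> * \<theta>/2 + - (\<sigma> * (pi/2)/2)" n "\<sigma> * (pi/2)/2" "f k"] by (simp add: E_def)
      ultimately show "((\<lambda>l. E n l * rho (pi/2) l k h) has_sum rho \<theta> n k (gm g h)) UNIV"
        using rho[OF h] by simp
    qed (use a tmE tms(1)[of "pi/2"] in \<open>auto simp: emb_def[abs_def] bscale_gscale Vmat_def[abs_def]\<close>)
    then have EV: "mm (emb E) (Vmat a (pi/2)) = Vmat a \<theta>"
      by (simp add: emb_def[abs_def] bscale_gscale bmul_bmono_left Vmat_def[abs_def])
    have "mm (Vmat a \<theta>) (Vinv c) = mm (emb E) (mm (Vmat a (pi/2)) (Vinv c))"
      unfolding EV[symmetric] by (rule mm_assoc[OF tmE tms(1,2)])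
    then show ?thesis by (simp add: Psi_Nmat Vmat_Vinv[OF a c ac])
  qed
  finally show ?thesis by (simp add: Psi_eq_iff[of 0 0 0, symmetric])
qed

end

lemma (in loop_algebra) N_special_plus:
  "mat_eq 0 0 (Nmat A z (hpow z 0 1 (1/2)) \<theta>)
     (mmul z 0 1 (mmul z 0 1 (Lmat z (hpow z 0 1 (1/2))) (remb z 1 (Aprime (1/2) \<theta>)))
       (remb z 1 (rinv 0 (Aprime (1/2) (pi/2)))))"
proof -
  have h: "hpow z 0 1 (1/2) = bmono z 0" by (simp add: hpow_def)
  interpret invertible_loop A z "bmono z 0" "bmono z 0"
    by unfold_locales (simp_all add: bmul_bmono_left)
  show ?thesis
    unfolding h
  proof (rule N_special[where b = 0 and \<sigma> = 1 and f = "\<lambda>\<kappa>. \<kappa>"])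
    show "Aprime (1/2) \<theta> (ix 0 n) (ix 0 k) = Rot 0 (1 * \<theta>/2) n k" for \<theta> n k
      by (simp add: Aprime_ix(1))
    show "rho \<theta> n \<kappa> g = Rot 0 (1 * \<theta>/2) n \<kappa>" if "ev (bmono z 0) g \<noteq> 0" for \<theta> n \<kappa> g
      using ev_bmono_nonzero[OF that] by (simp add: rho_Even_0)
  qed (auto simp: LZ_def rsh_bmono)
qed

lemma (in loop_algebra) N_special_minus:
  "mat_eq 0 0 (Nmat A z (hpow z 0 1 (-1/2)) \<theta>)
     (mmul z 0 1 (mmul z 0 1 (Lmat z (hpow z 0 1 (-1/2))) (remb z 1 (Aprime (-1/2) (- \<theta>))))
       (remb z 1 (rinv 0 (Aprime (-1/2) (- (pi/2))))))"
proof -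
  have h: "hpow z 0 1 (-1/2) = bmono z (-1)" by (simp add: hpow_def)
  interpret invertible_loop A z "bmono z (-1)" "bmono z 1"
    by unfold_locales (simp_all add: bmul_bmono_left lsh_bmono)
  show ?thesis
    unfolding h
  proof (rule N_special[where M = "\<lambda>\<theta>. Aprime (-1/2) (- \<theta>)" and b = "-1" and \<sigma> = "-1" and f = "\<lambda>\<kappa>. \<kappa> - 1"])
    show "Aprime (-1/2) (- \<theta>) (ix 0 n) (ix 0 k) = Rot (-1) (-1 * \<theta>/2) n k" for \<theta> n k
      using Aprime_ix(2)[of "- \<theta>" n k] by simp
    show "rho \<theta> n \<kappa> g = Rot (-1) (-1 * \<theta>/2) n (\<kappa> - 1)" if "ev (bmono z (-1)) g \<noteq> 0" for \<theta> n \<kappa> g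
      using ev_bmono_nonzero[OF that] by (simp add: rho_Even_m1)
  qed (auto simp: LZ_def rsh_bmono)
qed

theorem theorem7p5:
  fixes A :: "parity \<Rightarrow> 'a::topological_real_algebra_1 set" and z :: 'a and a :: "'a series"
  assumes "loop_algebra A z"
    and "a \<in> B00 A z" and "invertible01 A z a"
  shows
    \<comment> \<open>the matrices entering N are well-defined, and the two expressions for N agree\<close>
    "(Udef_extends A z a \<and>
      (\<exists>M'. is_minv A z 0 1 1 (Uhat z a) M') \<and>
      (\<exists>M'. is_minv A z 0 1 0 (Udef z a (pi/2)) M') \<and>
      (\<forall>\<theta>. mat_eq 0 0 (Nmat A z a \<theta>)
         (mmul z 0 0 (mmul z 1 0 (Udef z a \<theta>) (minv A z 0 1 0 (Udef z a (pi/2)))) (Lmat z a))))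
     \<and> \<comment> \<open>(i)\<close>
     (\<forall>\<theta>. (\<forall>n\<in>ZZ 0. \<forall>k\<in>ZZ 0. Nmat A z a \<theta> n k \<in> B00 A z) \<and>
        rapidly_decreasing_mat A z (Nmat A z a \<theta> - Lmat z 0))
     \<and> \<comment> \<open>(ii)\<close>
     (mat_eq 0 0 (Nmat A z a 0)
        (mmul z 1 1 (mmul z 1 0 (Umat z 0 a) (Lmat1 z)) (minv A z 0 1 1 (Uhat z a))) \<and>
      (\<forall>n\<in>ZZ 0. \<forall>k\<in>ZZ 0. \<exists>u\<in>A Even. \<exists>v\<in>A Odd. \<exists>u'\<in>A Even. \<exists>v'\<in>A Odd.
         Nmat A z a 0 n k = hmul z 0 (embA u v) (hpow z 0 1 (1/2))
                          + hmul z 0 (embA u' v') (hpow z 0 1 (-1/2))))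
     \<and> \<comment> \<open>(iii)\<close>
     mat_eq 0 0 (Nmat A z a (pi/2)) (Lmat z a)
     \<and> \<comment> \<open>(iv)\<close>
     (\<forall>\<theta>. mat_eq 0 0 (Nmat A z (hpow z 0 1 (1/2)) \<theta>)
        (mmul z 0 1 (mmul z 0 1 (Lmat z (hpow z 0 1 (1/2))) (remb z 1 (Aprime (1/2) \<theta>)))
           (remb z 1 (rinv 0 (Aprime (1/2) (pi/2))))))
     \<and>
     (\<forall>\<theta>. mat_eq 0 0 (Nmat A z (hpow z 0 1 (-1/2)) \<theta>)
        (mmul z 0 1 (mmul z 0 1 (Lmat z (hpow z 0 1 (-1/2))) (remb z 1 (Aprime (-1/2) (- \<theta>))))
           (remb z 1 (rinv 0 (Aprime (-1/2) (- (pi/2)))))))"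
proof -
  interpret loop_algebra A z by fact
  from assms(3) obtain c where "c \<in> B00 A z" "bmul a c = bmono z 0" "bmul c a = bmono z 0"
    by (auto simp: invertible01_iff)
  then interpret invertible_loop A z a c
    using assms(2) by unfold_locales auto
  show ?thesis
  proof (intro conjI allI)
    show "\<exists>M'. is_minv A z 0 1 1 (Uhat z a) M'" using minv_Uhat(1) by blast
    show "\<exists>M'. is_minv A z 0 1 0 (Udef z a (pi/2)) M'" using minv_Udef(1) by blast
    show "\<forall>n\<in>ZZ 0. \<forall>k\<in>ZZ 0. Nmat A z a \<theta> n k \<in> B00 A z" for \<theta>
      unfolding ZZ_ix using N_rapid(1) by blast
    show "\<forall>n\<in>ZZ 0. \<forall>k\<in>ZZ 0. \<exists>u\<in>A Even. \<exists>v\<in>A Odd. \<exists>u'\<in>A Even. \<exists>v'\<in>A Odd.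
         Nmat A z a 0 n k = hmul z 0 (embA u v) (hpow z 0 1 (1/2)) + hmul z 0 (embA u' v') (hpow z 0 1 (-1/2))"
      unfolding ZZ_ix using N_zero_entries by blast
  qed (rule Udef_extends[OF a] N_two_expressions N_rapid(2) N_zero N_half_pi N_special_plus N_special_minus)+
qed

end
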